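(* In the Cahiers topos $\mathcal C$, the subobject $\mathcal D(R)$ of $R^R$ is exactly $h(\mathcal D(\mathbf R))$ (where $R^R$ is identified with $h(C^\infty(\mathbf R))$, and $h(\mathcal D(\mathbf R))$ maps to it by $h$ applied to the inclusion $\mathcal D(\mathbf R)\subseteq C^\infty(\mathbf R)$).
   Context: Weil and semi-Weil ideals: let $\mathcal M^r\subseteq C^\infty(\mathbf R^l)$ be the ideal of functions vanishing to order $r$ at $0$ (all partial derivatives of order $<r$ vanish at $0$). A Weil ideal is a proper ideal $I\subseteq C^\infty(\mathbf R^l)$ containing some $\mathcal M^r$. A semi-Weil ideal is an ideal $J=p^*(I)\subseteq C^\infty(\mathbf R^{l+k})$ consisting of the finite sums $\sum (h_i\circ p)\cdot k_i$ with $h_i\in I$, $k_i\in C^\infty(\mathbf R^{l+k})$, where $I$ is a Weil ideal and $p:\mathbf R^{l+k}\to\mathbf R^l$ is the projection. Cahiers topos: $\mathcal C$ is the topos of sheaves on the site whose category is dual to the category of $C^\infty$-rings of the form $C^\infty(\mathbf R^{l+k})/J$ with $J$ semi-Weil, and whose coverings are induced by open coverings in the $\mathbf R^k$-direction (jointly surjective families of open embeddings $\mathbf R^k\to\mathbf R^k$, with the Weil algebra unchanged). The object $R$ is the sheaf $A\mapsto$ underlying set of $A$; $R_{>0}\subseteq R$ is the subobject represented by the manifold $\mathbf R_{>0}$ (at stage $C^\infty(\mathbf R^{l+k})/J$: classes of $f$ with $f(0,t)>0$ for all $t\in\mathbf R^k$), and $x<y$ means $y-x\in R_{>0}$. Embedding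 $h$: a convenient vector space (CVS) is a separated, bornological, Mackey-complete locally convex space $X$, with $X'$ its continuous linear functionals; a map $g:\mathbf R^n\to X$ is smooth iff $\phi\circ g$ is smooth for all $\phi\in X'$. Put $J(X)=\{g\in C^\infty(\mathbf R^{l+k},X)\mid \phi\circ g\in J\ \forall\phi\in X'\}$. The functor $h$ from the category of CVS's and smooth maps (maps taking smooth plots to smooth plots) to $\mathcal C$ is given by $h(X)(C^\infty(\mathbf R^{l+k})/J)=C^\infty(\mathbf R^{l+k},X)/J(X)$ and by composition on maps; it is full and faithful, $h(\mathbf R)=R$, and it preserves exponentials, so $R^R=h(C^\infty(\mathbf R))$. $\mathcal D(\mathbf R)\subseteq C^\infty(\mathbf R)$ is the CVS of smooth functions of compact support with Schwartz's inductive limit topology. Its internal counterpart $\mathcal D(R)\subseteq R^R$ is the extension in $\mathcal C$ (internal language) of the formula $\exists b>0\,[\forall x\,(x<-b\vee x>b)\Rightarrow f(x)=0]$ with $f$ ranging over $R^R$. *)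

theory Defs
  imports
    "HOL-Analysis.Analysis"
    "HOL-Algebra.QuotRing"
    "HOL-Library.Function_Algebras"
begin

section \<open>Smooth functions on Euclidean spaces of varying dimension\<close>

text \<open>
  A point of \<open>R^n\<close> is given by the first \<open>n\<close> coordinates of a sequence of reals, and a function on
  \<open>R^n\<close> is a function of sequences that depends on these coordinates only. For such functions
  continuity for the product topology is continuity on \<open>R^n\<close>, and precomposition with the projection
  \<open>R^(l+k) \<rightarrow> R^l\<close> onto the first \<open>l\<close> coordinates leaves the function of sequences unchanged.
  A smooth map into \<open>R^n\<close> may have arbitrary values in the coordinates from \<open>n\<close> on.
\<close>

type_synonym pt = "nat \<Rightarrow> real"

definition pd :: "nat \<Rightarrow> (pt \<Rightarrow> real) \<Rightarrow> pt \<Rightarrow> real" where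
  "pd i f = (\<lambda>x. deriv (\<lambda>t. f (x(i := t))) (x i))"

definition pds :: "nat list \<Rightarrow> (pt \<Rightarrow> real) \<Rightarrow> pt \<Rightarrow> real" where
  "pds is f = fold pd is f"

text \<open>For an open set \<open>U\<close> of \<open>R^n\<close>: all iterated partial derivatives exist and are continuous.\<close>

definition smooth_on :: "nat \<Rightarrow> pt set \<Rightarrow> (pt \<Rightarrow> real) \<Rightarrow> bool" where
  "smooth_on n U f \<longleftrightarrow>
     (\<forall>x\<in>U. \<forall>y\<in>U. (\<forall>i<n. x i = y i) \<longrightarrow> f x = f y) \<and>
     (\<forall>is. set is \<subseteq> {..<n} \<longrightarrow>
        continuous_on U (pds is f) \<and>
        (\<forall>i<n. \<forall>x\<in>U. (\<lambda>t. pds is f (x(i := t))) differentiable (at (x i))))"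

definition Cinf :: "nat \<Rightarrow> (pt \<Rightarrow> real) set" where
  "Cinf n = {f. smooth_on n UNIV f}"

definition Cinf_ring :: "nat \<Rightarrow> (pt \<Rightarrow> real) ring" where
  "Cinf_ring n = \<lparr>carrier = Cinf n, monoid.mult = (\<lambda>f g x. f x * g x), one = (\<lambda>_. 1),
                  zero = (\<lambda>_. 0), add = (\<lambda>f g x. f x + g x)\<rparr>"

section \<open>Weil and semi-Weil ideals\<close>

definition vanishing_ideal :: "nat \<Rightarrow> nat \<Rightarrow> (pt \<Rightarrow> real) set" where
  "vanishing_ideal l r =
     {f \<in> Cinf l. \<forall>is. set is \<subseteq> {..<l} \<and> length is < r \<longrightarrow> pds is f (\<lambda>_. 0) = 0}"

definition weil_ideal :: "nat \<Rightarrow> (pt \<Rightarrow> real) set \<Rightarrow> bool" where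
  "weil_ideal l I \<longleftrightarrow>
     ideal I (Cinf_ring l) \<and> I \<noteq> Cinf l \<and> (\<exists>r. vanishing_ideal l r \<subseteq> I)"

text \<open>The factors \<open>h i\<close> stand for \<open>h i \<circ> p\<close>, see the encoding of functions above.\<close>

definition pullback_ideal :: "nat \<Rightarrow> nat \<Rightarrow> (pt \<Rightarrow> real) set \<Rightarrow> (pt \<Rightarrow> real) set" where
  "pullback_ideal l k I =
     {f. \<exists>(m::nat) h g. (\<forall>i<m. h i \<in> I \<and> g i \<in> Cinf (l + k)) \<and>
                        f = (\<lambda>x. \<Sum>i<m. h i x * g i x)}"

section \<open>The site\<close>

text \<open>
  A stage is an object \<open>C^\<infinity>(R^(l+k))/J\<close>; coordinates \<open>0, ..., l-1\<close> are the infinitesimal (Weil)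
  ones and \<open>l, ..., l+k-1\<close> are those of the \<open>R^k\<close>-direction.
\<close>

record stage =
  ldim :: nat
  kdim :: nat
  sideal :: "(pt \<Rightarrow> real) set"

abbreviation sdim :: "stage \<Rightarrow> nat" where
  "sdim A \<equiv> ldim A + kdim A"

definition site_obj :: "stage set" where
  "site_obj = {A. \<exists>I. weil_ideal (ldim A) I \<and> sideal A = pullback_ideal (ldim A) (kdim A) I}"

type_synonym elt = "(pt \<Rightarrow> real) set"
type_synonym hom = "elt \<Rightarrow> elt"

definition alg :: "stage \<Rightarrow> elt ring" where
  "alg A = Cinf_ring (sdim A) Quot sideal A"

definition cls :: "stage \<Rightarrow> (pt \<Rightarrow> real) \<Rightarrow> elt" where
  "cls A f = sideal A +>\<^bsub>Cinf_ring (sdim A)\<^esub> f"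

definition rep :: "'x set \<Rightarrow> 'x" where
  "rep c = (SOME f. f \<in> c)"

text \<open>The operation of the \<open>C^\<infinity>\<close>-ring \<open>alg A\<close> given by a smooth \<open>\<theta>\<close> on \<open>R^m\<close>, applied to
  \<open>a 0, ..., a (m-1)\<close>.\<close>

definition smooth_op :: "stage \<Rightarrow> (pt \<Rightarrow> real) \<Rightarrow> (nat \<Rightarrow> elt) \<Rightarrow> elt" where
  "smooth_op A \<theta> a = cls A (\<lambda>s. \<theta> (\<lambda>i. rep (a i) s))"

text \<open>\<open>C^\<infinity>\<close>-ring homomorphisms \<open>alg A \<rightarrow> alg B\<close>, that is, morphisms \<open>B \<rightarrow> A\<close> of the site.\<close>

definition Hom :: "stage \<Rightarrow> stage \<Rightarrow> hom set" where
  "Hom A B =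
     {u \<in> carrier (alg A) \<rightarrow>\<^sub>E carrier (alg B).
        \<forall>m \<theta> a. \<theta> \<in> Cinf m \<and> (\<forall>i<m. a i \<in> carrier (alg A)) \<longrightarrow>
          u (smooth_op A \<theta> a) = smooth_op B \<theta> (\<lambda>i. u (a i))}"

definition hom_id :: "stage \<Rightarrow> hom" where
  "hom_id A = (\<lambda>a\<in>carrier (alg A). a)"

definition hom_comp :: "stage \<Rightarrow> hom \<Rightarrow> hom \<Rightarrow> hom" where
  "hom_comp A v u = compose (carrier (alg A)) v u"

text \<open>A smooth map \<open>R^(sdim B) \<rightarrow> R^(sdim A)\<close> inducing \<open>u \<in> Hom A B\<close>: its components represent the
  images under \<open>u\<close> of the coordinate functions.\<close>

definition hom_map :: "stage \<Rightarrow> hom \<Rightarrow> pt \<Rightarrow> pt" where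
  "hom_map A u s = (\<lambda>i. if i < sdim A then rep (u (cls A (\<lambda>x. x i))) s else 0)"

text \<open>The image as a set of sequences with arbitrary coordinates from \<open>k\<close> on.\<close>

definition emb_image :: "nat \<Rightarrow> (pt \<Rightarrow> pt) \<Rightarrow> pt set" where
  "emb_image k e = {y. \<exists>x. \<forall>i<k. y i = e x i}"

text \<open>Open embeddings \<open>R^k \<rightarrow> R^k\<close> of manifolds: diffeomorphisms onto an open subset.\<close>

definition open_embedding :: "nat \<Rightarrow> (pt \<Rightarrow> pt) \<Rightarrow> bool" where
  "open_embedding k e \<longleftrightarrow>
     (\<forall>i<k. (\<lambda>x. e x i) \<in> Cinf k) \<and> open (emb_image k e) \<and>
     (\<exists>g. (\<forall>i<k. smooth_on k (emb_image k e) (\<lambda>y. g y i)) \<and>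
          (\<forall>x. \<forall>i<k. g (e x) i = x i))"

text \<open>Since \<open>sideal A\<close> is pulled back along the projection that forgets \<open>R^k\<close>, the members of a
  cover of \<open>A\<close> have domain \<open>A\<close> again; they are induced by \<open>id \<times> e\<close> on \<open>R^l \<times> R^k\<close>.\<close>

definition cover_hom :: "stage \<Rightarrow> (pt \<Rightarrow> pt) \<Rightarrow> hom" where
  "cover_hom A e =
     (\<lambda>a\<in>carrier (alg A). cls A (\<lambda>s. rep a (\<lambda>i. if i < ldim A then s i
                                            else e (\<lambda>j. s (ldim A + j)) (i - ldim A))))"

definition covers :: "stage \<Rightarrow> (stage \<times> hom) set set" where
  "covers A =
     {{(A, cover_hom A e) |e. e \<in> E} |E.
        (\<forall>e\<in>E. open_embedding (kdim A) e) \<and> (\<Union>e\<in>E. emb_image (kdim A) e) = UNIV}"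

section \<open>Presheaves on the site\<close>

text \<open>Sections, and the action \<open>F(A) \<rightarrow> F(B)\<close> of \<open>u \<in> Hom A B\<close>. Products, exponentials and
  monomorphisms of sheaves are those of the underlying presheaves.\<close>

record 'a psh =
  sec :: "stage \<Rightarrow> 'a set"
  act :: "stage \<Rightarrow> stage \<Rightarrow> hom \<Rightarrow> 'a \<Rightarrow> 'a"

definition psh_map :: "'a psh \<Rightarrow> 'b psh \<Rightarrow> (stage \<Rightarrow> 'a \<Rightarrow> 'b) \<Rightarrow> bool" where
  "psh_map F G \<eta> \<longleftrightarrow>
     (\<forall>A\<in>site_obj. \<forall>a\<in>sec F A. \<eta> A a \<in> sec G A) \<and>
     (\<forall>A\<in>site_obj. \<forall>B\<in>site_obj. \<forall>u\<in>Hom A B. \<forall>a\<in>sec F A.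
        \<eta> B (act F A B u a) = act G A B u (\<eta> A a))"

definition psh_mono :: "'a psh \<Rightarrow> 'b psh \<Rightarrow> (stage \<Rightarrow> 'a \<Rightarrow> 'b) \<Rightarrow> bool" where
  "psh_mono F G \<eta> \<longleftrightarrow> psh_map F G \<eta> \<and> (\<forall>A\<in>site_obj. inj_on (\<eta> A) (sec F A))"

definition psh_prod :: "'a psh \<Rightarrow> 'b psh \<Rightarrow> ('a \<times> 'b) psh" where
  "psh_prod F G = \<lparr>sec = (\<lambda>A. sec F A \<times> sec G A),
                   act = (\<lambda>A B u (a, b). (act F A B u a, act G A B u b))\<rparr>"

text \<open>The exponential \<open>G^F\<close>: its sections at \<open>A\<close> are the natural transformations
  \<open>Hom A (-) \<times> F \<rightarrow> G\<close>, made extensional by the value \<open>undefined\<close>.\<close>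

definition psh_exp :: "'a psh \<Rightarrow> 'b psh \<Rightarrow> (stage \<Rightarrow> hom \<Rightarrow> 'a \<Rightarrow> 'b) psh" where
  "psh_exp F G =
     \<lparr>sec = (\<lambda>A. {\<tau>.
        (\<forall>B\<in>site_obj. \<forall>u\<in>Hom A B. \<forall>x\<in>sec F B. \<tau> B u x \<in> sec G B) \<and>
        (\<forall>B\<in>site_obj. \<forall>C\<in>site_obj. \<forall>u\<in>Hom A B. \<forall>v\<in>Hom B C. \<forall>x\<in>sec F B.
           \<tau> C (hom_comp A v u) (act F B C v x) = act G B C v (\<tau> B u x)) \<and>
        (\<forall>B u x. \<not> (B \<in> site_obj \<and> u \<in> Hom A B \<and> x \<in> sec F B) \<longrightarrow> \<tau> B u x = undefined)}),
      act = (\<lambda>A A' v \<tau> B u x.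
        if B \<in> site_obj \<and> u \<in> Hom A' B \<and> x \<in> sec F B then \<tau> B (hom_comp A u v) x
        else undefined)\<rparr>"

definition line :: "elt psh" where
  "line = \<lparr>sec = (\<lambda>A. carrier (alg A)), act = (\<lambda>A B u a. u a)\<rparr>"

definition line_pos :: "stage \<Rightarrow> elt set" where
  "line_pos A = {cls A f |f. f \<in> Cinf (sdim A) \<and> (\<forall>x. (\<forall>i<ldim A. x i = 0) \<longrightarrow> f x > 0)}"

section \<open>Internal language\<close>

text \<open>
  Kripke--Joyal forcing for the coverage \<open>covers\<close>. A term or formula is interpreted at a stage and
  at a section of its context \<open>\<Gamma>\<close>; contexts are extended to the right by products.
\<close>

type_synonym ('c, 'a) trm = "stage \<Rightarrow> 'c \<Rightarrow> 'a"
type_synonym 'c fml = "stage \<Rightarrow> 'c \<Rightarrow> bool"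

definition kj_or :: "'c psh \<Rightarrow> 'c fml \<Rightarrow> 'c fml \<Rightarrow> 'c fml" where
  "kj_or \<Gamma> P Q A c \<longleftrightarrow>
     (\<exists>S\<in>covers A. \<forall>(B, u)\<in>S. P B (act \<Gamma> A B u c) \<or> Q B (act \<Gamma> A B u c))"

definition kj_and :: "'c fml \<Rightarrow> 'c fml \<Rightarrow> 'c fml" where
  "kj_and P Q A c \<longleftrightarrow> P A c \<and> Q A c"

definition kj_imp :: "'c psh \<Rightarrow> 'c fml \<Rightarrow> 'c fml \<Rightarrow> 'c fml" where
  "kj_imp \<Gamma> P Q A c \<longleftrightarrow>
     (\<forall>B\<in>site_obj. \<forall>u\<in>Hom A B. P B (act \<Gamma> A B u c) \<longrightarrow> Q B (act \<Gamma> A B u c))"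

definition kj_all :: "'c psh \<Rightarrow> 'a psh \<Rightarrow> ('c \<times> 'a) fml \<Rightarrow> 'c fml" where
  "kj_all \<Gamma> F P A c \<longleftrightarrow>
     (\<forall>B\<in>site_obj. \<forall>u\<in>Hom A B. \<forall>x\<in>sec F B. P B (act \<Gamma> A B u c, x))"

definition kj_ex :: "'c psh \<Rightarrow> 'a psh \<Rightarrow> ('c \<times> 'a) fml \<Rightarrow> 'c fml" where
  "kj_ex \<Gamma> F P A c \<longleftrightarrow>
     (\<exists>S\<in>covers A. \<forall>(B, u)\<in>S. \<exists>x\<in>sec F B. P B (act \<Gamma> A B u c, x))"

definition kj_eq :: "('c, 'a) trm \<Rightarrow> ('c, 'a) trm \<Rightarrow> 'c fml" where
  "kj_eq s t A c \<longleftrightarrow> s A c = t A c"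

definition kj_less :: "('c, elt) trm \<Rightarrow> ('c, elt) trm \<Rightarrow> 'c fml" where
  "kj_less s t A c \<longleftrightarrow> t A c \<ominus>\<^bsub>alg A\<^esub> s A c \<in> line_pos A"

definition kj_zero :: "('c, elt) trm" where
  "kj_zero A c = \<zero>\<^bsub>alg A\<^esub>"

definition kj_neg :: "('c, elt) trm \<Rightarrow> ('c, elt) trm" where
  "kj_neg s A c = \<ominus>\<^bsub>alg A\<^esub> s A c"

definition kj_app ::
  "('c, stage \<Rightarrow> hom \<Rightarrow> 'a \<Rightarrow> 'b) trm \<Rightarrow> ('c, 'a) trm \<Rightarrow> ('c, 'b) trm" where
  "kj_app f t A c = f A c A (hom_id A) (t A c)"

definition extension :: "'c psh \<Rightarrow> 'c fml \<Rightarrow> stage \<Rightarrow> 'c set" where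
  "extension \<Gamma> P A = {c \<in> sec \<Gamma> A. P A c}"

abbreviation line_fun :: "(stage \<Rightarrow> hom \<Rightarrow> elt \<Rightarrow> elt) psh" where
  "line_fun \<equiv> psh_exp line line"

text \<open>The formula \<open>\<exists>b>0. \<forall>x. (x < -b \<or> x > b) \<Rightarrow> f(x) = 0\<close>, with context \<open>f\<close>, then \<open>(f, b)\<close>,
  then \<open>((f, b), x)\<close>.\<close>

definition bounded_support_fml :: "(stage \<Rightarrow> hom \<Rightarrow> elt \<Rightarrow> elt) fml" where
  "bounded_support_fml =
     kj_ex line_fun line
       (kj_and
         (kj_less kj_zero (\<lambda>_ (f, b). b))
         (kj_all (psh_prod line_fun line) line
           (let b = (\<lambda>_ ((f, b), x). b); x = (\<lambda>_ ((f, b), x). x); f = (\<lambda>_ ((f, b), x). f);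
                \<Gamma> = psh_prod (psh_prod line_fun line) line
            in kj_imp \<Gamma>
                 (kj_or \<Gamma> (kj_less x (kj_neg b)) (kj_less b x))
                 (kj_eq (kj_app f x) kj_zero))))"

definition internal_D :: "stage \<Rightarrow> (stage \<Rightarrow> hom \<Rightarrow> elt \<Rightarrow> elt) set" where
  "internal_D = extension line_fun bounded_support_fml"

section \<open>Locally convex spaces and the embedding \<open>h\<close>\<close>

text \<open>A locally convex space is given by a topology on a linear subspace of a real vector space.\<close>

instantiation "fun" :: (type, real_vector) real_vector
begin

definition scaleR_fun :: "real \<Rightarrow> ('a \<Rightarrow> 'b) \<Rightarrow> 'a \<Rightarrow> 'b" where
  "scaleR_fun c f = (\<lambda>x. c *\<^sub>R f x)"

instance
  by standard (simp_all add: scaleR_fun_def fun_eq_iff scaleR_add_right scaleR_add_left)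

end

definition seminorm_on :: "'v::real_vector set \<Rightarrow> ('v \<Rightarrow> real) \<Rightarrow> bool" where
  "seminorm_on V p \<longleftrightarrow>
     (\<forall>x\<in>V. \<forall>y\<in>V. p (x + y) \<le> p x + p y) \<and> (\<forall>c. \<forall>x\<in>V. p (c *\<^sub>R x) = \<bar>c\<bar> * p x)"

definition seminorm_topology :: "'v::real_vector set \<Rightarrow> ('v \<Rightarrow> real) set \<Rightarrow> 'v topology" where
  "seminorm_topology V P =
     topology_generated_by {{y\<in>V. p (y - x) < \<epsilon>} |x p \<epsilon>. x \<in> V \<and> p \<in> P \<and> \<epsilon> > 0}"

definition dual :: "'v::real_vector topology \<Rightarrow> ('v \<Rightarrow> real) set" where
  "dual X =
     {\<phi>. (\<forall>x\<in>topspace X. \<forall>y\<in>topspace X. \<phi> (x + y) = \<phi> x + \<phi> y) \<and>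
         (\<forall>c. \<forall>x\<in>topspace X. \<phi> (c *\<^sub>R x) = c * \<phi> x) \<and>
         continuous_map X euclideanreal \<phi>}"

definition Cinf_into :: "nat \<Rightarrow> 'v::real_vector topology \<Rightarrow> (pt \<Rightarrow> 'v) set" where
  "Cinf_into n X =
     {g. range g \<subseteq> topspace X \<and> (\<forall>x y. (\<forall>i<n. x i = y i) \<longrightarrow> g x = g y) \<and>
         (\<forall>\<phi>\<in>dual X. (\<lambda>s. \<phi> (g s)) \<in> Cinf n)}"

definition ideal_into :: "stage \<Rightarrow> 'v::real_vector topology \<Rightarrow> (pt \<Rightarrow> 'v) set" where
  "ideal_into A X = {g \<in> Cinf_into (sdim A) X. \<forall>\<phi>\<in>dual X. (\<lambda>s. \<phi> (g s)) \<in> sideal A}"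

definition cls_into :: "stage \<Rightarrow> 'v::real_vector topology \<Rightarrow> (pt \<Rightarrow> 'v) \<Rightarrow> (pt \<Rightarrow> 'v) set" where
  "cls_into A X g = {g' \<in> Cinf_into (sdim A) X. (\<lambda>s. g' s - g s) \<in> ideal_into A X}"

definition h_obj :: "'v::real_vector topology \<Rightarrow> (pt \<Rightarrow> 'v) set psh" where
  "h_obj X = \<lparr>sec = (\<lambda>A. {cls_into A X g |g. g \<in> Cinf_into (sdim A) X}),
              act = (\<lambda>A B u c. cls_into B X (\<lambda>s. rep c (hom_map A u s)))\<rparr>"

definition h_map :: "'w::real_vector topology \<Rightarrow> ('v::real_vector \<Rightarrow> 'w) \<Rightarrow>
    stage \<Rightarrow> (pt \<Rightarrow> 'v) set \<Rightarrow> (pt \<Rightarrow> 'w) set" where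
  "h_map Y F A c = cls_into A Y (\<lambda>s. F (rep c s))"

section \<open>The spaces of smooth functions and of test functions on the real line\<close>

definition Cinf_line :: "(real \<Rightarrow> real) set" where
  "Cinf_line = {f. \<forall>n x. (deriv ^^ n) f differentiable (at x)}"

text \<open>Uniform convergence of all derivatives on compact sets.\<close>

definition smooth_space :: "(real \<Rightarrow> real) topology" where
  "smooth_space = seminorm_topology Cinf_line
     {(\<lambda>f. SUP x\<in>{- real r..real r}. \<bar>(deriv ^^ j) f x\<bar>) |j r. True}"

definition test_funs :: "(real \<Rightarrow> real) set" where
  "test_funs = {f \<in> Cinf_line. compact (closure {x. f x \<noteq> 0})}"

definition test_funs_in :: "real set \<Rightarrow> (real \<Rightarrow> real) set" where
  "test_funs_in K = {f \<in> Cinf_line. \<forall>x. x \<notin> K \<longrightarrow> f x = 0}"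

text \<open>The finest locally convex topology for which the inclusions of the Frechet spaces
  \<open>test_funs_in K\<close>, \<open>K\<close> compact, are continuous: it is defined by all seminorms with continuous
  restrictions to these subspaces.\<close>

definition test_space :: "(real \<Rightarrow> real) topology" where
  "test_space = seminorm_topology test_funs
     {p. seminorm_on test_funs p \<and>
         (\<forall>K. compact K \<longrightarrow>
            continuous_map (subtopology smooth_space (test_funs_in K)) euclideanreal p)}"

section \<open>Comparison of \<open>h\<close> of the space of smooth functions with the exponential \<open>R^R\<close>\<close>

text \<open>\<open>h\<close> of the evaluation map, composed with \<open>h(X) \<times> R = h(X \<times> R)\<close> and \<open>h(R) = R\<close>.\<close>

definition h_eval :: "stage \<Rightarrow> (pt \<Rightarrow> real \<Rightarrow> real) set \<Rightarrow> elt \<Rightarrow> elt" where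
  "h_eval B c x = cls B (\<lambda>s. rep c s (rep x s))"

text \<open>The exponential transpose of \<open>h_eval\<close>; this is the identification of \<open>h smooth_space\<close> with
  \<open>R^R\<close> expressing that \<open>h\<close> preserves the exponential.\<close>

definition h_exp_iso :: "stage \<Rightarrow> (pt \<Rightarrow> real \<Rightarrow> real) set \<Rightarrow> stage \<Rightarrow> hom \<Rightarrow> elt \<Rightarrow> elt" where
  "h_exp_iso A c = (\<lambda>B u x.
     if B \<in> site_obj \<and> u \<in> Hom A B \<and> x \<in> sec line B
     then h_eval B (act (h_obj smooth_space) A B u c) x else undefined)"

definition h_test_incl :: "stage \<Rightarrow> (pt \<Rightarrow> real \<Rightarrow> real) set \<Rightarrow> stage \<Rightarrow> hom \<Rightarrow> elt \<Rightarrow> elt" where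
  "h_test_incl A c = h_exp_iso A (h_map smooth_space (\<lambda>f. f) A c)"

end

theory Submission
  imports Defs
begin

text \<open>
  Two reductions make the comparison pointwise. First, a function on \<open>R^(l+k)\<close> lies in the semi-Weil
  ideal of \<open>I\<close> iff its restrictions to all fibres \<open>R^l \<times> {t}\<close> lie in \<open>I\<close>: modulo \<open>I\<close> it is a
  polynomial in the infinitesimal coordinates with smooth coefficients, and a linear projection onto
  \<open>I\<close> may be applied to it. Second, by uniform boundedness in \<open>C^\<infinity>(R)\<close> a smooth family in
  \<open>C^\<infinity>(R)\<close> is a smooth function of one more variable, and a smooth family in \<open>D(R)\<close> has locally
  uniformly bounded supports, since otherwise some locally finite combination of point evaluations
  would be unbounded on it.

  Hence an element of \<open>h(D(R))\<close> satisfies the formula, with a constant \<open>b\<close> on each member of a cover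
  by unit cubes. Conversely, a section of \<open>R^R\<close> at \<open>A\<close> is given by a function \<open>F\<close>, its value at
  the generic element of \<open>R\<close> at the stage \<open>A \<times> R\<close>. Evaluating the formula at constants over
  the points of \<open>R^k\<close> shows that the fibres of \<open>F\<close> over \<open>(t, y)\<close> lie in \<open>I\<close> when \<open>|y|\<close> exceeds a
  locally bounded function of \<open>t\<close>. Cutting \<open>F\<close> off outside a smooth majorant of this function changes
  it by an element of the ideal and makes it a smooth family of test functions.
\<close>

section \<open>Calculus of smooth functions of sequences\<close>

text \<open>Smoothness and ideal membership of vector-valued maps are only known after composition
  with continuous functionals. Point evaluations are too few: they give neither joint smoothness of
  a family nor bounds for its supports. The functionals that do are countable combinations of
  evaluations, absolutely convergent for \<open>smooth_space\<close> and locally finite for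
  \<open>test_space\<close>. Moreover \<open>test_space\<close> has more functionals than
  \<open>smooth_space\<close>, so its classes are a priori finer, and injectivity of
  \<open>h_test_incl\<close> is not formal.

  A second difficulty: positivity at a stage is decided where the infinitesimal coordinates are
  zero, whereas equality holds modulo a Weil ideal. Continuity links the two. A strict inequality
  persists nearby, and a function vanishing near \<open>0\<close> lies in every Weil ideal, all its
  derivatives at \<open>0\<close> being zero. Supports must therefore be controlled also for small
  nonzero values of the infinitesimal coordinates.

  The majorant is compared with the square of the line variable, which is smooth, unlike the
  absolute value.\<close>

definition dep :: "nat \<Rightarrow> (pt \<Rightarrow> 'b) \<Rightarrow> bool" where
  "dep n f \<longleftrightarrow> (\<forall>x y. (\<forall>i<n. x i = y i) \<longrightarrow> f x = f y)"

lemma depD: "dep n f \<Longrightarrow> (\<And>i. i < n \<Longrightarrow> x i = y i) \<Longrightarrow> f x = f y"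
  unfolding dep_def by blast

lemma dep_upd: "dep n f \<Longrightarrow> \<not> i < n \<Longrightarrow> f (x(i := t)) = f x"
  by (rule depD) auto

lemma continuous_on_upd:
  fixes f :: "'b::topological_space \<Rightarrow> pt"
  assumes "continuous_on S f" "continuous_on S g"
  shows "continuous_on S (\<lambda>p. (f p)(i := g p))"
proof (rule continuous_on_coordinatewise_then_product)
  show "continuous_on S (\<lambda>p. ((f p)(i := g p)) j)" for j
    using assms by (cases "j = i") (auto intro: continuous_on_product_then_coordinatewise)
qed

lemma continuous_upd: "continuous_on UNIV (\<lambda>t::real. (x::pt)(i := t))"
  by (intro continuous_on_upd continuous_on_const continuous_on_id)

lemma continuous_coord: "continuous_on UNIV (\<lambda>x::pt. x i)"
  by (rule continuous_on_product_coordinates)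

lemma tendsto_pt:
  fixes f :: "'b \<Rightarrow> pt"
  assumes "\<And>i. ((\<lambda>t. f t i) \<longlongrightarrow> l i) F"
  shows "(f \<longlongrightarrow> l) F"
proof -
  have "limitin (product_topology (\<lambda>_. euclidean) UNIV) f l F"
    using assms by (subst limitin_componentwise) (auto simp: limitin_canonical_iff)
  then show ?thesis by (simp add: euclidean_product_topology limitin_canonical_iff)
qed

lemma eventually_upd:
  assumes "open U" "x \<in> U"
  shows "\<forall>\<^sub>F t in nhds (x i). (x::pt)(i := t) \<in> U"
proof -
  have "open ((\<lambda>t. x(i := t)) -` U)"
    using assms(1) continuous_upd[of x i] by (simp add: continuous_on_open_vimage)
  moreover have "x i \<in> (\<lambda>t. x(i := t)) -` U" using assms by simp
  ultimately show ?thesis unfolding eventually_nhds by blast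
qed

lemma has_deriv_cong:
  fixes x :: pt
  assumes "open U" "x \<in> U" "\<And>y. y \<in> U \<Longrightarrow> f y = g y"
  shows "((\<lambda>t. f (x(i := t))) has_real_derivative D) (at (x i)) \<longleftrightarrow>
         ((\<lambda>t. g (x(i := t))) has_real_derivative D) (at (x i))"
proof (rule DERIV_cong_ev)
  show "\<forall>\<^sub>F t in nhds (x i). f (x(i := t)) = g (x(i := t))"
    using eventually_upd[OF assms(1,2)] by eventually_elim (simp add: assms(3))
qed simp_all

lemma pd_cong:
  assumes "open U" "x \<in> U" "\<And>y. y \<in> U \<Longrightarrow> f y = g y"
  shows "pd i f x = pd i g x"
  unfolding pd_def deriv_def using has_deriv_cong[of U x f g, OF assms] by simp

lemma pds_Nil [simp]: "pds [] f = f"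
  by (simp add: pds_def)

lemma pds_Cons [simp]: "pds (i # is) f = pds is (pd i f)"
  by (simp add: pds_def)

lemma pds_append: "pds (is @ js) f = pds js (pds is f)"
  by (simp add: pds_def)

lemma pds_cong:
  assumes "open U"
  shows "(\<And>y. y \<in> U \<Longrightarrow> f y = g y) \<Longrightarrow> x \<in> U \<Longrightarrow> pds is f x = pds is g x"
proof (induction "is" arbitrary: f g)
  case (Cons i "is")
  have "\<And>y. y \<in> U \<Longrightarrow> pd i f y = pd i g y" using pd_cong[OF assms, of _ f g i] Cons.prems by blast
  then have "pds is (pd i f) x = pds is (pd i g) x" using Cons.IH Cons.prems(2) by blast
  then show ?case by simp
qed simp

text \<open>By induction on the list of indices, every iterated partial derivative of
  \<open>f\<close> agrees on \<open>U\<close> with a member of \<open>S\<close>. Openness of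
  \<open>U\<close> lets this agreement pass to the next derivative.\<close>

lemma smooth_coinduct:
  assumes "open U" and f: "f \<in> S"
    and dep: "\<And>x y. x \<in> U \<Longrightarrow> y \<in> U \<Longrightarrow> (\<And>i. i < n \<Longrightarrow> x i = y i) \<Longrightarrow> f x = f y"
    and cont: "\<And>f. f \<in> S \<Longrightarrow> continuous_on U f"
    and der: "\<And>f i. f \<in> S \<Longrightarrow> i < n \<Longrightarrow>
      \<exists>f'\<in>S. \<forall>x\<in>U. ((\<lambda>t. f (x(i := t))) has_real_derivative f' x) (at (x i))"
  shows "smooth_on n U f"
proof -
  have *: "set is \<subseteq> {..<n} \<Longrightarrow> f \<in> S \<Longrightarrow> \<exists>h\<in>S. \<forall>x\<in>U. pds is f x = h x" for "is" f
  proof (induction "is" arbitrary: f)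
    case Nil
    then show ?case by auto
  next
    case (Cons i "is")
    obtain f' where f': "f' \<in> S"
      "\<And>x. x \<in> U \<Longrightarrow> ((\<lambda>t. f (x(i := t))) has_real_derivative f' x) (at (x i))"
      using der[of f i] Cons.prems by auto
    have "pd i f x = f' x" if "x \<in> U" for x
      unfolding pd_def using f'(2)[OF that] by (rule DERIV_imp_deriv)
    then have "\<forall>x\<in>U. pds is (pd i f) x = pds is f' x"
      using pds_cong[OF assms(1)] by blast
    moreover obtain h where "h \<in> S" "\<forall>x\<in>U. pds is f' x = h x"
      using Cons.IH[of f'] Cons.prems f'(1) by auto
    ultimately show ?case by auto
  qed
  show ?thesis unfolding smooth_on_def
  proof (intro conjI ballI allI impI)
    fix "is" assume "set is \<subseteq> {..<n}"
    then obtain h where h: "h \<in> S" "\<And>x. x \<in> U \<Longrightarrow> pds is f x = h x" using *[of "is" f] f by blast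
    show "continuous_on U (pds is f)" using cont[OF h(1)] h(2) continuous_on_cong by metis
    fix i x assume "i < n" "x \<in> U"
    obtain h' where h': "((\<lambda>t. h (x(i := t))) has_real_derivative h' x) (at (x i))"
      using der[OF h(1) \<open>i < n\<close>] \<open>x \<in> U\<close> by blast
    then have "((\<lambda>t. pds is f (x(i := t))) has_real_derivative h' x) (at (x i))"
      using has_deriv_cong[of U x "pds is f" h, OF assms(1) \<open>x \<in> U\<close> h(2)] by blast
    then show "(\<lambda>t. pds is f (x(i := t))) differentiable at (x i)"
      using real_differentiable_def by blast
  next
    fix x y assume "x \<in> U" "y \<in> U" "\<forall>i<n. x i = y i"
    then show "f x = f y" using dep[of x y] by simp
  qed
qed

text \<open>By \<open>smooth_gen\<close> below, functions whose partial derivatives are polynomials in functions of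
  the same family are smooth.\<close>

inductive_set gen :: "(pt \<Rightarrow> real) set \<Rightarrow> (pt \<Rightarrow> real) set" for S0 where
  base: "f \<in> S0 \<Longrightarrow> f \<in> gen S0"
| const: "(\<lambda>_. c) \<in> gen S0"
| add: "f \<in> gen S0 \<Longrightarrow> g \<in> gen S0 \<Longrightarrow> (\<lambda>x. f x + g x) \<in> gen S0"
| mult: "f \<in> gen S0 \<Longrightarrow> g \<in> gen S0 \<Longrightarrow> (\<lambda>x. f x * g x) \<in> gen S0"

lemma gen_sum:
  "finite A \<Longrightarrow> (\<And>i. i \<in> A \<Longrightarrow> f i \<in> gen S0) \<Longrightarrow> (\<lambda>x. \<Sum>i\<in>A. f i x) \<in> gen S0"
  by (induction A rule: finite_induct) (auto intro: gen.const gen.add)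

text \<open>Sum and product rule keep \<open>gen S0\<close> closed under partial derivatives, so it
  serves as the family in \<open>smooth_coinduct\<close>; derivatives have to be supplied for the
  generators only.\<close>

lemma smooth_gen:
  assumes "open U" and f: "f \<in> gen S0"
    and dep: "\<And>f x y. f \<in> S0 \<Longrightarrow> x \<in> U \<Longrightarrow> y \<in> U \<Longrightarrow> (\<And>i. i < n \<Longrightarrow> x i = y i) \<Longrightarrow> f x = f y"
    and cont: "\<And>f. f \<in> S0 \<Longrightarrow> continuous_on U f"
    and der: "\<And>f i. f \<in> S0 \<Longrightarrow> i < n \<Longrightarrow>
      \<exists>f'\<in>gen S0. \<forall>x\<in>U. ((\<lambda>t. f (x(i := t))) has_real_derivative f' x) (at (x i))"
  shows "smooth_on n U f"
proof (rule smooth_coinduct[OF assms(1) f])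
  show "f x = f y" if "x \<in> U" "y \<in> U" "\<And>i. i < n \<Longrightarrow> x i = y i" for x y
    using f by (induction rule: gen.induct) (use dep that in auto)
  show "continuous_on U f" if "f \<in> gen S0" for f
    using that by (induction rule: gen.induct) (auto intro: cont continuous_intros)
  show "\<exists>f'\<in>gen S0. \<forall>x\<in>U. ((\<lambda>t. f (x(i := t))) has_real_derivative f' x) (at (x i))"
    if "f \<in> gen S0" "i < n" for f i
    using that(1)
  proof (induction rule: gen.induct)
    case (base f)
    then show ?case using der that by blast
  next
    case (const c)
    show ?case by (rule bexI[OF _ gen.const[of 0]]) auto
  next
    case (add f g)
    then obtain f' g' where *: "f' \<in> gen S0" "g' \<in> gen S0"
      "\<And>x. x \<in> U \<Longrightarrow> ((\<lambda>t. f (x(i := t))) has_real_derivative f' x) (at (x i))"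
      "\<And>x. x \<in> U \<Longrightarrow> ((\<lambda>t. g (x(i := t))) has_real_derivative g' x) (at (x i))" by blast
    show ?case
    proof (intro bexI ballI)
      show "(\<lambda>x. f' x + g' x) \<in> gen S0" by (rule gen.add[OF *(1,2)])
    qed (rule DERIV_add[OF *(3,4)])
  next
    case (mult f g)
    then obtain f' g' where *: "f' \<in> gen S0" "g' \<in> gen S0"
      "\<And>x. x \<in> U \<Longrightarrow> ((\<lambda>t. f (x(i := t))) has_real_derivative f' x) (at (x i))"
      "\<And>x. x \<in> U \<Longrightarrow> ((\<lambda>t. g (x(i := t))) has_real_derivative g' x) (at (x i))" by blast
    show ?case
    proof (intro bexI ballI)
      show "(\<lambda>x. f x * g' x + f' x * g x) \<in> gen S0"
        by (intro gen.add gen.mult * mult.hyps)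
      fix x assume "x \<in> U"
      from DERIV_mult'[OF *(3,4), OF this this]
      show "((\<lambda>t. f (x(i := t)) * g (x(i := t))) has_real_derivative f x * g' x + f' x * g x) (at (x i))"
        by simp
    qed
  qed
qed

section \<open>Closure properties of the rings of smooth functions\<close>

lemma CinfD:
  assumes "f \<in> Cinf n"
  shows Cinf_dep: "dep n f"
    and Cinf_continuous: "continuous_on UNIV f"
    and Cinf_has_pd: "i < n \<Longrightarrow> ((\<lambda>t. f (x(i := t))) has_real_derivative pd i f x) (at (x i))"
proof -
  show "dep n f" using assms unfolding Cinf_def smooth_on_def dep_def by blast
  have *: "set is \<subseteq> {..<n} \<longrightarrow> continuous_on UNIV (pds is f) \<and>
    (\<forall>i<n. \<forall>x\<in>UNIV. (\<lambda>t. pds is f (x(i := t))) differentiable (at (x i)))" for "is"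
    using assms unfolding Cinf_def smooth_on_def by blast
  show "continuous_on UNIV f" using *[of "[]"] by simp
  show "((\<lambda>t. f (x(i := t))) has_real_derivative pd i f x) (at (x i))" if "i < n"
    using *[of "[]"] that unfolding pd_def
    by (simp add: DERIV_deriv_iff_real_differentiable[symmetric])
qed

lemma Cinf_pd [intro]: "f \<in> Cinf n \<Longrightarrow> i < n \<Longrightarrow> pd i f \<in> Cinf n"
proof -
  assume f: "f \<in> Cinf n" and i: "i < n"
  have "pd i f x = pd i f y" if "\<forall>i<n. x i = y i" for x y
  proof -
    have "f (x(i := t)) = f (y(i := t))" for t
      using Cinf_dep[OF f] by (rule depD) (use that in auto)
    then show ?thesis unfolding pd_def using that i by simp
  qed
  moreover have "continuous_on UNIV (pds is (pd i f)) \<and>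
    (\<forall>i'<n. \<forall>x\<in>UNIV. (\<lambda>t. pds is (pd i f) (x(i' := t))) differentiable (at (x i')))"
    if "set is \<subseteq> {..<n}" for "is"
  proof -
    have "set (i # is) \<subseteq> {..<n} \<longrightarrow> continuous_on UNIV (pds (i # is) f) \<and>
      (\<forall>i'<n. \<forall>x\<in>UNIV. (\<lambda>t. pds (i # is) f (x(i' := t))) differentiable (at (x i')))"
      using f unfolding Cinf_def smooth_on_def by blast
    then show ?thesis using i that by simp
  qed
  ultimately show ?thesis unfolding Cinf_def smooth_on_def by blast
qed

lemma Cinf_pds: "f \<in> Cinf n \<Longrightarrow> set is \<subseteq> {..<n} \<Longrightarrow> pds is f \<in> Cinf n"
  by (induction "is" arbitrary: f) auto

text \<open>The mean value theorem for either sign of \<open>h\<close>, in the quotient form in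
  which the later estimates of difference quotients use it.\<close>

lemma pd_mvt:
  assumes f: "f \<in> Cinf n" and i: "i < n" and h: "h \<noteq> 0"
  obtains z where "\<bar>z - s i\<bar> \<le> \<bar>h\<bar>" "(f (s(i := s i + h)) - f s) / h = pd i f (s(i := z))"
proof -
  have der: "((\<lambda>v. f (s(i := v))) has_real_derivative pd i f (s(i := v))) (at v)" for v
    using Cinf_has_pd[OF f i, of "s(i := v)"] by simp
  show ?thesis
  proof (cases "h > 0")
    case True
    then have "s i < s i + h" by simp
    from MVT2[OF this der] obtain z where "z > s i" "z < s i + h"
      "f (s(i := s i + h)) - f (s(i := s i)) = h * pd i f (s(i := z))" by auto
    then show ?thesis using True by (intro that[of z]) (auto simp: field_simps)
  next
    case False
    then have "s i + h < s i" using h by simp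
    from MVT2[OF this der] obtain z where "z > s i + h" "z < s i"
      "f (s(i := s i)) - f (s(i := s i + h)) = - h * pd i f (s(i := z))" by auto
    then show ?thesis using False h by (intro that[of z]) (auto simp: field_simps)
  qed
qed

lemma Cinf_gen:
  assumes f: "f \<in> gen S0"
    and dep: "\<And>f. f \<in> S0 \<Longrightarrow> dep n f"
    and cont: "\<And>f. f \<in> S0 \<Longrightarrow> continuous_on UNIV f"
    and der: "\<And>f i. f \<in> S0 \<Longrightarrow> i < n \<Longrightarrow>
      \<exists>f'\<in>gen S0. \<forall>x. ((\<lambda>t. f (x(i := t))) has_real_derivative f' x) (at (x i))"
  shows "f \<in> Cinf n"
  unfolding Cinf_def mem_Collect_eq using open_UNIV f
proof (rule smooth_gen)
  show "\<And>f i. f \<in> S0 \<Longrightarrow> i < n \<Longrightarrow>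
      \<exists>f'\<in>gen S0. \<forall>x\<in>UNIV. ((\<lambda>t. f (x(i := t))) has_real_derivative f' x) (at (x i))"
    using der by simp
  show "\<And>f x y. f \<in> S0 \<Longrightarrow> x \<in> UNIV \<Longrightarrow> y \<in> UNIV \<Longrightarrow> (\<And>i. i < n \<Longrightarrow> x i = y i) \<Longrightarrow> f x = f y"
    using dep unfolding dep_def by blast
qed (rule cont)

lemma gen_Cinf: "f \<in> gen (Cinf n) \<Longrightarrow> f \<in> Cinf n"
  by (erule Cinf_gen) (auto intro: CinfD gen.base Cinf_pd)

lemma Cinf_const [intro, simp]: "(\<lambda>_. c) \<in> Cinf n"
  by (rule gen_Cinf) (rule gen.const)

lemma Cinf_add [intro]: "f \<in> Cinf n \<Longrightarrow> g \<in> Cinf n \<Longrightarrow> (\<lambda>x. f x + g x) \<in> Cinf n"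
  by (rule gen_Cinf, rule gen.add; rule gen.base)

lemma Cinf_mult [intro]: "f \<in> Cinf n \<Longrightarrow> g \<in> Cinf n \<Longrightarrow> (\<lambda>x. f x * g x) \<in> Cinf n"
  by (rule gen_Cinf, rule gen.mult; rule gen.base)

lemma Cinf_sum [intro]: "(\<And>i. i \<in> A \<Longrightarrow> f i \<in> Cinf n) \<Longrightarrow> (\<lambda>x. \<Sum>i\<in>A. f i x) \<in> Cinf n"
  by (induction A rule: infinite_finite_induct) auto

lemma Cinf_uminus [intro]: "f \<in> Cinf n \<Longrightarrow> (\<lambda>x. - f x) \<in> Cinf n"
  using Cinf_mult[OF Cinf_const[of "-1"], of f n] by simp

lemma Cinf_diff [intro]: "f \<in> Cinf n \<Longrightarrow> g \<in> Cinf n \<Longrightarrow> (\<lambda>x. f x - g x) \<in> Cinf n"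
  using Cinf_add[OF _ Cinf_uminus, of f n g] by simp

lemma Cinf_power [intro]: "f \<in> Cinf n \<Longrightarrow> (\<lambda>x. f x ^ r) \<in> Cinf n"
  by (induction r) auto

lemma Cinf_coord [intro]: "i < n \<Longrightarrow> (\<lambda>x. x i) \<in> Cinf n"
proof (rule Cinf_gen[OF gen.base])
  show "(\<lambda>x. x i) \<in> {\<lambda>x::pt. x i | i. i < n}" if "i < n" using that by blast
  fix f :: "pt \<Rightarrow> real" and j assume "f \<in> {\<lambda>x::pt. x i | i. i < n}" and j: "j < n"
  then obtain i where "i < n" and f: "f = (\<lambda>x. x i)" by blast
  show "\<exists>f'\<in>gen {\<lambda>x::pt. x i | i. i < n}.
      \<forall>x. ((\<lambda>t. f (x(j := t))) has_real_derivative f' x) (at (x j))"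
    by (rule bexI[OF _ gen.const[of "if i = j then 1 else 0"]])
       (auto simp: f intro!: derivative_eq_intros)
qed (auto simp: dep_def intro: continuous_coord)

text \<open>Functions are encoded on sequences, so the pullback along a projection is the same
  function; its derivatives in the new coordinates are zero.\<close>

lemma Cinf_mono:
  assumes "n \<le> m" "f \<in> Cinf n"
  shows "f \<in> Cinf m"
proof (rule Cinf_gen[OF gen.base[OF assms(2)]])
  fix f assume f: "f \<in> Cinf n"
  show "dep m f" using Cinf_dep[OF f] assms(1) unfolding dep_def by (meson order_less_le_trans)
  show "continuous_on UNIV f" using f by (rule Cinf_continuous)
  fix i
  show "\<exists>f'\<in>gen (Cinf n). \<forall>x. ((\<lambda>t. f (x(i := t))) has_real_derivative f' x) (at (x i))"
  proof (cases "i < n")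
    case True
    then show ?thesis using f by (auto intro: gen.base Cinf_has_pd)
  next
    case False
    then show ?thesis using dep_upd[OF Cinf_dep[OF f]]
      by (intro bexI[OF _ gen.const[of 0]]) auto
  qed
qed

text \<open>Moving the coordinates one at a time reduces the claim to increments in one variable,
  each given by the mean value theorem. Continuity of the partial derivatives takes the place of
  total differentiability.\<close>

lemma chain_rule:
  fixes c :: "real \<Rightarrow> pt"
  assumes \<theta>: "\<theta> \<in> Cinf m"
    and c: "\<And>i. i < m \<Longrightarrow> ((\<lambda>t. c t i) has_real_derivative c' i) (at t0)"
  shows "((\<lambda>t. \<theta> (c t)) has_real_derivative (\<Sum>i<m. pd i \<theta> (c t0) * c' i)) (at t0)"
proof -
  \<comment> \<open>Coordinates below \<open>j\<close> have moved to time \<open>t\<close>, the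
    others are still at \<open>t0\<close>; for \<open>j = m\<close> this is \<open>c t\<close> as
    far as \<theta> can see.\<close>
  define d where "d j t = (\<lambda>i. if i < j then c t i else c t0 i)" for j t
  have "j \<le> m \<Longrightarrow> ((\<lambda>t. \<theta> (d j t)) has_real_derivative (\<Sum>i<j. pd i \<theta> (c t0) * c' i)) (at t0)" for j
  proof (induction j)
    case 0
    then show ?case by (simp add: d_def)
  next
    case (Suc j)
    then have j: "j < m" by simp
    have dS: "d (Suc j) t = (d j t)(j := c t j)" for t
      by (auto simp: d_def fun_eq_iff less_Suc_eq)
    have dj: "d j t = (d j t)(j := c t0 j)" for t
      by (auto simp: d_def fun_eq_iff)
    \<comment> \<open>The intermediate points are collected into one function \<xi> of
      \<open>t\<close>; being squeezed by \<open>c t j\<close>, it tends to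
      \<open>c t0 j\<close>.\<close>
    have "\<exists>\<xi>. \<bar>\<xi> - c t0 j\<bar> \<le> \<bar>c t j - c t0 j\<bar> \<and>
       \<theta> (d (Suc j) t) - \<theta> (d j t) = pd j \<theta> ((d j t)(j := \<xi>)) * (c t j - c t0 j)" for t
    proof -
      have der: "((\<lambda>u. \<theta> ((d j t)(j := u))) has_real_derivative pd j \<theta> ((d j t)(j := u))) (at u)" for u
        using Cinf_has_pd[OF \<theta> j, of "(d j t)(j := u)"] by simp
      consider "c t j = c t0 j" | "c t j < c t0 j" | "c t0 j < c t j" by linarith
      then show ?thesis
      proof cases
        case 1
        then show ?thesis using dS dj by (metis abs_zero cancel_comm_monoid_add_class.diff_cancel mult_zero_right order_refl)
      next
        case 2
        obtain z where "z > c t j" "z < c t0 j"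
          "\<theta> ((d j t)(j := c t0 j)) - \<theta> ((d j t)(j := c t j)) = (c t0 j - c t j) * pd j \<theta> ((d j t)(j := z))"
          using MVT2[OF 2 der] by blast
        then show ?thesis using dS[of t] dj[of t] by (intro exI[of _ z]) (auto simp: algebra_simps)
      next
        case 3
        obtain z where "z < c t j" "z > c t0 j"
          "\<theta> ((d j t)(j := c t j)) - \<theta> ((d j t)(j := c t0 j)) = (c t j - c t0 j) * pd j \<theta> ((d j t)(j := z))"
          using MVT2[OF 3 der] by blast
        then show ?thesis using dS[of t] dj[of t] by (intro exI[of _ z]) (auto simp: algebra_simps)
      qed
    qed
    then obtain \<xi> where \<xi>: "\<And>t. \<bar>\<xi> t - c t0 j\<bar> \<le> \<bar>c t j - c t0 j\<bar>"
      "\<And>t. \<theta> (d (Suc j) t) - \<theta> (d j t) = pd j \<theta> ((d j t)(j := \<xi> t)) * (c t j - c t0 j)"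
      by metis
    have clim: "((\<lambda>t. c t i) \<longlongrightarrow> c t0 i) (at t0)" if "i < m" for i
      using DERIV_isCont[OF c[OF that]] by (simp add: isCont_def)
    have "((\<lambda>t. \<xi> t - c t0 j) \<longlongrightarrow> 0) (at t0)"
    proof (rule Lim_null_comparison)
      show "\<forall>\<^sub>F t in at t0. norm (\<xi> t - c t0 j) \<le> \<bar>c t j - c t0 j\<bar>" using \<xi>(1) by simp
      show "((\<lambda>t. \<bar>c t j - c t0 j\<bar>) \<longlongrightarrow> 0) (at t0)"
        using clim[OF j] LIM_zero tendsto_rabs_zero by blast
    qed
    then have \<xi>lim: "(\<xi> \<longlongrightarrow> c t0 j) (at t0)" using LIM_zero_cancel by blast
    have "((\<lambda>t. (d j t)(j := \<xi> t)) \<longlongrightarrow> c t0) (at t0)"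
    proof (rule tendsto_pt)
      fix i show "((\<lambda>t. ((d j t)(j := \<xi> t)) i) \<longlongrightarrow> c t0 i) (at t0)"
        using \<xi>lim clim[of i] j by (cases "i = j"; cases "i < j") (auto simp: d_def)
    qed
    moreover have "isCont (pd j \<theta>) (c t0)"
      using Cinf_continuous[OF Cinf_pd[OF \<theta> j]] continuous_on_eq_continuous_at open_UNIV by blast
    ultimately have A: "((\<lambda>t. pd j \<theta> ((d j t)(j := \<xi> t))) \<longlongrightarrow> pd j \<theta> (c t0)) (at t0)"
      using isCont_tendsto_compose by blast
    have "((\<lambda>t. pd j \<theta> ((d j t)(j := \<xi> t)) * ((c t j - c t0 j) / (t - t0))) \<longlongrightarrow> pd j \<theta> (c t0) * c' j) (at t0)"
      using A c[OF j] by (intro tendsto_mult) (simp_all add: has_field_derivative_iff)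
    moreover have "d (Suc j) t0 = d j t0" by (auto simp: d_def fun_eq_iff)
    ultimately have "((\<lambda>t. \<theta> (d (Suc j) t) - \<theta> (d j t)) has_real_derivative pd j \<theta> (c t0) * c' j) (at t0)"
      unfolding has_field_derivative_iff using \<xi>(2) by simp
    from DERIV_add[OF this Suc.IH] j show ?case by (simp add: add.commute)
  qed
  from this[of m] have "((\<lambda>t. \<theta> (d m t)) has_real_derivative (\<Sum>i<m. pd i \<theta> (c t0) * c' i)) (at t0)" by simp
  moreover have "\<theta> (d m t) = \<theta> (c t)" for t
    using Cinf_dep[OF \<theta>] by (rule depD) (simp add: d_def)
  ultimately show ?thesis by simp
qed

lemma continuous_compose_pt:
  fixes f :: "nat \<Rightarrow> 'b::topological_space \<Rightarrow> real"
  assumes \<theta>: "\<theta> \<in> Cinf m" and f: "\<And>i. i < m \<Longrightarrow> continuous_on U (f i)"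
  shows "continuous_on U (\<lambda>s. \<theta> (\<lambda>i. f i s))"
proof -
  have "continuous_on U (\<lambda>s. \<theta> (\<lambda>i. if i < m then f i s else 0))"
  proof (rule continuous_on_compose2[OF Cinf_continuous[OF \<theta>]])
    show "continuous_on U (\<lambda>s. (\<lambda>i. if i < m then f i s else 0))"
    proof (rule continuous_on_coordinatewise_then_product)
      show "continuous_on U (\<lambda>s. if i < m then f i s else 0)" for i
        using f by (cases "i < m") auto
    qed
  qed simp
  moreover have "\<theta> (\<lambda>i. if i < m then f i s else 0) = \<theta> (\<lambda>i. f i s)" for s
    using Cinf_dep[OF \<theta>] by (rule depD) simp
  ultimately show ?thesis by simp
qed

text \<open>By the chain rule a derivative of a composite is a polynomial in composites with the
  same inner functions and in members of \<open>Cinf n\<close>; these two kinds of functions are the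
  generators.\<close>

lemma Cinf_compose:
  assumes \<theta>: "\<theta> \<in> Cinf m" and f: "\<And>i. i < m \<Longrightarrow> f i \<in> Cinf n"
  shows "(\<lambda>s. \<theta> (\<lambda>i. f i s)) \<in> Cinf n"
proof (rule Cinf_gen)
  define S where "S = {(\<lambda>s. \<theta> (\<lambda>i. f i s)) | \<theta>. \<theta> \<in> Cinf m} \<union> Cinf n"
  show "(\<lambda>s. \<theta> (\<lambda>i. f i s)) \<in> gen S" using \<theta> by (auto simp: S_def intro: gen.base)
  fix g assume g: "g \<in> S"
  show "dep n g" unfolding dep_def
  proof (intro allI impI)
    fix x y :: pt assume xy: "\<forall>i<n. x i = y i"
    consider \<theta> where "\<theta> \<in> Cinf m" "g = (\<lambda>s. \<theta> (\<lambda>i. f i s))" | "g \<in> Cinf n" using g S_def by blast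
    then show "g x = g y"
    proof cases
      case 1
      have "f i x = f i y" if "i < m" for i using Cinf_dep[OF f[OF that]] xy unfolding dep_def by blast
      then show ?thesis unfolding 1(2) by (intro depD[OF Cinf_dep[OF 1(1)]]) auto
    next
      case 2
      then show ?thesis using Cinf_dep xy unfolding dep_def by blast
    qed
  qed
  show "continuous_on UNIV g"
    using g continuous_compose_pt[of _ m UNIV f] Cinf_continuous f unfolding S_def by blast
  fix j assume j: "j < n"
  consider \<theta> where "\<theta> \<in> Cinf m" "g = (\<lambda>s. \<theta> (\<lambda>i. f i s))" | "g \<in> Cinf n" using g S_def by blast
  then show "\<exists>f'\<in>gen S. \<forall>x. ((\<lambda>t. g (x(j := t))) has_real_derivative f' x) (at (x j))"
  proof cases
    case 1
    have "(\<lambda>x. \<Sum>i<m. pd i \<theta> (\<lambda>i. f i x) * pd j (f i) x) \<in> gen S"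
    proof (intro gen_sum gen.mult gen.base)
      fix i assume "i \<in> {..<m}"
      then show "(\<lambda>x. pd i \<theta> (\<lambda>i. f i x)) \<in> S" using Cinf_pd[OF 1(1), of i] by (auto simp: S_def)
      show "(\<lambda>x. pd j (f i) x) \<in> S" using f \<open>i \<in> _\<close> j by (auto simp: S_def)
    qed simp
    moreover have "((\<lambda>t. g (x(j := t))) has_real_derivative (\<Sum>i<m. pd i \<theta> (\<lambda>i. f i x) * pd j (f i) x)) (at (x j))" for x
      unfolding 1(2)
      using chain_rule[OF 1(1), of "\<lambda>t i. f i (x(j := t))" "\<lambda>i. pd j (f i) x" "x j"] Cinf_has_pd[OF f j]
      by simp
    ultimately show ?thesis by (intro bexI allI)
  next
    case 2
    then show ?thesis using j by (intro bexI[of _ "pd j g"]) (auto simp: S_def intro: gen.base Cinf_has_pd)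
  qed
qed

lemma pd_const [simp]: "pd i (\<lambda>_. c) = (\<lambda>_. 0)"
  by (simp add: pd_def)

lemma pd_add:
  assumes "f \<in> Cinf n" "g \<in> Cinf n" "i < n"
  shows "pd i (\<lambda>x. f x + g x) = (\<lambda>x. pd i f x + pd i g x)"
proof
  fix x show "pd i (\<lambda>x. f x + g x) x = pd i f x + pd i g x"
    unfolding pd_def[of i "\<lambda>x. f x + g x"]
    by (rule DERIV_imp_deriv) (auto intro!: derivative_eq_intros Cinf_has_pd assms)
qed

lemma pd_mult:
  assumes "f \<in> Cinf n" "g \<in> Cinf n" "i < n"
  shows "pd i (\<lambda>x. f x * g x) = (\<lambda>x. pd i f x * g x + f x * pd i g x)"
proof
  fix x show "pd i (\<lambda>x. f x * g x) x = pd i f x * g x + f x * pd i g x"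
    unfolding pd_def[of i "\<lambda>x. f x * g x"]
    by (rule DERIV_imp_deriv) (auto intro!: derivative_eq_intros Cinf_has_pd[OF assms(1,3)] Cinf_has_pd[OF assms(2,3)])
qed

text \<open>The functions that coincide near each point with some smooth function, which may vary
  with the point, form a family closed under partial derivatives.\<close>

lemma Cinf_local:
  assumes dep: "dep n f"
    and loc: "\<And>x. \<exists>U h. open U \<and> x \<in> U \<and> h \<in> Cinf n \<and> (\<forall>y\<in>U. f y = h y)"
  shows "f \<in> Cinf n"
  unfolding Cinf_def mem_Collect_eq
proof (rule smooth_coinduct[OF open_UNIV])
  define S where "S = {f. \<forall>x. \<exists>U h. open U \<and> x \<in> U \<and> h \<in> Cinf n \<and> (\<forall>y\<in>U. f y = h y)}"
  show "f \<in> S" using loc by (simp add: S_def)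
  show "f x = f y" if "\<And>i. i < n \<Longrightarrow> x i = y i" for x y using dep that unfolding dep_def by blast
  fix g assume g: "g \<in> S"
  have "isCont g x" for x
  proof -
    obtain U h where U: "open U" "x \<in> U" "h \<in> Cinf n" "\<And>y. y \<in> U \<Longrightarrow> g y = h y"
      using g unfolding S_def by blast
    have "isCont h x" using Cinf_continuous[OF U(3)] by (simp add: continuous_on_eq_continuous_at)
    moreover have "\<forall>\<^sub>F y in nhds x. g y = h y" using U eventually_nhds by blast
    ultimately show ?thesis using isCont_cong by blast
  qed
  then show "continuous_on UNIV g" by (simp add: continuous_on_eq_continuous_at)
  fix i assume i: "i < n"
  show "\<exists>f'\<in>S. \<forall>x\<in>UNIV. ((\<lambda>t. g (x(i := t))) has_real_derivative f' x) (at (x i))"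
  proof (intro bexI ballI)
    show "((\<lambda>t. g (x(i := t))) has_real_derivative pd i g x) (at (x i))" for x
    proof -
      obtain U h where U: "open U" "x \<in> U" "h \<in> Cinf n" "\<And>y. y \<in> U \<Longrightarrow> g y = h y"
        using g unfolding S_def by blast
      show ?thesis using has_deriv_cong[of U x g h, OF U(1,2,4)] pd_cong[of U x g h, OF U(1,2,4)] Cinf_has_pd[OF U(3) i] by metis
    qed
    show "pd i g \<in> S" unfolding S_def
    proof (safe)
      fix x
      obtain U h where U: "open U" "x \<in> U" "h \<in> Cinf n" "\<And>y. y \<in> U \<Longrightarrow> g y = h y"
        using g unfolding S_def by blast
      then show "\<exists>U h. open U \<and> x \<in> U \<and> h \<in> Cinf n \<and> (\<forall>y\<in>U. pd i g y = h y)"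
        using pd_cong[of U _ g h i] Cinf_pd[OF U(3) i] by blast
    qed
  qed
qed

text \<open>Leibniz's rule moves a parameter derivative under the integral, which yields an integral
  of the same kind. The integration variable occupies coordinate \<open>n\<close>.\<close>

lemma Cinf_integral:
  assumes "f \<in> Cinf (Suc n)"
  shows "(\<lambda>x. integral {0..1} (\<lambda>t. f (x(n := t)))) \<in> Cinf n"
  unfolding Cinf_def mem_Collect_eq
proof (rule smooth_coinduct[OF open_UNIV])
  define S where "S = {(\<lambda>x::pt. integral {0..1} (\<lambda>t. f (x(n := t)))) | f. f \<in> Cinf (Suc n)}"
  show "(\<lambda>x. integral {0..1} (\<lambda>t. f (x(n := t)))) \<in> S" using assms S_def by blast
  show "integral {0..1} (\<lambda>t. f (x(n := t))) = integral {0..1} (\<lambda>t. f (y(n := t)))"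
    if "\<And>i. i < n \<Longrightarrow> x i = y i" for x y
    by (rule arg_cong[of _ _ "integral _"], rule ext, rule depD[OF Cinf_dep[OF assms]])
       (use that less_Suc_eq in auto)
  fix g assume "g \<in> S"
  then obtain f where f: "f \<in> Cinf (Suc n)" and g: "g = (\<lambda>x. integral {0..1} (\<lambda>t. f (x(n := t))))"
    unfolding S_def by blast
  show "continuous_on UNIV g" unfolding g box_real(2)[symmetric]
  proof (rule integral_continuous_on_param)
    show "continuous_on (UNIV \<times> cbox 0 1) (\<lambda>(x, t). f (x(n := t)))"
      unfolding case_prod_beta
      by (rule continuous_on_compose2[OF Cinf_continuous[OF f]],
          intro continuous_on_upd continuous_on_fst continuous_on_snd continuous_on_id, simp)
  qed
  fix i assume i: "i < n"
  show "\<exists>f'\<in>S. \<forall>x\<in>UNIV. ((\<lambda>t. g (x(i := t))) has_real_derivative f' x) (at (x i))"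
  proof (intro bexI ballI)
    show "(\<lambda>x. integral {0..1} (\<lambda>t. pd i f (x(n := t)))) \<in> S"
      using Cinf_pd[OF f] i S_def by auto
    fix x :: pt
    have "((\<lambda>u. integral (cbox 0 1) (\<lambda>t. f (x(i := u, n := t)))) has_real_derivative
          integral (cbox 0 1) (\<lambda>t. pd i f (x(i := x i, n := t)))) (at (x i) within UNIV)"
    proof (rule leibniz_rule_field_derivative)
      show "((\<lambda>u. f (x(i := u, n := t))) has_real_derivative pd i f (x(i := u, n := t))) (at u within UNIV)" for u t
        using Cinf_has_pd[OF f, of i "x(i := u, n := t)"] i by (simp add: fun_upd_twist)
      show "(\<lambda>t. f (x(i := u, n := t))) integrable_on cbox 0 1" for u
        by (rule integrable_continuous, rule continuous_on_compose2[OF Cinf_continuous[OF f]])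
           (auto intro: continuous_on_subset[OF continuous_upd])
      show "continuous_on (UNIV \<times> cbox 0 1) (\<lambda>(u, t). pd i f (x(i := u, n := t)))"
        unfolding case_prod_beta
        by (rule continuous_on_compose2[OF Cinf_continuous[OF Cinf_pd[OF f less_SucI[OF i]]]],
            intro continuous_on_upd continuous_on_const continuous_on_fst continuous_on_snd
              continuous_on_id, simp)
    qed auto
    then show "((\<lambda>t. g (x(i := t))) has_real_derivative integral {0..1} (\<lambda>t. pd i f (x(n := t)))) (at (x i))"
      by (simp add: g)
  qed
qed

text \<open>The fundamental theorem of calculus along the segment from the \<open>g i s\<close> to
  the \<open>f i s\<close>: \<open>G i\<close> is the mean of the \<open>i\<close>-th partial
  derivative of \<theta> on it. The segment parameter is coordinate \<open>n\<close> of
  \<open>Cinf_integral\<close>.\<close>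

lemma hadamard:
  assumes \<theta>: "\<theta> \<in> Cinf m" and f: "\<And>i. i < m \<Longrightarrow> f i \<in> Cinf n" and g: "\<And>i. i < m \<Longrightarrow> g i \<in> Cinf n"
  obtains G where "\<And>i. i < m \<Longrightarrow> G i \<in> Cinf n"
    "\<And>s. \<theta> (\<lambda>i. f i s) - \<theta> (\<lambda>i. g i s) = (\<Sum>i<m. (f i s - g i s) * G i s)"
proof
  define G where "G i s = integral {0..1} (\<lambda>t. pd i \<theta> (\<lambda>j. g j s + t * (f j s - g j s)))" for i s
  fix i assume i: "i < m"
  have "(\<lambda>s. pd i \<theta> (\<lambda>j. g j s + s n * (f j s - g j s))) \<in> Cinf (Suc n)"
  proof (rule Cinf_compose[OF Cinf_pd[OF \<theta> i]])
    fix j assume "j < m"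
    then have "f j \<in> Cinf (Suc n)" "g j \<in> Cinf (Suc n)"
      using f g Cinf_mono[of n "Suc n"] by auto
    then show "(\<lambda>s. g j s + s n * (f j s - g j s)) \<in> Cinf (Suc n)"
      by (intro Cinf_add Cinf_mult Cinf_diff Cinf_coord) simp_all
  qed
  from Cinf_integral[OF this]
  have "(\<lambda>x. integral {0..1} (\<lambda>t. pd i \<theta> (\<lambda>j. g j (x(n := t)) + t * (f j (x(n := t)) - g j (x(n := t)))))) \<in> Cinf n"
    by simp
  moreover have "pd i \<theta> (\<lambda>j. g j (x(n := t)) + t * (f j (x(n := t)) - g j (x(n := t)))) =
     pd i \<theta> (\<lambda>j. g j x + t * (f j x - g j x))" for x t
    by (rule depD[OF Cinf_dep[OF Cinf_pd[OF \<theta> i]]])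
       (simp add: dep_upd[OF Cinf_dep[OF f]] dep_upd[OF Cinf_dep[OF g]])
  ultimately show "G i \<in> Cinf n" unfolding G_def by simp
next
  define G where "G i s = integral {0..1} (\<lambda>t. pd i \<theta> (\<lambda>j. g j s + t * (f j s - g j s)))" for i s
  fix s
  define c where "c t = (\<lambda>j. g j s + t * (f j s - g j s))" for t
  have der: "((\<lambda>t. \<theta> (c t)) has_real_derivative (\<Sum>i<m. pd i \<theta> (c t) * (f i s - g i s))) (at t)" for t
    by (rule chain_rule[OF \<theta>]) (auto simp: c_def intro!: derivative_eq_intros)
  have "((\<lambda>t. \<Sum>i<m. pd i \<theta> (c t) * (f i s - g i s)) has_integral \<theta> (c 1) - \<theta> (c 0)) {0..1}"
    by (rule fundamental_theorem_of_calculus)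
       (use der in \<open>auto simp: has_real_derivative_iff_has_vector_derivative[symmetric] intro: has_field_derivative_at_within\<close>)
  moreover have "((\<lambda>t. \<Sum>i<m. pd i \<theta> (c t) * (f i s - g i s)) has_integral (\<Sum>i<m. G i s * (f i s - g i s))) {0..1}"
  proof (intro has_integral_sum has_integral_mult_left)
    fix i assume "i \<in> {..<m}"
    then have "continuous_on {0..1} (\<lambda>t. pd i \<theta> (c t))" unfolding c_def
      by (intro continuous_compose_pt[OF Cinf_pd[OF \<theta>]]) (auto intro!: continuous_intros)
    then have "(\<lambda>t. pd i \<theta> (c t)) integrable_on {0..1}" by (rule integrable_continuous_real)
    then show "((\<lambda>t. pd i \<theta> (c t)) has_integral G i s) {0..1}"
      unfolding G_def c_def by (rule integrable_integral)
  qed simp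
  ultimately have "\<theta> (c 1) - \<theta> (c 0) = (\<Sum>i<m. G i s * (f i s - g i s))"
    by (rule has_integral_unique)
  then show "\<theta> (\<lambda>i. f i s) - \<theta> (\<lambda>i. g i s) = (\<Sum>i<m. (f i s - g i s) * G i s)"
    by (simp add: c_def mult.commute)
qed

section \<open>Ideals of smooth functions and their fibres\<close>

text \<open>With both sets variable, these sums describe the pulled back ideal as well as the main
  part and the remainder of a Taylor expansion.\<close>

definition fsums :: "(pt \<Rightarrow> real) set \<Rightarrow> (pt \<Rightarrow> real) set \<Rightarrow> (pt \<Rightarrow> real) set" where
  "fsums I G = {f. \<exists>(m::nat) h g. (\<forall>i<m. h i \<in> I \<and> g i \<in> G) \<and> f = (\<lambda>x. \<Sum>i<m. h i x * g i x)}"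

lemma pullback_ideal_fsums: "pullback_ideal l k I = fsums I (Cinf (l + k))"
  by (simp add: pullback_ideal_def fsums_def)

lemma fsums_zero [intro]: "(\<lambda>_. 0) \<in> fsums I G"
  unfolding fsums_def by (rule CollectI, rule exI[of _ 0]) auto

lemma fsums_step:
  assumes "f \<in> fsums I G" "h \<in> I" "g \<in> G"
  shows "(\<lambda>x. f x + h x * g x) \<in> fsums I G"
proof -
  obtain m h' g' where *: "\<forall>i<(m::nat). h' i \<in> I \<and> g' i \<in> G" "f = (\<lambda>x. \<Sum>i<m. h' i x * g' i x)"
    using assms(1) unfolding fsums_def by blast
  have "\<forall>i<Suc m. (h'(m := h)) i \<in> I \<and> (g'(m := g)) i \<in> G"
    using * assms by (auto simp: less_Suc_eq)
  moreover have "(\<lambda>x. f x + h x * g x) = (\<lambda>x. \<Sum>i<Suc m. (h'(m := h)) i x * (g'(m := g)) i x)"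
    using *(2) by auto
  ultimately show ?thesis unfolding fsums_def by blast
qed

lemma fsums_single: "h \<in> I \<Longrightarrow> g \<in> G \<Longrightarrow> (\<lambda>x. h x * g x) \<in> fsums I G"
  using fsums_step[OF fsums_zero] by auto

lemma fsums_induct [consumes 1, case_names zero step]:
  assumes "f \<in> fsums I G" and "P (\<lambda>_. 0)"
    and "\<And>f h g. f \<in> fsums I G \<Longrightarrow> P f \<Longrightarrow> h \<in> I \<Longrightarrow> g \<in> G \<Longrightarrow> P (\<lambda>x. f x + h x * g x)"
  shows "P f"
proof -
  obtain m h g where *: "\<forall>i<(m::nat). h i \<in> I \<and> g i \<in> G" "f = (\<lambda>x. \<Sum>i<m. h i x * g i x)"
    using assms(1) unfolding fsums_def by blast
  have "j \<le> m \<Longrightarrow> P (\<lambda>x. \<Sum>i<j. h i x * g i x) \<and> (\<lambda>x. \<Sum>i<j. h i x * g i x) \<in> fsums I G" for j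
  proof (induction j)
    case (Suc j)
    then show ?case using assms(3)[of "\<lambda>x. \<Sum>i<j. h i x * g i x" "h j" "g j"]
      fsums_step[of "\<lambda>x. \<Sum>i<j. h i x * g i x" I G "h j" "g j"] *(1) by auto
  qed (use assms(2) in auto)
  then show ?thesis using *(2) by auto
qed

lemma fsums_add:
  assumes "f \<in> fsums I G" "f' \<in> fsums I G"
  shows "(\<lambda>x. f x + f' x) \<in> fsums I G"
  using assms(2)
proof (induction rule: fsums_induct)
  case (step f' h g)
  from fsums_step[OF step.IH step.hyps(2,3)] show ?case by (simp add: add.assoc)
qed (use assms(1) in simp)

lemma fsums_mono: "f \<in> fsums I G \<Longrightarrow> I \<subseteq> I' \<Longrightarrow> G \<subseteq> G' \<Longrightarrow> f \<in> fsums I' G'"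
  by (induction rule: fsums_induct) (auto intro: fsums_step)

lemma fsums_mult:
  assumes "f \<in> fsums I G" "\<And>g. g \<in> G \<Longrightarrow> (\<lambda>x. g x * w x) \<in> G'"
  shows "(\<lambda>x. f x * w x) \<in> fsums I G'"
  using assms(1)
proof (induction rule: fsums_induct)
  case (step f h g)
  then show ?case using fsums_step[OF step.IH step.hyps(2) assms(2)[OF step.hyps(3)]]
    by (simp add: algebra_simps)
qed auto

lemma fsums_sum:
  "(\<And>i. i \<in> A \<Longrightarrow> f i \<in> fsums I G) \<Longrightarrow> (\<lambda>x. \<Sum>i\<in>A. f i x) \<in> fsums I G"
  by (induction A rule: infinite_finite_induct) (auto intro: fsums_add)

section \<open>Ideals of the rings of smooth functions\<close>

lemma cring_Cinf: "cring (Cinf_ring n)"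
proof (rule cringI)
  show "abelian_group (Cinf_ring n)"
  proof (rule abelian_groupI)
    show "\<exists>y\<in>carrier (Cinf_ring n). y \<oplus>\<^bsub>Cinf_ring n\<^esub> x = \<zero>\<^bsub>Cinf_ring n\<^esub>"
      if "x \<in> carrier (Cinf_ring n)" for x
      using that by (intro bexI[of _ "\<lambda>s. - x s"]) (auto simp: Cinf_ring_def)
  qed (auto simp: Cinf_ring_def algebra_simps)
  show "Group.comm_monoid (Cinf_ring n)"
    by (rule comm_monoidI) (auto simp: Cinf_ring_def algebra_simps)
qed (auto simp: Cinf_ring_def algebra_simps)

lemma a_inv_Cinf: "f \<in> Cinf n \<Longrightarrow> \<ominus>\<^bsub>Cinf_ring n\<^esub> f = (\<lambda>x. - f x)"
proof -
  assume f: "f \<in> Cinf n"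
  interpret cring "Cinf_ring n" by (rule cring_Cinf)
  show ?thesis by (rule minus_equality) (use f in \<open>auto simp: Cinf_ring_def\<close>)
qed

lemma idealD:
  assumes "ideal I (Cinf_ring n)"
  shows ideal_Cinf: "f \<in> I \<Longrightarrow> f \<in> Cinf n"
    and ideal_zero: "(\<lambda>_. 0) \<in> I"
    and ideal_add: "f \<in> I \<Longrightarrow> g \<in> I \<Longrightarrow> (\<lambda>x. f x + g x) \<in> I"
    and ideal_mult: "f \<in> I \<Longrightarrow> w \<in> Cinf n \<Longrightarrow> (\<lambda>x. f x * w x) \<in> I"
proof -
  interpret ideal I "Cinf_ring n" by fact
  show "f \<in> I \<Longrightarrow> f \<in> Cinf n" using Icarr by (simp add: Cinf_ring_def)
  show "(\<lambda>_. 0) \<in> I" using additive_subgroup.zero_closed[OF is_additive_subgroup] unfolding Cinf_ring_def by simp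
  show "f \<in> I \<Longrightarrow> g \<in> I \<Longrightarrow> (\<lambda>x. f x + g x) \<in> I" using additive_subgroup.a_closed[OF is_additive_subgroup] by (simp add: Cinf_ring_def)
  show "f \<in> I \<Longrightarrow> w \<in> Cinf n \<Longrightarrow> (\<lambda>x. f x * w x) \<in> I" using I_r_closed by (simp add: Cinf_ring_def)
qed

lemma ideal_mult_left: "ideal I (Cinf_ring n) \<Longrightarrow> f \<in> I \<Longrightarrow> w \<in> Cinf n \<Longrightarrow> (\<lambda>x. w x * f x) \<in> I"
  using ideal_mult[of I n f w] by (simp add: mult.commute)

lemma ideal_uminus: "ideal I (Cinf_ring n) \<Longrightarrow> f \<in> I \<Longrightarrow> (\<lambda>x. - f x) \<in> I"
  using ideal_mult[of I n f "\<lambda>_. -1"] by simp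

lemma ideal_diff: "ideal I (Cinf_ring n) \<Longrightarrow> f \<in> I \<Longrightarrow> g \<in> I \<Longrightarrow> (\<lambda>x. f x - g x) \<in> I"
  using ideal_add[OF _ _ ideal_uminus] by simp

lemma ideal_sum: "ideal I (Cinf_ring n) \<Longrightarrow> (\<And>i. i \<in> A \<Longrightarrow> f i \<in> I) \<Longrightarrow> (\<lambda>x. \<Sum>i\<in>A. f i x) \<in> I"
  by (induction A rule: infinite_finite_induct) (auto intro: ideal_add ideal_zero)

lemma ideal_fsums: "ideal I (Cinf_ring n) \<Longrightarrow> f \<in> fsums I (Cinf n) \<Longrightarrow> f \<in> I"
  by (rotate_tac 1, induction rule: fsums_induct) (auto intro: ideal_add ideal_zero ideal_mult)

lemma fsums_Cinf: "f \<in> fsums I G \<Longrightarrow> I \<subseteq> Cinf n \<Longrightarrow> G \<subseteq> Cinf n \<Longrightarrow> f \<in> Cinf n"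
  by (induction rule: fsums_induct) (auto intro!: Cinf_add Cinf_mult)

lemma ideal_pullback:
  assumes "ideal I (Cinf_ring l)"
  shows "ideal (pullback_ideal l k I) (Cinf_ring (l + k))"
proof -
  interpret R: cring "Cinf_ring (l + k)" by (rule cring_Cinf)
  have I: "I \<subseteq> Cinf (l + k)" using ideal_Cinf[OF assms] Cinf_mono[of l "l + k"] by auto
  have mult: "(\<lambda>x. f x * w x) \<in> pullback_ideal l k I"
    if "f \<in> pullback_ideal l k I" "w \<in> Cinf (l + k)" for f w
    using fsums_mult[of f I "Cinf (l+k)" w "Cinf (l+k)"] that by (auto simp: pullback_ideal_fsums)
  have sub: "pullback_ideal l k I \<subseteq> Cinf (l + k)"
    using I fsums_Cinf unfolding pullback_ideal_fsums by blast
  show ?thesis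
  proof (rule idealI)
    show "subgroup (pullback_ideal l k I) (add_monoid (Cinf_ring (l + k)))"
    proof (rule group.subgroupI[OF R.a_group])
      show "inv\<^bsub>add_monoid (Cinf_ring (l + k))\<^esub> a \<in> pullback_ideal l k I" if "a \<in> pullback_ideal l k I" for a
        using mult[OF that, of "\<lambda>_. -1"] a_inv_Cinf[of a "l + k"] sub that by (auto simp: a_inv_def)
    qed (use sub in \<open>auto simp: Cinf_ring_def pullback_ideal_fsums intro: fsums_add\<close>)
  qed (use mult in \<open>auto simp: Cinf_ring_def R.ring_axioms mult.commute intro: R.ring_axioms[unfolded Cinf_ring_def]\<close>)
qed

section \<open>Functions vanishing to finite order at the origin\<close>

lemma vanishing_0: "vanishing_ideal l 0 = Cinf l"
  by (auto simp: vanishing_ideal_def)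

lemma vanishing_Suc:
  "f \<in> vanishing_ideal l (Suc r) \<longleftrightarrow> f \<in> Cinf l \<and> f (\<lambda>_. 0) = 0 \<and> (\<forall>i<l. pd i f \<in> vanishing_ideal l r)"
    (is "?L \<longleftrightarrow> ?R")
proof
  assume L: ?L
  have *: "pds is f (\<lambda>_. 0) = 0" if "set is \<subseteq> {..<l}" "length is < Suc r" for "is"
    using L that unfolding vanishing_ideal_def by blast
  have "pds is (pd i f) (\<lambda>_. 0) = 0" if "i < l" "set is \<subseteq> {..<l}" "length is < r" for i "is"
    using *[of "i # is"] that by simp
  then show ?R using L *[of "[]"] unfolding vanishing_ideal_def by auto
next
  assume R: ?R
  have "pds is f (\<lambda>_. 0) = 0" if "set is \<subseteq> {..<l}" "length is < Suc r" for "is"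
    using R that unfolding vanishing_ideal_def by (cases "is") auto
  then show ?L using R unfolding vanishing_ideal_def by auto
qed

lemma vanishing_Cinf: "f \<in> vanishing_ideal l r \<Longrightarrow> f \<in> Cinf l"
  by (simp add: vanishing_ideal_def)

lemma vanishing_mono: "f \<in> vanishing_ideal l (Suc r) \<Longrightarrow> f \<in> vanishing_ideal l r"
  by (auto simp: vanishing_ideal_def)

lemma vanishing_add:
  "f \<in> vanishing_ideal l r \<Longrightarrow> g \<in> vanishing_ideal l r \<Longrightarrow> (\<lambda>x. f x + g x) \<in> vanishing_ideal l r"
  by (induction r arbitrary: f g) (auto simp: vanishing_0 vanishing_Suc pd_add)

lemma vanishing_mult:
  "f \<in> vanishing_ideal l r \<Longrightarrow> g \<in> Cinf l \<Longrightarrow> (\<lambda>x. f x * g x) \<in> vanishing_ideal l r"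
proof (induction r arbitrary: f g)
  case (Suc r)
  have f: "f \<in> Cinf l" "f \<in> vanishing_ideal l r" using Suc.prems vanishing_Cinf vanishing_mono by blast+
  show ?case unfolding vanishing_Suc
  proof (intro conjI allI impI)
    fix i assume i: "i < l"
    show "pd i (\<lambda>x. f x * g x) \<in> vanishing_ideal l r"
      unfolding pd_mult[OF f(1) Suc.prems(2) i]
      using Suc i f by (intro vanishing_add Suc.IH) (auto simp: vanishing_Suc)
  qed (use Suc.prems f in \<open>auto simp: vanishing_Suc\<close>)
qed (auto simp: vanishing_0)

lemma vanishing_mult_Suc:
  "f \<in> vanishing_ideal l r \<Longrightarrow> g \<in> Cinf l \<Longrightarrow> g (\<lambda>_. 0) = 0 \<Longrightarrow> (\<lambda>x. f x * g x) \<in> vanishing_ideal l (Suc r)"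
proof (induction r arbitrary: f)
  case 0
  then show ?case by (auto simp: vanishing_0 vanishing_Suc Cinf_pd)
next
  case (Suc r)
  have f: "f \<in> Cinf l" using Suc.prems vanishing_Cinf by blast
  show ?case unfolding vanishing_Suc[of _ _ "Suc r"]
  proof (intro conjI allI impI)
    fix i assume i: "i < l"
    show "pd i (\<lambda>x. f x * g x) \<in> vanishing_ideal l (Suc r)"
      unfolding pd_mult[OF f Suc.prems(2) i]
      using Suc i f by (intro vanishing_add Suc.IH vanishing_mult) (auto simp: vanishing_Suc[of f])
  qed (use Suc.prems f in auto)
qed

lemma vanishing_power:
  assumes "f \<in> Cinf l" "f (\<lambda>_. 0) = 0"
  shows "(\<lambda>x. f x ^ r) \<in> vanishing_ideal l r"
proof (induction r)
  case (Suc r)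
  from vanishing_mult_Suc[OF this assms] show ?case by (simp add: mult.commute)
qed (simp add: vanishing_0)

text \<open>Near the origin \<open>f\<close> coincides with the zero function, so all its
  derivatives there are zero. Consequently membership in a Weil ideal, which contains some
  \<open>vanishing_ideal l r\<close>, depends on the germ at \<open>0\<close> only.\<close>

lemma vanishing_near_zero:
  assumes "f \<in> Cinf l" "open U" "(\<lambda>_. 0) \<in> U" "\<And>x. x \<in> U \<Longrightarrow> f x = 0"
  shows "f \<in> vanishing_ideal l r"
proof -
  have "pds is (\<lambda>_. 0) = (\<lambda>_. 0)" for "is" by (induction "is") auto
  then have "pds is f (\<lambda>_. 0) = 0" for "is"
    using pds_cong[OF assms(2), of f "\<lambda>_. 0"] assms by auto
  then show ?thesis using assms(1) by (simp add: vanishing_ideal_def)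
qed

text \<open>A member with value \<open>a \<noteq> 0\<close> at the origin would be invertible modulo
  \<open>I\<close>: \<open>h = 1 - f / a\<close> vanishes at \<open>0\<close>, so a power of it lies
  in \<open>I\<close>, while \<open>1 - h ^ j\<close> is a multiple of \<open>f\<close>. Together
  they put \<open>1\<close> into \<open>I\<close>.\<close>

lemma weil_ideal_zero_at_0:
  assumes I: "weil_ideal l I" and f: "f \<in> I"
  shows "f (\<lambda>_. 0) = 0"
proof (rule ccontr)
  define a where "a = f (\<lambda>_. 0)"
  assume "f (\<lambda>_. 0) \<noteq> 0"
  then have a: "a \<noteq> 0" by (simp add: a_def)
  have id: "ideal I (Cinf_ring l)" and ne: "I \<noteq> Cinf l" using I by (auto simp: weil_ideal_def)
  obtain r where r: "vanishing_ideal l r \<subseteq> I" using I by (auto simp: weil_ideal_def)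
  have fC: "f \<in> Cinf l" using ideal_Cinf[OF id f] .
  define h where "h x = 1 - (1 / a) * f x" for x
  have h: "h \<in> Cinf l" unfolding h_def by (intro Cinf_diff Cinf_mult fC Cinf_const)
  have h0: "h (\<lambda>_. 0) = 0" using a by (simp add: h_def a_def)
  have 1: "(\<lambda>x. 1 - h x ^ j) \<in> I" for j
  proof (induction j)
    case (Suc j)
    have "(\<lambda>x. f x * ((1 / a) * h x ^ j)) \<in> I"
      by (intro ideal_mult[OF id f] Cinf_mult Cinf_power h Cinf_const)
    from ideal_add[OF id Suc this] show ?case by (simp add: h_def algebra_simps)
  qed (use ideal_zero[OF id] in simp)
  have "(\<lambda>x. h x ^ r) \<in> I" using vanishing_power[OF h h0] r by blast
  from ideal_add[OF id 1[of r] this] have "(\<lambda>x. 1) \<in> I" by simp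
  from ideal_mult[OF id this] have "Cinf l \<subseteq> I" by auto
  then show False using ne ideal_Cinf[OF id] by blast
qed

lemma sum_fun_apply: "sum f A x = (\<Sum>i\<in>A. f i x)"
  by (induction A rule: infinite_finite_induct) auto

text \<open>The coordinates of \<open>t\<close> below \<open>l\<close> are overwritten, so that any
  point of a fibre may serve as its label \<open>t\<close>.\<close>

definition fibre :: "nat \<Rightarrow> (pt \<Rightarrow> real) \<Rightarrow> pt \<Rightarrow> pt \<Rightarrow> real" where
  "fibre l f t = (\<lambda>x. f (\<lambda>i. if i < l then x i else t i))"

lemma fibre_Cinf: "f \<in> Cinf (l + k) \<Longrightarrow> fibre l f t \<in> Cinf l"
  unfolding fibre_def
proof (rule Cinf_compose[of f "l + k" "\<lambda>i s. if i < l then s i else t i"])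
  show "(\<lambda>s. if i < l then s i else t i) \<in> Cinf l" for i by (cases "i < l") auto
qed

lemma pullback_fibre:
  assumes I: "ideal I (Cinf_ring l)" and f: "f \<in> pullback_ideal l k I"
  shows "fibre l f t \<in> I"
  using f unfolding pullback_ideal_fsums
proof (induction rule: fsums_induct)
  case zero
  show ?case using ideal_zero[OF I] by (simp add: fibre_def)
next
  case (step f h g)
  have "fibre l (\<lambda>x. f x + h x * g x) t = (\<lambda>x. fibre l f t x + h x * fibre l g t x)"
  proof -
    have "h (\<lambda>i. if i < l then x i else t i) = h x" for x
      by (rule depD[OF Cinf_dep[OF ideal_Cinf[OF I step.hyps(2)]]]) simp
    then show ?thesis by (simp add: fibre_def)
  qed
  then show ?case using ideal_add[OF I step.IH ideal_mult[OF I step.hyps(2) fibre_Cinf[OF step.hyps(3)]]] by simp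
qed

text \<open>Iterating Hadamard's lemma avoids multi-indices.\<close>

lemma taylor:
  assumes f: "f \<in> Cinf (l + k)"
  shows "\<exists>P R. P \<in> fsums (Cinf l) {c \<in> Cinf (l + k). \<forall>s x. c (\<lambda>i. if i < l then x i else s i) = c s} \<and>
    R \<in> fsums (vanishing_ideal l r) (Cinf (l + k)) \<and> f = (\<lambda>x. P x + R x)"
proof (induction r)
  case 0
  have "(\<lambda>x. 1 * f x) \<in> fsums (vanishing_ideal l 0) (Cinf (l + k))"
    using f by (intro fsums_single) (auto simp: vanishing_0)
  then show ?case by (intro exI[of _ "\<lambda>_. 0"] exI[of _ f]) auto
next
  case (Suc r)
  let ?T = "{c \<in> Cinf (l + k). \<forall>s x. c (\<lambda>i. if i < l then x i else s i) = c s}"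
  have step: "\<exists>P R. P \<in> fsums (Cinf l) ?T \<and>
    R \<in> fsums (vanishing_ideal l (Suc r)) (Cinf (l + k)) \<and> g = (\<lambda>x. P x + R x)"
    if "g \<in> fsums (vanishing_ideal l r) (Cinf (l + k))" for g
    using that
  proof (induction rule: fsums_induct)
    case zero
    show ?case by (intro exI[of _ "\<lambda>_. 0"]) auto
  next
    case (step g h w)
    then obtain P R where PR: "P \<in> fsums (Cinf l) ?T"
      "R \<in> fsums (vanishing_ideal l (Suc r)) (Cinf (l + k))" "g = (\<lambda>x. P x + R x)" by blast
    \<comment> \<open>Setting the infinitesimal coordinates to zero gives a coefficient constant
      along fibres. By Hadamard's lemma the error is a combination of the coordinates
      \<open>i < l\<close>, each of which raises the order of vanishing of \<open>h\<close> by
      one.\<close>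
    define q where "q i s = (if i < l then 0 else s i)" for i and s :: pt
    have q: "q i \<in> Cinf (l + k)" if "i < l + k" for i
      using that unfolding q_def by (cases "i < l") auto
    obtain G where G: "\<And>i. i < l + k \<Longrightarrow> G i \<in> Cinf (l + k)"
      "\<And>s. w (\<lambda>i. s i) - w (\<lambda>i. q i s) = (\<Sum>i<l + k. (s i - q i s) * G i s)"
      using hadamard[OF step.hyps(3), of "\<lambda>i s. s i" "l + k" q] q by blast
    define P' where "P' x = P x + h x * w (\<lambda>i. q i x)" for x
    define R' where "R' x = R x + (\<Sum>i<l. (h x * x i) * G i x)" for x
    have "(\<lambda>x. w (\<lambda>i. q i x)) \<in> ?T"
      using Cinf_compose[OF step.hyps(3) q] by (auto simp: q_def cong: if_cong)
    then have "P' \<in> fsums (Cinf l) ?T"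
      unfolding P'_def using PR(1) step.hyps(2) vanishing_Cinf by (intro fsums_step) auto
    moreover have "R' \<in> fsums (vanishing_ideal l (Suc r)) (Cinf (l + k))"
      unfolding R'_def using step.hyps(2) PR(2) G(1)
      by (intro fsums_add fsums_sum fsums_single[where h = "\<lambda>x. h x * x _"] vanishing_mult_Suc) auto
    moreover have "g x + h x * w x = P' x + R' x" for x
    proof -
      have "(\<Sum>i<l + k. (x i - q i x) * G i x) = (\<Sum>i<l. (x i - q i x) * G i x)"
        by (rule sum.mono_neutral_right) (auto simp: q_def)
      also have "\<dots> = (\<Sum>i<l. x i * G i x)" by (rule sum.cong) (auto simp: q_def)
      finally have "w x = w (\<lambda>i. q i x) + (\<Sum>i<l. x i * G i x)" using G(2)[of x] by simp
      then show ?thesis by (simp add: P'_def R'_def PR(3) algebra_simps sum_distrib_left)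
    qed
    ultimately show ?case by blast
  qed
  obtain P R where PR: "P \<in> fsums (Cinf l) ?T" "R \<in> fsums (vanishing_ideal l r) (Cinf (l + k))"
    "f = (\<lambda>x. P x + R x)" using Suc by blast
  obtain P' R' where PR': "P' \<in> fsums (Cinf l) ?T"
    "R' \<in> fsums (vanishing_ideal l (Suc r)) (Cinf (l + k))" "R = (\<lambda>x. P' x + R' x)"
    using step[OF PR(2)] by blast
  show ?case
    by (rule exI[of _ "\<lambda>x. P x + P' x"], rule exI[of _ R'])
       (use PR PR' in \<open>auto intro: fsums_add\<close>)
qed

text \<open>A linear projection of the space of all functions onto \<open>I\<close> turns the fibrewise
  relation into a presentation by elements of \<open>I\<close>.\<close>

lemma pullback_ideal_fibrewise:
  assumes I: "weil_ideal l I"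
  shows "f \<in> pullback_ideal l k I \<longleftrightarrow> f \<in> Cinf (l + k) \<and> (\<forall>t. fibre l f t \<in> I)"
proof
  have id: "ideal I (Cinf_ring l)" using I by (simp add: weil_ideal_def)
  show "f \<in> Cinf (l + k) \<and> (\<forall>t. fibre l f t \<in> I)" if "f \<in> pullback_ideal l k I"
    using pullback_fibre[OF id that] ideal_Cinf[OF ideal_pullback[OF id] that] by blast
  assume *: "f \<in> Cinf (l + k) \<and> (\<forall>t. fibre l f t \<in> I)"
  let ?T = "{c \<in> Cinf (l + k). \<forall>s x. c (\<lambda>i. if i < l then x i else s i) = c s}"
  obtain r where r: "vanishing_ideal l r \<subseteq> I" using I by (auto simp: weil_ideal_def)
  obtain P R where P: "P \<in> fsums (Cinf l) ?T" and R: "R \<in> fsums (vanishing_ideal l r) (Cinf (l + k))"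
    and f: "f = (\<lambda>x. P x + R x)" using taylor[of f l k r] * by blast
  have R': "R \<in> pullback_ideal l k I"
    unfolding pullback_ideal_fsums using fsums_mono[OF R r] by blast
  obtain m a c where mac: "\<forall>i<(m::nat). a i \<in> Cinf l \<and> c i \<in> ?T" "P = (\<lambda>x. \<Sum>i<m. a i x * c i x)"
    using P unfolding fsums_def by blast
  \<comment> \<open>The projection \<open>p\<close> comes from an algebraic complement, without any
    continuity. It acts on the finitely many \<open>a i\<close>; the smooth dependence on the
    parameters sits in the \<open>c i\<close> and survives.\<close>
  have "subspace I"
    by (rule subspaceI)
       (use ideal_zero[OF id] ideal_add[OF id] ideal_mult_left[OF id] in
         \<open>auto simp: zero_fun_def plus_fun_def scaleR_fun_def\<close>)
  then obtain p where p: "range p \<subseteq> I" "linear p" "\<And>v. v \<in> I \<Longrightarrow> p v = v"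
    using linear_exists_left_inverse_on[OF linear_id, of I] by auto
  have Pp: "P x = (\<Sum>i<m. p (a i) x * c i x)" for x
  proof -
    \<comment> \<open>The \<open>c i\<close> are constant along the fibre through \<open>x\<close>,
      so the restriction of \<open>P\<close> to this fibre is a combination of the
      \<open>a i\<close> with constant coefficients.\<close>
    let ?v = "\<Sum>i<m. c i x *\<^sub>R a i"
    have "fibre l P x = (\<lambda>y. fibre l f x y - fibre l R x y)" by (simp add: fibre_def f)
    then have "fibre l P x \<in> I" using * pullback_fibre[OF id R'] ideal_diff[OF id] by simp
    moreover have "fibre l P x = ?v"
    proof
      fix y
      have "a i (\<lambda>i. if i < l then y i else x i) = a i y" if "i < m" for i
        
        by (rule depD[OF Cinf_dep[of _ l]]) (use mac(1) that in auto)
      then show "fibre l P x y = ?v y"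
        using mac(1) unfolding fibre_def mac(2) by (simp add: sum_fun_apply scaleR_fun_def mult.commute)
    qed
    ultimately have "p ?v = ?v" "fibre l P x = ?v" using p(3) by auto
    moreover have "p ?v = (\<Sum>i<m. c i x *\<^sub>R p (a i))"
      by (simp add: linear_sum[OF p(2)] linear_cmul[OF p(2)])
    \<comment> \<open>Evaluating the fibre through \<open>x\<close> at the point \<open>x\<close>
      itself recovers \<open>P x\<close>.\<close>
    ultimately have "fibre l P x x = (\<Sum>i<m. c i x *\<^sub>R p (a i)) x" by simp
    then show ?thesis by (simp add: fibre_def sum_fun_apply scaleR_fun_def mult.commute)
  qed
  have "P \<in> pullback_ideal l k I"
    unfolding pullback_ideal_fsums fsums_def
    by (rule CollectI, rule exI[of _ m], rule exI[of _ "\<lambda>i. p (a i)"], rule exI[of _ c])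
       (use Pp p(1) mac(1) in auto)
  then show "f \<in> pullback_ideal l k I"
    unfolding f using R' ideal_add[OF ideal_pullback[OF id]] by blast
qed

section \<open>Stages and their morphisms\<close>

lemma site_weil:
  assumes "A \<in> site_obj"
  obtains I where "weil_ideal (ldim A) I" "sideal A = pullback_ideal (ldim A) (kdim A) I"
  using assms unfolding site_obj_def by blast

lemma site_ideal: "A \<in> site_obj \<Longrightarrow> ideal (sideal A) (Cinf_ring (sdim A))"
  using ideal_pullback unfolding site_obj_def weil_ideal_def by fastforce

lemma mem_cls: "h \<in> cls A f \<longleftrightarrow> (\<lambda>x. h x - f x) \<in> sideal A"
proof -
  have "h = (\<lambda>x. j x + f x) \<longleftrightarrow> j = (\<lambda>x. h x - f x)" for j
    by (auto simp: fun_eq_iff)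
  then show ?thesis unfolding cls_def a_r_coset_def' by (auto simp: Cinf_ring_def)
qed

lemma cls_eq:
  assumes "A \<in> site_obj"
  shows "cls A f = cls A g \<longleftrightarrow> (\<lambda>x. f x - g x) \<in> sideal A"
proof
  note id = site_ideal[OF assms]
  show "(\<lambda>x. f x - g x) \<in> sideal A" if "cls A f = cls A g"
    using that mem_cls[of f A f] mem_cls[of f A g] ideal_zero[OF id] by auto
  assume *: "(\<lambda>x. f x - g x) \<in> sideal A"
  have "(\<lambda>x. h x - f x) \<in> sideal A \<longleftrightarrow> (\<lambda>x. h x - g x) \<in> sideal A" for h
    using ideal_add[OF id _ *, of "\<lambda>x. h x - f x"] ideal_diff[OF id _ *, of "\<lambda>x. h x - g x"]
    by auto
  then show "cls A f = cls A g" using mem_cls by blast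
qed

lemma sideal_Cinf: "A \<in> site_obj \<Longrightarrow> f \<in> sideal A \<Longrightarrow> f \<in> Cinf (sdim A)"
  using ideal_Cinf site_ideal by blast

lemma rep_cls:
  assumes "A \<in> site_obj"
  shows "(\<lambda>x. rep (cls A f) x - f x) \<in> sideal A"
proof -
  have "f \<in> cls A f" using ideal_zero[OF site_ideal[OF assms]] by (simp add: mem_cls)
  then have "rep (cls A f) \<in> cls A f" unfolding rep_def by (rule someI[where P = "\<lambda>h. h \<in> cls A f"])
  then show ?thesis by (simp add: mem_cls)
qed

lemma cls_rep_cls: "A \<in> site_obj \<Longrightarrow> cls A (rep (cls A f)) = cls A f"
  using rep_cls cls_eq by blast

lemma rep_cls_Cinf:
  assumes "A \<in> site_obj" "f \<in> Cinf (sdim A)"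
  shows "rep (cls A f) \<in> Cinf (sdim A)"
  using Cinf_add[OF sideal_Cinf[OF assms(1) rep_cls[OF assms(1), of f]] assms(2)] by simp

lemma carrier_alg: "carrier (alg A) = {cls A f |f. f \<in> Cinf (sdim A)}"
  unfolding alg_def FactRing_def A_RCOSETS_def' cls_def by (auto simp: Cinf_ring_def)

lemma cls_carrier [intro]: "f \<in> Cinf (sdim A) \<Longrightarrow> cls A f \<in> carrier (alg A)"
  by (auto simp: carrier_alg)

lemma carrier_algE:
  assumes "A \<in> site_obj" "a \<in> carrier (alg A)"
  shows rep_Cinf: "rep a \<in> Cinf (sdim A)" and cls_rep: "cls A (rep a) = a"
  using assms by (auto simp: carrier_alg rep_cls_Cinf cls_rep_cls)

lemma ring_alg: "A \<in> site_obj \<Longrightarrow> ring (alg A)"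
  unfolding alg_def by (intro ideal.quotient_is_ring site_ideal)

lemma zero_alg: "A \<in> site_obj \<Longrightarrow> \<zero>\<^bsub>alg A\<^esub> = cls A (\<lambda>_. 0)"
proof -
  assume A: "A \<in> site_obj"
  have "\<zero>\<^bsub>alg A\<^esub> = sideal A" by (simp add: alg_def FactRing_def)
  also have "\<dots> = cls A (\<lambda>_. 0)" using mem_cls[of _ A "\<lambda>_. 0"] by auto
  finally show ?thesis .
qed

lemma add_cls:
  assumes "A \<in> site_obj" "f \<in> Cinf (sdim A)" "g \<in> Cinf (sdim A)"
  shows "cls A f \<oplus>\<^bsub>alg A\<^esub> cls A g = cls A (\<lambda>x. f x + g x)"
  using ring_hom_add[OF ideal.rcos_ring_hom[OF site_ideal[OF assms(1)]], of f g] assms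
  unfolding alg_def cls_def by (simp add: Cinf_ring_def)

lemma a_inv_cls:
  assumes A: "A \<in> site_obj" and f: "f \<in> Cinf (sdim A)"
  shows "\<ominus>\<^bsub>alg A\<^esub> cls A f = cls A (\<lambda>x. - f x)"
proof -
  interpret ring "alg A" using A by (rule ring_alg)
  show ?thesis
  proof (rule minus_equality)
    show "cls A (\<lambda>x. - f x) \<oplus>\<^bsub>alg A\<^esub> cls A f = \<zero>\<^bsub>alg A\<^esub>"
      using f by (subst add_cls[OF A]) (auto simp: zero_alg[OF A])
  qed (use f in auto)
qed

lemma minus_cls:
  assumes A: "A \<in> site_obj" and f: "f \<in> Cinf (sdim A)" "g \<in> Cinf (sdim A)"
  shows "cls A f \<ominus>\<^bsub>alg A\<^esub> cls A g = cls A (\<lambda>x. f x - g x)"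
  unfolding a_minus_def a_inv_cls[OF A f(2)] using f by (subst add_cls[OF A]) auto

text \<open>Hadamard's lemma makes the difference of the composites a combination of the differences
  \<open>f i - g i\<close>. Hence an ideal is a congruence for all smooth operations, and
  \<open>smooth_op\<close> does not depend on representatives.\<close>

lemma compose_cong:
  assumes A: "A \<in> site_obj" and \<theta>: "\<theta> \<in> Cinf m"
    and f: "\<And>i. i < m \<Longrightarrow> f i \<in> Cinf (sdim A)" and g: "\<And>i. i < m \<Longrightarrow> g i \<in> Cinf (sdim A)"
    and fg: "\<And>i. i < m \<Longrightarrow> cls A (f i) = cls A (g i)"
  shows "cls A (\<lambda>s. \<theta> (\<lambda>i. f i s)) = cls A (\<lambda>s. \<theta> (\<lambda>i. g i s))"
proof -
  note id = site_ideal[OF A]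
  obtain G where G: "\<And>i. i < m \<Longrightarrow> G i \<in> Cinf (sdim A)"
    "\<And>s. \<theta> (\<lambda>i. f i s) - \<theta> (\<lambda>i. g i s) = (\<Sum>i<m. (f i s - g i s) * G i s)"
    using hadamard[of \<theta> m f "sdim A" g] \<theta> f g by blast
  show ?thesis unfolding cls_eq[OF A] G(2)
    using fg G(1) unfolding cls_eq[OF A] by (intro ideal_sum[OF id] ideal_mult[OF id]) auto
qed

lemma smooth_op_cls:
  assumes A: "A \<in> site_obj" and \<theta>: "\<theta> \<in> Cinf m"
    and f: "\<And>i. i < m \<Longrightarrow> f i \<in> Cinf (sdim A)" and a: "\<And>i. i < m \<Longrightarrow> a i = cls A (f i)"
  shows "smooth_op A \<theta> a = cls A (\<lambda>s. \<theta> (\<lambda>i. f i s))"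
  unfolding smooth_op_def
  by (rule compose_cong[OF A \<theta>]) (use f a rep_cls_Cinf[OF A] cls_rep_cls[OF A] in auto)

text \<open>Any representatives \<open>p\<close> are allowed, not only those picked by
  \<open>hom_map\<close>, so that composites and explicitly constructed maps can be used
  directly.\<close>

definition lifts :: "stage \<Rightarrow> stage \<Rightarrow> hom \<Rightarrow> (nat \<Rightarrow> pt \<Rightarrow> real) \<Rightarrow> bool" where
  "lifts A B u p \<longleftrightarrow> (\<forall>i<sdim A. p i \<in> Cinf (sdim B) \<and> cls B (p i) = u (cls A (\<lambda>x. x i)))"

lemma lifts_Cinf: "lifts A B u p \<Longrightarrow> i < sdim A \<Longrightarrow> p i \<in> Cinf (sdim B)"
  by (simp add: lifts_def)

text \<open>A class is the smooth operation \<open>f\<close> applied to the classes of the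
  coordinates, and a homomorphism commutes with it. Morphisms are thus substitutions.\<close>

lemma Hom_cls:
  assumes A: "A \<in> site_obj" and B: "B \<in> site_obj" and u: "u \<in> Hom A B" and p: "lifts A B u p"
    and f: "f \<in> Cinf (sdim A)"
  shows "u (cls A f) = cls B (\<lambda>s. f (\<lambda>i. p i s))"
proof -
  have c: "\<And>i. i < sdim A \<Longrightarrow> (\<lambda>x. x i) \<in> Cinf (sdim A)" by auto
  have "cls A f = smooth_op A f (\<lambda>i. cls A (\<lambda>x. x i))"
    using smooth_op_cls[OF A f c] by simp
  also have "u \<dots> = smooth_op B f (\<lambda>i. u (cls A (\<lambda>x. x i)))"
  proof -
    have H: "\<forall>m \<theta> a. \<theta> \<in> Cinf m \<and> (\<forall>i<m. a i \<in> carrier (alg A)) \<longrightarrow>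
        u (smooth_op A \<theta> a) = smooth_op B \<theta> (\<lambda>i. u (a i))" using u by (simp add: Hom_def)
    show ?thesis
      by (rule H[THEN spec, THEN spec, THEN spec, THEN mp, of _ "sdim A"]) (use f c in blast)
  qed
  also have "\<dots> = cls B (\<lambda>s. f (\<lambda>i. p i s))"
    using p by (intro smooth_op_cls[OF B f]) (auto simp: lifts_def)
  finally show ?thesis .
qed

lemma Hom_carrier: "u \<in> Hom A B \<Longrightarrow> a \<in> carrier (alg A) \<Longrightarrow> u a \<in> carrier (alg B)"
  unfolding Hom_def by auto

lemma lifts_hom_map:
  assumes "B \<in> site_obj" "u \<in> Hom A B"
  shows "lifts A B u (\<lambda>i s. hom_map A u s i)"
  unfolding lifts_def hom_map_def
  using carrier_algE[OF assms(1) Hom_carrier[OF assms(2)]] by (auto simp: cls_carrier Cinf_coord cong: if_cong)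

lemma lifts_sideal:
  assumes A: "A \<in> site_obj" and B: "B \<in> site_obj" and u: "u \<in> Hom A B" and p: "lifts A B u p"
    and f: "f \<in> sideal A"
  shows "(\<lambda>s. f (\<lambda>i. p i s)) \<in> sideal B"
proof -
  have "cls A f = cls A (\<lambda>_. 0)" using f by (simp add: cls_eq[OF A])
  then have "cls B (\<lambda>s. f (\<lambda>i. p i s)) = cls B (\<lambda>_. 0)"
    using Hom_cls[OF A B u p sideal_Cinf[OF A f]] Hom_cls[OF A B u p, of "\<lambda>_. 0"] by simp
  then show ?thesis by (simp add: cls_eq[OF B])
qed

lemma Hom_eqI:
  assumes A: "A \<in> site_obj" and B: "B \<in> site_obj" and u: "u \<in> Hom A B" "lifts A B u p"
    and v: "v \<in> Hom A B" "lifts A B v p"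
  shows "u = v"
proof (rule extensionalityI)
  show "u \<in> extensional (carrier (alg A))" "v \<in> extensional (carrier (alg A))"
    using u v by (auto simp: Hom_def PiE_def)
  fix a assume "a \<in> carrier (alg A)"
  then obtain f where "f \<in> Cinf (sdim A)" "a = cls A f" by (auto simp: carrier_alg)
  then show "u a = v a" using Hom_cls[OF A B u] Hom_cls[OF A B v] by simp
qed

text \<open>The condition under which the substitution of \<open>p\<close> passes to the quotients;
  with \<open>induced\<close> it provides the converse of \<open>lifts\<close>.\<close>

definition ideal_map :: "stage \<Rightarrow> stage \<Rightarrow> (nat \<Rightarrow> pt \<Rightarrow> real) \<Rightarrow> bool" where
  "ideal_map A B p \<longleftrightarrow> (\<forall>i<sdim A. p i \<in> Cinf (sdim B)) \<and>
     (\<forall>f\<in>sideal A. (\<lambda>s. f (\<lambda>i. p i s)) \<in> sideal B)"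

definition induced :: "stage \<Rightarrow> stage \<Rightarrow> (nat \<Rightarrow> pt \<Rightarrow> real) \<Rightarrow> hom" where
  "induced A B p = (\<lambda>a\<in>carrier (alg A). cls B (\<lambda>s. rep a (\<lambda>i. p i s)))"

lemma induced_cls:
  assumes A: "A \<in> site_obj" and B: "B \<in> site_obj" and p: "ideal_map A B p" and f: "f \<in> Cinf (sdim A)"
  shows "induced A B p (cls A f) = cls B (\<lambda>s. f (\<lambda>i. p i s))"
  using p rep_cls[OF A, of f] cls_carrier[OF f]
  unfolding induced_def ideal_map_def by (auto simp: cls_eq[OF B])

lemma induced_Hom:
  assumes A: "A \<in> site_obj" and B: "B \<in> site_obj" and p: "ideal_map A B p"
  shows "induced A B p \<in> Hom A B"
proof -
  have pC: "\<And>i. i < sdim A \<Longrightarrow> p i \<in> Cinf (sdim B)" using p by (simp add: ideal_map_def)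
  have "induced A B p (smooth_op A \<theta> a) = smooth_op B \<theta> (\<lambda>i. induced A B p (a i))"
    if \<theta>: "\<theta> \<in> Cinf m" and a: "\<forall>i<m. a i \<in> carrier (alg A)" for m \<theta> a
  proof -
    have r: "rep (a i) \<in> Cinf (sdim A)" "a i = cls A (rep (a i))" if "i < m" for i
      using carrier_algE[OF A] a that by auto
    have "smooth_op A \<theta> a = cls A (\<lambda>s. \<theta> (\<lambda>i. rep (a i) s))"
      by (simp add: smooth_op_def)
    then have "induced A B p (smooth_op A \<theta> a) = cls B (\<lambda>s. \<theta> (\<lambda>i. rep (a i) (\<lambda>j. p j s)))"
      using induced_cls[OF A B p Cinf_compose[OF \<theta> r(1)]] by simp
    also have "\<dots> = smooth_op B \<theta> (\<lambda>i. induced A B p (a i))"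
    proof (rule smooth_op_cls[OF B \<theta>, symmetric])
      fix i assume i: "i < m"
      show "(\<lambda>s. rep (a i) (\<lambda>j. p j s)) \<in> Cinf (sdim B)" by (rule Cinf_compose[OF r(1)[OF i] pC])
      show "induced A B p (a i) = cls B (\<lambda>s. rep (a i) (\<lambda>j. p j s))"
        using a i by (simp add: induced_def)
    qed
    finally show ?thesis .
  qed
  moreover have "induced A B p \<in> carrier (alg A) \<rightarrow>\<^sub>E carrier (alg B)"
    unfolding induced_def by (auto intro!: cls_carrier Cinf_compose[OF rep_Cinf[OF A]] pC)
  ultimately show ?thesis unfolding Hom_def by blast
qed

lemma lifts_induced:
  assumes A: "A \<in> site_obj" and B: "B \<in> site_obj" and p: "ideal_map A B p"
  shows "lifts A B (induced A B p) p"
  using p induced_cls[OF A B p Cinf_coord] unfolding lifts_def ideal_map_def by auto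

lemma hom_id:
  assumes A: "A \<in> site_obj"
  shows hom_id_Hom: "hom_id A \<in> Hom A A" and lifts_id: "lifts A A (hom_id A) (\<lambda>i s. s i)"
proof -
  have i: "ideal_map A A (\<lambda>i s. s i)" by (auto simp: ideal_map_def)
  have "hom_id A = induced A A (\<lambda>i s. s i)"
    unfolding hom_id_def induced_def using cls_rep[OF A] by (intro restrict_ext) auto
  then show "hom_id A \<in> Hom A A" "lifts A A (hom_id A) (\<lambda>i s. s i)"
    using induced_Hom[OF A A i] lifts_induced[OF A A i] by auto
qed

lemma hom_comp:
  assumes A: "A \<in> site_obj" and B: "B \<in> site_obj" and C: "C \<in> site_obj"
    and u: "u \<in> Hom A B" and v: "v \<in> Hom B C"
  shows hom_comp_Hom: "hom_comp A v u \<in> Hom A C"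
    and lifts_comp: "lifts A B u p \<Longrightarrow> lifts B C v q \<Longrightarrow> lifts A C (hom_comp A v u) (\<lambda>i s. p i (\<lambda>j. q j s))"
proof -
  have *: "hom_comp A v u \<in> Hom A C \<and> lifts A C (hom_comp A v u) (\<lambda>i s. p i (\<lambda>j. q j s))"
    if p: "lifts A B u p" and q: "lifts B C v q" for p q
  proof -
    let ?r = "\<lambda>i s. p i (\<lambda>j. q j s)"
    have i: "ideal_map A C ?r" unfolding ideal_map_def
    proof (intro conjI allI impI ballI)
      show "?r i \<in> Cinf (sdim C)" if "i < sdim A" for i
        using lifts_Cinf[OF p that] lifts_Cinf[OF q] by (rule Cinf_compose)
      show "(\<lambda>s. f (\<lambda>i. ?r i s)) \<in> sideal C" if "f \<in> sideal A" for f
        using lifts_sideal[OF B C v q lifts_sideal[OF A B u p that]] .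
    qed
    have "hom_comp A v u = induced A C ?r"
    proof (rule extensionalityI)
      fix a assume "a \<in> carrier (alg A)"
      then obtain f where f: "f \<in> Cinf (sdim A)" "a = cls A f" by (auto simp: carrier_alg)
      have "(\<lambda>s. f (\<lambda>i. p i s)) \<in> Cinf (sdim B)" using f(1) lifts_Cinf[OF p] by (rule Cinf_compose)
      then show "hom_comp A v u a = induced A C ?r a"
        using f \<open>a \<in> _\<close> Hom_cls[OF A B u p f(1)] Hom_cls[OF B C v q] induced_cls[OF A C i f(1)]
        by (simp add: hom_comp_def compose_def)
    qed (auto simp: hom_comp_def induced_def)
    then show ?thesis using induced_Hom[OF A C i] lifts_induced[OF A C i] by simp
  qed
  show "hom_comp A v u \<in> Hom A C" using * lifts_hom_map B C u v by blast
  show "lifts A B u p \<Longrightarrow> lifts B C v q \<Longrightarrow> lifts A C (hom_comp A v u) (\<lambda>i s. p i (\<lambda>j. q j s))"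
    using * by blast
qed

section \<open>Restriction along the members of a cover\<close>

definition cover_map :: "nat \<Rightarrow> (pt \<Rightarrow> pt) \<Rightarrow> nat \<Rightarrow> pt \<Rightarrow> real" where
  "cover_map l e i s = (if i < l then s i else e (\<lambda>j. s (l + j)) (i - l))"

lemma sideal_fibrewise:
  assumes "A \<in> site_obj"
  shows "\<exists>I. weil_ideal (ldim A) I \<and> sideal A = pullback_ideal (ldim A) (kdim A) I \<and>
    (\<forall>f. f \<in> sideal A \<longleftrightarrow> f \<in> Cinf (sdim A) \<and> (\<forall>t. fibre (ldim A) f t \<in> I))"
  using site_weil[OF assms] pullback_ideal_fibrewise by metis

lemma cover_map_Cinf:
  assumes "open_embedding k e" "i < l + k"
  shows "cover_map l e i \<in> Cinf (l + k)"
proof (cases "i < l")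
  case False
  have "(\<lambda>x. e x (i - l)) \<in> Cinf k" using assms False by (simp add: open_embedding_def)
  then have "(\<lambda>s. e (\<lambda>j. s (l + j)) (i - l)) \<in> Cinf (l + k)"
    by (rule Cinf_compose) auto
  moreover have "cover_map l e i = (\<lambda>s. e (\<lambda>j. s (l + j)) (i - l))" using False by (auto simp: cover_map_def)
  ultimately show ?thesis by simp
next
  case True
  then have "cover_map l e i = (\<lambda>s. s i)" by (auto simp: cover_map_def)
  then show ?thesis using assms by auto
qed

text \<open>The map is the identity on the infinitesimal coordinates, so pulling back along it
  merely relabels the fibres, and the fibrewise criterion is preserved.\<close>

lemma cover_map_ideal_map:
  assumes A: "A \<in> site_obj" and e: "open_embedding (kdim A) e"
  shows "ideal_map A A (cover_map (ldim A) e)"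
  unfolding ideal_map_def
proof (intro conjI allI impI ballI)
  let ?l = "ldim A"
  show *: "cover_map ?l e i \<in> Cinf (sdim A)" if "i < sdim A" for i
    using cover_map_Cinf[OF e that] .
  obtain I where I: "\<And>f. f \<in> sideal A \<longleftrightarrow> f \<in> Cinf (sdim A) \<and> (\<forall>t. fibre ?l f t \<in> I)"
    using sideal_fibrewise[OF A] by blast
  fix f assume f: "f \<in> sideal A"
  have "fibre ?l (\<lambda>s. f (\<lambda>i. cover_map ?l e i s)) t = fibre ?l f (\<lambda>i. cover_map ?l e i t)" for t
    by (auto simp: fibre_def cover_map_def fun_eq_iff intro!: arg_cong[of _ _ f])
  then show "(\<lambda>s. f (\<lambda>i. cover_map ?l e i s)) \<in> sideal A"
    using f Cinf_compose[of f "sdim A" "cover_map ?l e"] * I by auto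
qed

lemma cover_hom_induced: "cover_hom A e = induced A A (cover_map (ldim A) e)"
  unfolding cover_hom_def induced_def cover_map_def ..

text \<open>Each fibre of \<open>f\<close> is also a fibre of one of its restrictions, because the
  images of the embeddings cover \<open>R^k\<close>, and membership in the ideal is decided fibre by
  fibre.\<close>

lemma cover_separated:
  assumes A: "A \<in> site_obj" and f: "f \<in> Cinf (sdim A)"
    and E: "(\<Union>e\<in>E. emb_image (kdim A) e) = UNIV"
    and loc: "\<And>e. e \<in> E \<Longrightarrow> (\<lambda>s. f (\<lambda>i. cover_map (ldim A) e i s)) \<in> sideal A"
  shows "f \<in> sideal A"
proof -
  let ?l = "ldim A"
  obtain I where I: "\<And>f. f \<in> sideal A \<longleftrightarrow> f \<in> Cinf (sdim A) \<and> (\<forall>t. fibre ?l f t \<in> I)"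
    using sideal_fibrewise[OF A] by blast
  have "fibre ?l f t \<in> I" for t
  proof -
    obtain e x where e: "e \<in> E" "\<And>i. i < kdim A \<Longrightarrow> t (?l + i) = e x i"
      using E by (auto simp: emb_image_def set_eq_iff dest: spec[of _ "\<lambda>i. t (?l + i)"])
    have "fibre ?l f t = fibre ?l (\<lambda>s. f (\<lambda>i. cover_map ?l e i s)) (\<lambda>i. x (i - ?l))"
    proof
      fix z
      show "fibre ?l f t z = fibre ?l (\<lambda>s. f (\<lambda>i. cover_map ?l e i s)) (\<lambda>i. x (i - ?l)) z"
        unfolding fibre_def
      proof (rule depD[OF Cinf_dep[OF f]])
        fix i assume "i < sdim A"
        then show "(if i < ?l then z i else t i) =
            cover_map ?l e i (\<lambda>i. if i < ?l then z i else x (i - ?l))"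
          using e(2)[of "i - ?l"] by (auto simp: cover_map_def)
      qed
    qed
    then show ?thesis using loc[OF e(1)] I by auto
  qed
  then show ?thesis using f I by blast
qed

lemma line_simps [simp]: "sec line A = carrier (alg A)" "act line A B u a = u a"
  by (simp_all add: line_def)

text \<open>The forcing clauses of the formula after \<open>b > 0\<close>, unfolded: the stages
  \<open>C\<close>, \<open>D\<close> and \<open>F\<close> come from the universal quantifier, from
  the implication and from the cover for the disjunction; \<open>hom_id D\<close> comes from
  applying a section of \<open>R^R\<close> to an element.\<close>

definition bounds_support ::
  "stage \<Rightarrow> (stage \<Rightarrow> hom \<Rightarrow> elt \<Rightarrow> elt) \<Rightarrow> stage \<Rightarrow> hom \<Rightarrow> elt \<Rightarrow> bool" where
  "bounds_support A \<tau> B u b \<longleftrightarrow>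
     (\<forall>C\<in>site_obj. \<forall>v\<in>Hom B C. \<forall>x\<in>carrier (alg C). \<forall>D\<in>site_obj. \<forall>w\<in>Hom C D.
       (\<exists>T\<in>covers D. \<forall>(F, z)\<in>T.
          \<ominus>\<^bsub>alg F\<^esub> z (w (v b)) \<ominus>\<^bsub>alg F\<^esub> z (w x) \<in> line_pos F \<or>
          z (w x) \<ominus>\<^bsub>alg F\<^esub> z (w (v b)) \<in> line_pos F) \<longrightarrow>
       act line_fun C D w (act line_fun B C v (act line_fun A B u \<tau>)) D (hom_id D) (w x) =
         \<zero>\<^bsub>alg D\<^esub>)"

lemma bounded_support_fml_iff:
  "bounded_support_fml A \<tau> \<longleftrightarrow> (\<exists>S\<in>covers A. \<forall>(B, u)\<in>S. \<exists>b\<in>carrier (alg B).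
     b \<ominus>\<^bsub>alg B\<^esub> \<zero>\<^bsub>alg B\<^esub> \<in> line_pos B \<and> bounds_support A \<tau> B u b)"
  unfolding bounds_support_def bounded_support_fml_def kj_ex_def kj_and_def kj_less_def kj_all_def
    kj_imp_def kj_or_def kj_eq_def kj_app_def kj_zero_def kj_neg_def Let_def psh_prod_def
  by simp

lemma line_fun_act:
  "act line_fun A A' v \<tau> B u x = (if B \<in> site_obj \<and> u \<in> Hom A' B \<and> x \<in> carrier (alg B)
     then \<tau> B (hom_comp A u v) x else undefined)"
  by (simp add: psh_exp_def)

lemma open_embedding_id: "open_embedding k (\<lambda>x. x)"
proof -
  have "emb_image k (\<lambda>x. x) = UNIV" by (auto simp: emb_image_def)
  then show ?thesis unfolding open_embedding_def
    by (intro conjI exI[of _ "\<lambda>x. x"]) (auto simp: Cinf_def[symmetric] Cinf_coord[unfolded Cinf_def, simplified])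
qed

section \<open>Functionals on spaces of smooth functions on the line\<close>

lemma Cinf_line_deriv:
  "f \<in> Cinf_line \<Longrightarrow> ((deriv ^^ j) f has_real_derivative (deriv ^^ Suc j) f x) (at x)"
  by (simp add: Cinf_line_def DERIV_deriv_iff_real_differentiable)

lemma Cinf_lineI:
  assumes "\<And>j x. (g j has_real_derivative g (Suc j) x) (at x)" "g 0 = f"
  shows "f \<in> Cinf_line" and "(deriv ^^ j) f = g j"
proof -
  have *: "(deriv ^^ j) f = g j" for j
  proof (induction j)
    case (Suc j)
    have "deriv (g j) = g (Suc j)" using assms(1) DERIV_imp_deriv by blast
    then show ?case using Suc by simp
  qed (simp add: assms(2))
  then show "(deriv ^^ j) f = g j" by blast
  show "f \<in> Cinf_line" unfolding Cinf_line_def using * assms(1) real_differentiable_def by auto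
qed

lemma Cinf_line_lincomb:
  assumes "f \<in> Cinf_line" "g \<in> Cinf_line"
  shows "(\<lambda>x. a * f x + b * g x) \<in> Cinf_line"
    and "(deriv ^^ j) (\<lambda>x. a * f x + b * g x) = (\<lambda>x. a * (deriv ^^ j) f x + b * (deriv ^^ j) g x)"
proof -
  have *: "((\<lambda>x. a * (deriv ^^ j) f x + b * (deriv ^^ j) g x) has_real_derivative
     a * (deriv ^^ Suc j) f x + b * (deriv ^^ Suc j) g x) (at x)" for j x
    by (intro DERIV_add DERIV_cmult Cinf_line_deriv assms)
  show "(\<lambda>x. a * f x + b * g x) \<in> Cinf_line"
    "(deriv ^^ j) (\<lambda>x. a * f x + b * g x) = (\<lambda>x. a * (deriv ^^ j) f x + b * (deriv ^^ j) g x)"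
    using Cinf_lineI[of "\<lambda>j x. a * (deriv ^^ j) f x + b * (deriv ^^ j) g x", OF *] by auto
qed

lemma Cinf_line_continuous: "f \<in> Cinf_line \<Longrightarrow> continuous_on S ((deriv ^^ j) f)"
  by (intro continuous_at_imp_continuous_on ballI DERIV_isCont[OF Cinf_line_deriv])

definition sup_deriv :: "nat \<Rightarrow> nat \<Rightarrow> (real \<Rightarrow> real) \<Rightarrow> real" where
  "sup_deriv j r f = (SUP x\<in>{- real r..real r}. \<bar>(deriv ^^ j) f x\<bar>)"

lemma sup_deriv_upper:
  assumes "f \<in> Cinf_line" "x \<in> {- real r..real r}"
  shows "\<bar>(deriv ^^ j) f x\<bar> \<le> sup_deriv j r f"
proof -
  have "compact ((\<lambda>x. \<bar>(deriv ^^ j) f x\<bar>) ` {- real r..real r})"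
    by (intro compact_continuous_image continuous_on_rabs Cinf_line_continuous assms) auto
  then have "bdd_above ((\<lambda>x. \<bar>(deriv ^^ j) f x\<bar>) ` {- real r..real r})"
    by (intro bounded_imp_bdd_above compact_imp_bounded)
  then show ?thesis unfolding sup_deriv_def using assms(2) by (rule cSUP_upper2) simp
qed

lemma sup_deriv_least:
  "(\<And>x. x \<in> {- real r..real r} \<Longrightarrow> \<bar>(deriv ^^ j) f x\<bar> \<le> c) \<Longrightarrow> sup_deriv j r f \<le> c"
  unfolding sup_deriv_def by (rule cSUP_least) auto

lemma sup_deriv_add:
  assumes "f \<in> Cinf_line" "g \<in> Cinf_line"
  shows "sup_deriv j r (\<lambda>x. f x + g x) \<le> sup_deriv j r f + sup_deriv j r g"
proof (rule sup_deriv_least)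
  fix x assume x: "x \<in> {- real r..real r}"
  have "(deriv ^^ j) (\<lambda>x. f x + g x) x = (deriv ^^ j) f x + (deriv ^^ j) g x"
    using Cinf_line_lincomb(2)[OF assms, of j 1 1] by simp
  then show "\<bar>(deriv ^^ j) (\<lambda>x. f x + g x) x\<bar> \<le> sup_deriv j r f + sup_deriv j r g"
    using sup_deriv_upper[OF assms(1) x, of j] sup_deriv_upper[OF assms(2) x, of j] by linarith
qed

lemma sup_deriv_zero: "sup_deriv j r (\<lambda>_. 0) = 0"
proof -
  have "(deriv ^^ j) (\<lambda>_. 0 :: real) = (\<lambda>_. 0)"
    using Cinf_lineI(2)[of "\<lambda>_ _. 0" "\<lambda>_. 0" j] by simp
  then show ?thesis by (simp add: sup_deriv_def)
qed

section \<open>Topologies defined by seminorms\<close>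

lemma topspace_seminorm_topology:
  assumes "p \<in> P" "p 0 = 0"
  shows "topspace (seminorm_topology V P) = V"
proof -
  have *: "\<exists>B\<in>{{y\<in>V. p (y - x) < \<epsilon>} |x p \<epsilon>. x \<in> V \<and> p \<in> P \<and> \<epsilon> > 0}. x \<in> B" if "x \<in> V" for x
  proof (rule bexI[of _ "{y \<in> V. p (y - x) < 1}"])
    show "{y \<in> V. p (y - x) < 1} \<in> {{y\<in>V. p (y - x) < \<epsilon>} |x p \<epsilon>. x \<in> V \<and> p \<in> P \<and> \<epsilon> > 0}"
      using that assms(1) zero_less_one by blast
  qed (use that assms(2) in simp)
  show ?thesis unfolding seminorm_topology_def topology_generated_by_topspace
  proof (intro equalityI subsetI)
    show "x \<in> \<Union>{{y\<in>V. p (y - x) < \<epsilon>} |x p \<epsilon>. x \<in> V \<and> p \<in> P \<and> \<epsilon> > 0}" if "x \<in> V" for x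
      using *[OF that] unfolding Union_iff .
  qed auto
qed

text \<open>On a subbasic ball around \<open>x\<close> that contains \<open>l\<close>, the triangle
  inequality leaves the margin \<open>e - p (l - x)\<close> for \<open>p (f n - l)\<close>.
  Intersections and unions follow the generation of the topology.\<close>

lemma limitin_seminorm_topology:
  assumes P: "p0 \<in> P" "p0 0 = 0"
    and sub: "\<And>p x y. p \<in> P \<Longrightarrow> x \<in> V \<Longrightarrow> y \<in> V \<Longrightarrow> p (x + y) \<le> p x + p y"
    and V: "\<And>x y. x \<in> V \<Longrightarrow> y \<in> V \<Longrightarrow> x - y \<in> V"
    and f: "\<And>n. f n \<in> V" "l \<in> V"
    and lim: "\<And>p. p \<in> P \<Longrightarrow> ((\<lambda>n. p (f n - l)) \<longlongrightarrow> 0) F"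
  shows "limitin (seminorm_topology V P) f l F"
  unfolding limitin_def
proof (intro conjI allI impI)
  show "l \<in> topspace (seminorm_topology V P)" using topspace_seminorm_topology[OF P] f(2) by simp
  fix U assume U: "openin (seminorm_topology V P) U \<and> l \<in> U"
  then have "generate_topology_on {{y\<in>V. p (y - x) < \<epsilon>} |x p \<epsilon>. x \<in> V \<and> p \<in> P \<and> \<epsilon> > 0} U"
    by (simp add: seminorm_topology_def openin_topology_generated_by_iff)
  then have "l \<in> U \<longrightarrow> (\<forall>\<^sub>F n in F. f n \<in> U)"
  proof (induction rule: generate_topology_on.induct)
    case (Int a b)
    then show ?case by (auto elim: eventually_elim2)
  next
    case (UN K)
    show ?case
    proof
      assume "l \<in> \<Union>K"
      then obtain k where "k \<in> K" "l \<in> k" by blast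
      with UN.IH have "\<forall>\<^sub>F n in F. f n \<in> k" by blast
      then show "\<forall>\<^sub>F n in F. f n \<in> \<Union>K" by (rule eventually_mono) (use \<open>k \<in> K\<close> in blast)
    qed
  next
    case (Basis s)
    then obtain x p e where s: "s = {y\<in>V. p (y - x) < e}" "x \<in> V" "p \<in> P" "e > 0" by blast
    show ?case
    proof
      assume "l \<in> s"
      then have "0 < e - p (l - x)" using s by simp
      then have "\<forall>\<^sub>F n in F. p (f n - l) < e - p (l - x)"
        using lim[OF s(3)] by (rule order_tendstoD(2)[rotated])
      then show "\<forall>\<^sub>F n in F. f n \<in> s"
      proof (rule eventually_mono)
        fix n assume "p (f n - l) < e - p (l - x)"
        moreover have "p ((f n - l) + (l - x)) \<le> p (f n - l) + p (l - x)"
          using sub[OF s(3)] V f s(2) by blast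
        ultimately show "f n \<in> s" using f(1) s(1) by simp
      qed
    qed
  qed simp
  then show "\<forall>\<^sub>F n in F. f n \<in> U" using U by blast
qed

text \<open>By linearity a bound by a single defining seminorm gives continuity at every point:
  balls of radius \<open>e / C\<close> are mapped into intervals of radius \<open>e\<close>.\<close>

lemma dualI:
  assumes P: "p \<in> P" "p 0 = 0"
    and V: "\<And>x y. x \<in> V \<Longrightarrow> y \<in> V \<Longrightarrow> x - y \<in> V"
    and add: "\<And>x y. x \<in> V \<Longrightarrow> y \<in> V \<Longrightarrow> \<phi> (x + y) = \<phi> x + \<phi> y"
    and scale: "\<And>c x. x \<in> V \<Longrightarrow> \<phi> (c *\<^sub>R x) = c * \<phi> x"
    and C: "C > 0" and bound: "\<And>x. x \<in> V \<Longrightarrow> \<bar>\<phi> x\<bar> \<le> C * p x"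
  shows "\<phi> \<in> dual (seminorm_topology V P)"
proof -
  note top = topspace_seminorm_topology[OF P, of V]
  have "continuous_map (seminorm_topology V P) euclideanreal \<phi>"
    unfolding continuous_map_def top
  proof (intro conjI allI impI)
    fix U :: "real set" assume "openin euclidean U"
    then have U: "open U" by simp
    show "openin (seminorm_topology V P) {x \<in> V. \<phi> x \<in> U}"
    proof (subst openin_subopen, intro ballI)
      fix x assume x: "x \<in> {x \<in> V. \<phi> x \<in> U}"
      then obtain e where e: "e > 0" "\<And>t. \<bar>t - \<phi> x\<bar> < e \<Longrightarrow> t \<in> U"
        using U unfolding open_dist dist_real_def by blast
      define d where "d = e / C"
      have d: "d > 0" using e C by (simp add: d_def)
      let ?B = "{y\<in>V. p (y - x) < d}"
      have "openin (seminorm_topology V P) ?B"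
        unfolding seminorm_topology_def using x P(1) d
        by (intro topology_generated_by_Basis) blast
      moreover have "x \<in> ?B" using x P(2) d by simp
      moreover have "?B \<subseteq> {x \<in> V. \<phi> x \<in> U}"
      proof
        fix y assume y: "y \<in> ?B"
        then have yx: "y - x \<in> V" using V x by blast
        have "\<phi> y = \<phi> (y - x) + \<phi> x" using add[OF yx, of x] x by simp
        moreover have "\<bar>\<phi> (y - x)\<bar> < e"
        proof -
          have "\<bar>\<phi> (y - x)\<bar> \<le> C * p (y - x)" by (rule bound[OF yx])
          also have "\<dots> < C * d" using y C by simp
          finally show ?thesis using C by (simp add: d_def)
        qed
        ultimately show "y \<in> {x \<in> V. \<phi> x \<in> U}" using e(2)[of "\<phi> y"] y by simp
      qed
      ultimately show "\<exists>T. openin (seminorm_topology V P) T \<and> x \<in> T \<and> T \<subseteq> {x \<in> V. \<phi> x \<in> U}"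
        by blast
    qed
  qed simp
  then show ?thesis unfolding dual_def top using add scale by simp
qed


section \<open>The Frechet space of smooth functions on the line\<close>

abbreviation smooth_seminorms :: "((real \<Rightarrow> real) \<Rightarrow> real) set" where
  "smooth_seminorms \<equiv> {sup_deriv j r |j r. True}"

lemma smooth_space_eq: "smooth_space = seminorm_topology Cinf_line smooth_seminorms"
  unfolding smooth_space_def sup_deriv_def by simp

lemma Cinf_line_diff: "f \<in> Cinf_line \<Longrightarrow> g \<in> Cinf_line \<Longrightarrow> f - g \<in> Cinf_line"
  using Cinf_line_lincomb(1)[of f g 1 "-1"] by (simp add: fun_diff_def)

lemma sup_deriv_0: "sup_deriv j r 0 = 0"
  using sup_deriv_zero by (simp add: zero_fun_def)

lemma topspace_smooth_space [simp]: "topspace smooth_space = Cinf_line"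
  unfolding smooth_space_eq
  by (rule topspace_seminorm_topology[of "sup_deriv 0 0"]) (auto simp: sup_deriv_0)

lemma dual_smooth_spaceI:
  assumes add: "\<And>f g. f \<in> Cinf_line \<Longrightarrow> g \<in> Cinf_line \<Longrightarrow> \<phi> (\<lambda>x. f x + g x) = \<phi> f + \<phi> g"
    and scale: "\<And>c f. f \<in> Cinf_line \<Longrightarrow> \<phi> (\<lambda>x. c * f x) = c * \<phi> f"
    and "C > 0" "\<And>f. f \<in> Cinf_line \<Longrightarrow> \<bar>\<phi> f\<bar> \<le> C * sup_deriv j r f"
  shows "\<phi> \<in> dual smooth_space"
  unfolding smooth_space_eq
  by (rule dualI[where p = "sup_deriv j r" and C = C])
     (use assms in \<open>auto simp: sup_deriv_0 Cinf_line_diff plus_fun_def scaleR_fun_def\<close>)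

lemma eval_dual_smooth_space: "(\<lambda>f. (deriv ^^ j) f t) \<in> dual smooth_space"
proof (rule dual_smooth_spaceI)
  have "t \<in> {- real (nat \<lceil>\<bar>t\<bar>\<rceil>)..real (nat \<lceil>\<bar>t\<bar>\<rceil>)}" by auto linarith+
  then show "\<bar>(deriv ^^ j) f t\<bar> \<le> 1 * sup_deriv j (nat \<lceil>\<bar>t\<bar>\<rceil>) f" if "f \<in> Cinf_line" for f
    using sup_deriv_upper[OF that] by simp
  show "(deriv ^^ j) (\<lambda>x. f x + g x) t = (deriv ^^ j) f t + (deriv ^^ j) g t"
    if "f \<in> Cinf_line" "g \<in> Cinf_line" for f g
    using Cinf_line_lincomb(2)[OF that, of j 1 1] by simp
  show "(deriv ^^ j) (\<lambda>x. c * f x) t = c * (deriv ^^ j) f t" if "f \<in> Cinf_line" for c f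
    using Cinf_line_lincomb(2)[OF that that, of j c 0] by simp
qed simp

text \<open>Convergence of sequences in \<open>smooth_space\<close>, phrased by uniform limits so
  that the theorem on uniformly convergent derivatives applies.\<close>

definition smooth_conv :: "(nat \<Rightarrow> real \<Rightarrow> real) \<Rightarrow> (real \<Rightarrow> real) \<Rightarrow> bool" where
  "smooth_conv F f \<longleftrightarrow> (\<forall>j r. uniform_limit {- real r..real r}
     (\<lambda>m. (deriv ^^ j) (F m)) ((deriv ^^ j) f) sequentially)"

lemma smooth_conv_sup_deriv:
  assumes "smooth_conv F f" and F: "\<And>m. F m \<in> Cinf_line" and f: "f \<in> Cinf_line"
  shows "(\<lambda>m. sup_deriv j r (F m - f)) \<longlonglongrightarrow> 0"
proof (rule tendstoI)
  fix e :: real assume "e > 0"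
  then have "\<forall>\<^sub>F m in sequentially. \<forall>x\<in>{- real r..real r}. dist ((deriv ^^ j) (F m) x) ((deriv ^^ j) f x) < e / 2"
    using assms(1) unfolding smooth_conv_def by (intro uniform_limitD) auto
  then show "\<forall>\<^sub>F m in sequentially. dist (sup_deriv j r (F m - f)) 0 < e"
  proof (rule eventually_mono)
    fix m assume *: "\<forall>x\<in>{- real r..real r}. dist ((deriv ^^ j) (F m) x) ((deriv ^^ j) f x) < e / 2"
    have eq: "(deriv ^^ j) (F m - f) x = (deriv ^^ j) (F m) x - (deriv ^^ j) f x" for x
      using Cinf_line_lincomb(2)[OF F[of m] f, of j 1 "-1"] by (simp add: fun_diff_def)
    have "sup_deriv j r (F m - f) \<le> e / 2"
      by (rule sup_deriv_least) (use * in \<open>auto simp: eq dist_real_def intro: less_imp_le\<close>)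
    moreover have "0 \<le> sup_deriv j r (F m - f)"
      using sup_deriv_upper[OF Cinf_line_diff[OF F f], of 0 r j m]
      by (rule order_trans[OF abs_ge_zero]) simp
    ultimately show "dist (sup_deriv j r (F m - f)) 0 < e" using \<open>e > 0\<close> by (simp add: dist_real_def)
  qed
qed

lemma limitin_smooth_space:
  assumes "\<And>m. F m \<in> Cinf_line" "f \<in> Cinf_line" "\<And>j r. (\<lambda>m. sup_deriv j r (F m - f)) \<longlonglongrightarrow> 0"
  shows "limitin smooth_space F f sequentially"
  unfolding smooth_space_eq
proof (rule limitin_seminorm_topology)
  show "sup_deriv 0 0 \<in> smooth_seminorms" by auto
  show "p (x + y) \<le> p x + p y" if "p \<in> smooth_seminorms" "x \<in> Cinf_line" "y \<in> Cinf_line" for p x y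
    using sup_deriv_add[OF that(2,3)] that(1) by (auto simp: plus_fun_def)
qed (use assms sup_deriv_0 Cinf_line_diff in auto)

section \<open>Test functions and their functionals\<close>

lemma test_funs_iff: "f \<in> test_funs \<longleftrightarrow> f \<in> Cinf_line \<and> (\<exists>N. \<forall>x. \<bar>x\<bar> > N \<longrightarrow> f x = 0)"
proof
  assume f: "f \<in> test_funs"
  then have "bounded {x. f x \<noteq> 0}"
    unfolding test_funs_def using bounded_subset[OF compact_imp_bounded closure_subset] by blast
  then obtain N where "\<forall>x\<in>{x. f x \<noteq> 0}. \<bar>x\<bar> \<le> N" by (auto simp: bounded_iff)
  then show "f \<in> Cinf_line \<and> (\<exists>N. \<forall>x. \<bar>x\<bar> > N \<longrightarrow> f x = 0)"
    using f unfolding test_funs_def by (intro conjI exI[of _ N]) (auto simp: not_le[symmetric])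
next
  assume f: "f \<in> Cinf_line \<and> (\<exists>N. \<forall>x. \<bar>x\<bar> > N \<longrightarrow> f x = 0)"
  then obtain N where "\<forall>x. \<bar>x\<bar> > N \<longrightarrow> f x = 0" by blast
  then have "{x. f x \<noteq> 0} \<subseteq> {-N..N}" by (auto simp: not_less[symmetric] abs_less_iff)
  then have "bounded {x. f x \<noteq> 0}" using bounded_subset bounded_closed_interval by blast
  then show "f \<in> test_funs" using f by (simp add: test_funs_def compact_closure)
qed

lemma test_funs_lincomb:
  assumes "f \<in> test_funs" "g \<in> test_funs"
  shows "(\<lambda>x. a * f x + b * g x) \<in> test_funs"
proof -
  obtain N M where "\<forall>x. \<bar>x\<bar> > N \<longrightarrow> f x = 0" "\<forall>x. \<bar>x\<bar> > M \<longrightarrow> g x = 0"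
    using assms unfolding test_funs_iff by blast
  then have "\<forall>x. \<bar>x\<bar> > max N M \<longrightarrow> a * f x + b * g x = 0" by simp
  then show ?thesis using assms Cinf_line_lincomb(1) unfolding test_funs_iff by blast
qed

lemma test_funs_in_subset: "compact K \<Longrightarrow> test_funs_in K \<subseteq> test_funs"
proof
  fix f assume K: "compact K" and f: "f \<in> test_funs_in K"
  obtain N where "\<forall>x\<in>K. \<bar>x\<bar> \<le> N" using compact_imp_bounded[OF K] by (auto simp: bounded_iff)
  then have "\<forall>x. \<bar>x\<bar> > N \<longrightarrow> f x = 0" using f unfolding test_funs_in_def by force
  then show "f \<in> test_funs" using f unfolding test_funs_iff test_funs_in_def by blast
qed

lemma test_funs_in_lincomb:
  assumes "f \<in> test_funs_in K" "g \<in> test_funs_in K"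
  shows "(\<lambda>x. a * f x + b * g x) \<in> test_funs_in K"
  using assms Cinf_line_lincomb(1)[of f g a b] unfolding test_funs_in_def by simp

abbreviation test_seminorms :: "((real \<Rightarrow> real) \<Rightarrow> real) set" where
  "test_seminorms \<equiv> {p. seminorm_on test_funs p \<and>
     (\<forall>K. compact K \<longrightarrow> continuous_map (subtopology smooth_space (test_funs_in K)) euclideanreal p)}"

lemma zero_seminorm: "(\<lambda>_. 0) \<in> test_seminorms"
  by (simp add: seminorm_on_def)

lemma topspace_test_space [simp]: "topspace test_space = test_funs"
  unfolding test_space_def by (rule topspace_seminorm_topology[OF zero_seminorm]) simp

lemma test_funs_diff: "f \<in> test_funs \<Longrightarrow> g \<in> test_funs \<Longrightarrow> f - g \<in> test_funs"
  using test_funs_lincomb[of f g 1 "-1"] by (simp add: fun_diff_def)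

text \<open>The topology is defined by all seminorms with continuous restrictions, so the absolute
  value of \<phi> is itself a defining seminorm and bounds \<phi> with constant
  \<open>1\<close>.\<close>

lemma dual_test_spaceI:
  assumes add: "\<And>f g. f \<in> test_funs \<Longrightarrow> g \<in> test_funs \<Longrightarrow> \<phi> (\<lambda>x. f x + g x) = \<phi> f + \<phi> g"
    and scale: "\<And>c f. f \<in> test_funs \<Longrightarrow> \<phi> (\<lambda>x. c * f x) = c * \<phi> f"
    and cont: "\<And>K. compact K \<Longrightarrow> continuous_map (subtopology smooth_space (test_funs_in K)) euclideanreal \<phi>"
  shows "\<phi> \<in> dual test_space"
  unfolding test_space_def
proof (rule dualI[where p = "\<lambda>f. \<bar>\<phi> f\<bar>" and C = 1])
  show "(\<lambda>f. \<bar>\<phi> f\<bar>) \<in> test_seminorms"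
    using cont by (auto simp: seminorm_on_def plus_fun_def scaleR_fun_def add scale abs_mult abs_triangle_ineq
      intro: continuous_map_real_abs)
  have "(\<lambda>_. 0) \<in> test_funs" by (auto simp: test_funs_iff Cinf_lineI(1)[of "\<lambda>_ _. 0"])
  from scale[OF this, of 0] show "\<bar>\<phi> 0\<bar> = 0" by (simp add: zero_fun_def)
qed (use add scale in \<open>auto simp: plus_fun_def scaleR_fun_def test_funs_diff\<close>)

lemma dualD:
  assumes "\<phi> \<in> dual X"
  shows dual_add: "f \<in> topspace X \<Longrightarrow> g \<in> topspace X \<Longrightarrow> \<phi> (f + g) = \<phi> f + \<phi> g"
    and dual_scale: "f \<in> topspace X \<Longrightarrow> \<phi> (c *\<^sub>R f) = c * \<phi> f"
    and dual_continuous: "continuous_map X euclideanreal \<phi>"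
  using assms unfolding dual_def by auto

lemma dual_smooth_test: "\<phi> \<in> dual smooth_space \<Longrightarrow> \<phi> \<in> dual test_space"
proof (rule dual_test_spaceI)
  assume \<phi>: "\<phi> \<in> dual smooth_space"
  show "continuous_map (subtopology smooth_space (test_funs_in K)) euclideanreal \<phi>" for K
    using dual_continuous[OF \<phi>] by (rule continuous_map_from_subtopology)
qed (use dual_add[of \<phi> smooth_space] dual_scale[of \<phi> smooth_space] in
    \<open>auto simp: plus_fun_def scaleR_fun_def test_funs_iff\<close>)

text \<open>The properties used for differentiating under a functional: linearity, and continuity
  along sequences that converge with all derivatives. Every functional of \<open>test_space\<close>
  has them on the functions supported in one compact set.\<close>

definition seq_functional :: "(real \<Rightarrow> real) set \<Rightarrow> ((real \<Rightarrow> real) \<Rightarrow> real) \<Rightarrow> bool" where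
  "seq_functional V \<phi> \<longleftrightarrow> V \<subseteq> Cinf_line \<and>
     (\<forall>f\<in>V. \<forall>g\<in>V. \<forall>a b. (\<lambda>x. a * f x + b * g x) \<in> V \<and> \<phi> (\<lambda>x. a * f x + b * g x) = a * \<phi> f + b * \<phi> g) \<and>
     (\<forall>F f. (\<forall>m. F m \<in> V) \<and> f \<in> V \<and> smooth_conv F f \<longrightarrow> (\<lambda>m. \<phi> (F m)) \<longlonglongrightarrow> \<phi> f)"

lemma dual_lincomb:
  assumes \<phi>: "\<phi> \<in> dual X" and f: "f \<in> topspace X" "g \<in> topspace X"
    and scale: "\<And>c f. f \<in> topspace X \<Longrightarrow> (\<lambda>x::real. c * f x) \<in> topspace X"
  shows "\<phi> (\<lambda>x. a * f x + b * g x) = a * \<phi> f + b * \<phi> g"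
proof -
  have "(\<lambda>x. a * f x + b * g x) = a *\<^sub>R f + b *\<^sub>R g"
    by (simp add: plus_fun_def scaleR_fun_def)
  moreover have "a *\<^sub>R f \<in> topspace X" "b *\<^sub>R g \<in> topspace X"
    using scale f by (simp_all add: scaleR_fun_def)
  ultimately show ?thesis using dual_add[OF \<phi>] dual_scale[OF \<phi>] f by simp
qed

text \<open>On \<open>test_funs_in K\<close> each defining seminorm of \<open>test_space\<close> is
  continuous for the topology of \<open>smooth_space\<close>, so there convergence with all
  derivatives implies convergence in \<open>test_space\<close>.\<close>

lemma seq_functional_test:
  assumes \<phi>: "\<phi> \<in> dual test_space" and K: "compact K"
  shows "seq_functional (test_funs_in K) \<phi>"
  unfolding seq_functional_def
proof (intro conjI ballI allI impI)
  fix f g a b assume "f \<in> test_funs_in K" "g \<in> test_funs_in K"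
  then show "\<phi> (\<lambda>x. a * f x + b * g x) = a * \<phi> f + b * \<phi> g"
    using test_funs_lincomb[of _ _ _ 0] test_funs_in_subset[OF K] by (intro dual_lincomb[OF \<phi>]) auto
next
  fix F f assume *: "(\<forall>m. F m \<in> test_funs_in K) \<and> f \<in> test_funs_in K \<and> smooth_conv F f"
  then have F: "F m \<in> test_funs_in K" "F m \<in> test_funs" "F m \<in> Cinf_line" for m
    using test_funs_in_subset[OF K] by (auto simp: test_funs_in_def)
  have f: "f \<in> test_funs_in K" "f \<in> test_funs" "f \<in> Cinf_line"
    using * test_funs_in_subset[OF K] by (auto simp: test_funs_in_def)
  have "limitin test_space F f sequentially"
    unfolding test_space_def
  proof (rule limitin_seminorm_topology[OF zero_seminorm])
    fix p assume p: "p \<in> test_seminorms"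
    have "limitin smooth_space (\<lambda>m. F m - f) 0 sequentially"
    proof (rule limitin_smooth_space)
      show "F m - f \<in> Cinf_line" for m using F f Cinf_line_diff by blast
      show "0 \<in> Cinf_line" using Cinf_line_diff[OF f(3) f(3)] by simp
      show "(\<lambda>m. sup_deriv j r (F m - f - 0)) \<longlonglongrightarrow> 0" for j r
        using smooth_conv_sup_deriv[of F f] * F f by simp
    qed
    moreover have "F m - f \<in> test_funs_in K" for m
      using test_funs_in_lincomb[OF F(1) f(1), of 1 m "-1"] by (simp add: fun_diff_def)
    moreover have "0 \<in> test_funs_in K"
      using test_funs_in_lincomb[OF f(1) f(1), of 0 0] by (simp add: zero_fun_def)
    ultimately have "limitin (subtopology smooth_space (test_funs_in K)) (\<lambda>m. F m - f) 0 sequentially"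
      by (simp add: limitin_subtopology)
    moreover have "continuous_map (subtopology smooth_space (test_funs_in K)) euclideanreal p"
      using p K by blast
    ultimately have "limitin euclideanreal (p \<circ> (\<lambda>m. F m - f)) (p 0) sequentially"
      by (rule continuous_map_limit[rotated])
    moreover have "p 0 = 0"
    proof -
      have "\<forall>c. \<forall>x\<in>test_funs. p (c *\<^sub>R x) = \<bar>c\<bar> * p x" using p by (simp add: seminorm_on_def)
      from this[rule_format, OF f(2), of 0] show ?thesis by simp
    qed
    ultimately show "(\<lambda>m. p (F m - f)) \<longlonglongrightarrow> 0" by (simp add: o_def)
  qed (use F f test_funs_diff in \<open>auto simp: seminorm_on_def\<close>)
  from continuous_map_limit[OF dual_continuous[OF \<phi>] this]
  show "(\<lambda>m. \<phi> (F m)) \<longlonglongrightarrow> \<phi> f" by (simp add: o_def)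
qed (auto simp: test_funs_in_lincomb, simp add: test_funs_in_def)

section \<open>Families of functions on the line given by a smooth function of one more
  variable\<close>

definition slice :: "nat \<Rightarrow> (pt \<Rightarrow> real) \<Rightarrow> pt \<Rightarrow> real \<Rightarrow> real" where
  "slice n K s = (\<lambda>y. K (s(n := y)))"

lemma slice_Cinf_line:
  assumes "K \<in> Cinf (Suc n)"
  shows "slice n K s \<in> Cinf_line"
    and "(deriv ^^ j) (slice n K s) = slice n (pds (replicate j n) K) s"
proof -
  have *: "(slice n (pds (replicate j n) K) s has_real_derivative slice n (pds (replicate (Suc j) n) K) s y) (at y)"
    for j y
  proof -
    have H: "pds (replicate j n) K \<in> Cinf (Suc n)" using assms by (intro Cinf_pds) auto
    have "pds (replicate (Suc j) n) K = pd n (pds (replicate j n) K)"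
      by (simp only: replicate_Suc replicate_append_same[symmetric] pds_append pds_Cons pds_Nil)
    then show ?thesis using Cinf_has_pd[OF H, of n "s(n := y)"] by (simp add: slice_def)
  qed
  show "slice n K s \<in> Cinf_line" "(deriv ^^ j) (slice n K s) = slice n (pds (replicate j n) K) s"
    using Cinf_lineI[of "\<lambda>j. slice n (pds (replicate j n) K) s", OF *] by auto
qed

text \<open>This replaces the symmetry of second partial derivatives: that derivatives in the
  parameters commute with those on the line follows from uniform convergence of difference quotients.\<close>

lemma smooth_limit:
  assumes F: "\<And>m. F m \<in> Cinf_line"
    and lim: "\<And>j r. uniform_limit {- real r..real r} (\<lambda>m. (deriv ^^ j) (F m)) (g j) sequentially"
  shows "g 0 \<in> Cinf_line" "(deriv ^^ j) (g 0) = g j" "smooth_conv F (g 0)"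
proof -
  have *: "(g j has_real_derivative g (Suc j) x) (at x)" for j x
  proof -
    obtain r where r: "\<bar>x\<bar> < real r" using reals_Archimedean2 by blast
    let ?S = "{- real r<..<real r}"
    have x: "x \<in> ?S" using r by auto
    have "\<exists>h. \<forall>x\<in>?S. (\<lambda>m. (deriv ^^ j) (F m) x) \<longlonglongrightarrow> h x \<and>
      (h has_derivative (\<lambda>t. g (Suc j) x * t)) (at x within ?S)"
    proof (rule has_derivative_sequence[OF _ _ _ x])
      show "((deriv ^^ j) (F m) has_derivative (\<lambda>t. (deriv ^^ Suc j) (F m) x * t)) (at x within ?S)" for m x
        using Cinf_line_deriv[OF F, of j m x] has_field_derivative_at_within
        unfolding has_field_derivative_def by blast
      show "(\<lambda>m. (deriv ^^ j) (F m) x) \<longlonglongrightarrow> g j x"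
        using tendsto_uniform_limitI[OF lim[of j r]] x by auto
      show "\<forall>\<^sub>F m in sequentially. \<forall>x\<in>?S. \<forall>h. norm ((deriv ^^ Suc j) (F m) x * h - g (Suc j) x * h) \<le> e * norm h"
        if "e > 0" for e
        using uniform_limitD[OF lim[of "Suc j" r] that]
      proof (rule eventually_mono, intro ballI allI)
        fix m x h assume *: "\<forall>x\<in>{- real r..real r}. dist ((deriv ^^ Suc j) (F m) x) (g (Suc j) x) < e"
          and "x \<in> ?S"
        then have "x \<in> {- real r..real r}" by auto
        then have "\<bar>(deriv ^^ Suc j) (F m) x - g (Suc j) x\<bar> \<le> e"
          using * unfolding dist_real_def by (blast intro: less_imp_le)
        then show "norm ((deriv ^^ Suc j) (F m) x * h - g (Suc j) x * h) \<le> e * norm h"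
          by (simp only: left_diff_distrib[symmetric] real_norm_def abs_mult) (rule mult_right_mono, auto)
      qed
    qed auto
    then obtain h where h: "\<And>x. x \<in> ?S \<Longrightarrow> (\<lambda>m. (deriv ^^ j) (F m) x) \<longlonglongrightarrow> h x"
      "(h has_derivative (\<lambda>t. g (Suc j) x * t)) (at x within ?S)" using x by blast
    have hg: "g j y = h y" if "y \<in> ?S" for y
      using tendsto_uniform_limitI[OF lim[of j r], of y] h(1)[OF that] that LIMSEQ_unique by fastforce
    then have "(g j has_derivative (\<lambda>t. g (Suc j) x * t)) (at x within ?S)"
      by (intro has_derivative_transform[OF x _ h(2)])
    then show ?thesis
      using x by (simp add: has_field_derivative_def at_within_open[OF x])
  qed
  show "g 0 \<in> Cinf_line" "(deriv ^^ j) (g 0) = g j" using Cinf_lineI[of g, OF *] by auto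
  show "smooth_conv F (g 0)" unfolding smooth_conv_def using lim Cinf_lineI(2)[of g, OF *] by auto
qed

text \<open>By compactness of the interval and joint continuity of \<open>H\<close>, one
  neighbourhood of \<open>s\<close> serves for all points of the interval.\<close>

lemma slice_uniform_limit:
  assumes H: "continuous_on UNIV H" and s: "u \<longlonglongrightarrow> s"
  shows "uniform_limit {- real r..real r} (\<lambda>m. slice n H (u m)) (slice n H s) sequentially"
proof (rule uniform_limitI)
  fix e :: real assume e: "e > 0"
  have cont: "continuous_on (UNIV \<times> {- real r..real r}) (\<lambda>(s, y). H (s(n := y)))"
    unfolding case_prod_beta
    by (rule continuous_on_compose2[OF H],
        intro continuous_on_upd continuous_on_fst continuous_on_snd continuous_on_id, simp)
  obtain X where X: "s \<in> X" "open X"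
    "\<forall>x\<in>X \<inter> UNIV. \<forall>y\<in>{- real r..real r}. dist ((\<lambda>(s, y). H (s(n := y))) (x, y)) ((\<lambda>(s, y). H (s(n := y))) (s, y)) \<le> e / 2"
    by (rule continuous_on_prod_compactE[OF cont, of s "e / 2"]) (use e in auto)
  have "\<forall>\<^sub>F m in sequentially. u m \<in> X" using topological_tendstoD[OF s X(2,1)] .
  then show "\<forall>\<^sub>F m in sequentially. \<forall>y\<in>{- real r..real r}. dist (slice n H (u m) y) (slice n H s y) < e"
  proof (rule eventually_mono, intro ballI)
    fix m y assume "u m \<in> X" "y \<in> {- real r..real r}"
    then have "dist (slice n H (u m) y) (slice n H s y) \<le> e / 2" using X(3) by (auto simp: slice_def)
    then show "dist (slice n H (u m) y) (slice n H s y) < e" using e by linarith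
  qed
qed

lemma slice_smooth_conv:
  assumes K: "K \<in> Cinf (Suc n)" and "u \<longlonglongrightarrow> s"
  shows "smooth_conv (\<lambda>m. slice n K (u m)) (slice n K s)"
  unfolding smooth_conv_def slice_Cinf_line(2)[OF K]
  by (intro allI slice_uniform_limit Cinf_continuous[of _ "Suc n"] Cinf_pds K assms(2)) auto

text \<open>By the mean value theorem each line derivative of the difference quotient is a value of
  a parameter derivative at an intermediate point, and compactness makes it uniformly close to the
  value at \<open>s\<close>.\<close>

lemma slice_diff_quotient:
  assumes K: "K \<in> Cinf (Suc n)" and i: "i < n" and h: "h \<longlonglongrightarrow> 0" "\<And>m. h m \<noteq> 0"
  shows "smooth_conv (\<lambda>m y. 1 / h m * slice n K (s(i := s i + h m)) y + (- 1 / h m) * slice n K s y)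
    (slice n (pd i K) s)"
proof -
  let ?F = "\<lambda>m y. 1 / h m * slice n K (s(i := s i + h m)) y + (- 1 / h m) * slice n K s y"
  \<comment> \<open>Here the line derivatives are taken first and \<open>pd i\<close> last, as they
    occur in the limit; \<open>smooth_limit\<close> needs no exchange of the two, only convergence
    to the \<open>g j\<close>.\<close>
  define g where "g j = slice n (pd i (pds (replicate j n) K)) s" for j
  have F: "?F m \<in> Cinf_line" for m by (intro Cinf_line_lincomb slice_Cinf_line K)
  have "uniform_limit {- real r..real r} (\<lambda>m. (deriv ^^ j) (?F m)) (g j) sequentially" for j r
  proof (rule uniform_limitI)
    fix e :: real assume e: "e > 0"
    let ?H = "pds (replicate j n) K"
    have H: "?H \<in> Cinf (Suc n)" using K by (intro Cinf_pds) auto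
    have dF: "(deriv ^^ j) (?F m) y = (?H (s(i := s i + h m, n := y)) - ?H (s(n := y))) / h m" for m y
      unfolding Cinf_line_lincomb(2)[OF slice_Cinf_line(1)[OF K] slice_Cinf_line(1)[OF K]] slice_Cinf_line(2)[OF K]
      by (simp add: slice_def diff_divide_distrib)
    have i': "i < Suc n" using i by simp
    have cont: "continuous_on (UNIV \<times> {- real r..real r}) (\<lambda>(v, y). pd i ?H (s(i := v, n := y)))"
      unfolding case_prod_beta
      by (rule continuous_on_compose2[OF Cinf_continuous[OF Cinf_pd[OF H i']]],
          intro continuous_on_upd continuous_on_const continuous_on_fst continuous_on_snd
            continuous_on_id, simp)
    obtain X where X: "s i \<in> X" "open X"
      "\<forall>x\<in>X \<inter> UNIV. \<forall>y\<in>{- real r..real r}. dist ((\<lambda>(v, y). pd i ?H (s(i := v, n := y))) (x, y))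
         ((\<lambda>(v, y). pd i ?H (s(i := v, n := y))) (s i, y)) \<le> e / 2"
      by (rule continuous_on_prod_compactE[OF cont, of "s i" "e / 2"]) (use e in auto)
    obtain d where d: "d > 0" "\<And>v. \<bar>v - s i\<bar> < d \<Longrightarrow> v \<in> X"
      using X(1,2) unfolding open_dist dist_real_def by blast
    have "\<forall>\<^sub>F m in sequentially. dist (h m) 0 < d" using tendstoD[OF h(1) d(1)] .
    then show "\<forall>\<^sub>F m in sequentially. \<forall>y\<in>{- real r..real r}. dist ((deriv ^^ j) (?F m) y) (g j y) < e"
    proof (rule eventually_mono, intro ballI)
      fix m y assume hm: "dist (h m) 0 < d" and y: "y \<in> {- real r..real r}"
      obtain z where z: "\<bar>z - s i\<bar> \<le> \<bar>h m\<bar>"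
        "(?H (s(i := s i + h m, n := y)) - ?H (s(n := y))) / h m = pd i ?H (s(i := z, n := y))"
        using pd_mvt[OF H i' h(2), of "s(n := y)" m] i by (auto simp: fun_upd_twist)
      then have zd: "\<bar>z - s i\<bar> < d" using hm by simp
      have zF: "(deriv ^^ j) (?F m) y = pd i ?H (s(i := z, n := y))" unfolding dF z(2) ..
      have "dist (pd i ?H (s(i := z, n := y))) (pd i ?H (s(i := s i, n := y))) \<le> e / 2"
        using X(3) d(2)[OF zd] y by auto
      then show "dist ((deriv ^^ j) (?F m) y) (g j y) < e"
        using e by (subst zF) (simp add: g_def slice_def)
    qed
  qed
  from smooth_limit(3)[of ?F g, OF F this] show ?thesis by (simp add: g_def)
qed

text \<open>The functional commutes with the limits of difference quotients, so its values on the
  members of \<open>S\<close> form a family closed under partial derivatives.\<close>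

lemma functional_of_family:
  assumes \<phi>: "seq_functional V \<phi>" and S: "S \<subseteq> Cinf (Suc n)"
    and SV: "\<And>K s. K \<in> S \<Longrightarrow> slice n K s \<in> V" and pd: "\<And>K i. K \<in> S \<Longrightarrow> i < n \<Longrightarrow> pd i K \<in> S"
    and K: "K \<in> S"
  shows "(\<lambda>s. \<phi> (slice n K s)) \<in> Cinf n"
  unfolding Cinf_def mem_Collect_eq
proof (rule smooth_coinduct[OF open_UNIV])
  define S' where "S' = {(\<lambda>s. \<phi> (slice n K s)) |K. K \<in> S}"
  show "(\<lambda>s. \<phi> (slice n K s)) \<in> S'" using K S'_def by blast
  show "\<phi> (slice n K x) = \<phi> (slice n K y)" if "\<And>i. i < n \<Longrightarrow> x i = y i" for x y
  proof -
    have "slice n K x = slice n K y" unfolding slice_def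
      by (rule ext, rule depD[OF Cinf_dep[of K "Suc n"]]) (use K S that less_Suc_eq in auto)
    then show ?thesis by simp
  qed
  have lim: "(\<lambda>m. \<phi> (F m)) \<longlonglongrightarrow> \<phi> f" if "\<And>m. F m \<in> V" "f \<in> V" "smooth_conv F f" for F f
    using \<phi> that unfolding seq_functional_def by blast
  have lin: "(\<lambda>x. a * f x + b * g x) \<in> V" "\<phi> (\<lambda>x. a * f x + b * g x) = a * \<phi> f + b * \<phi> g"
    if "f \<in> V" "g \<in> V" for a b f g
    using \<phi> that unfolding seq_functional_def by blast+
  fix f assume "f \<in> S'"
  then obtain K where K: "K \<in> S" "K \<in> Cinf (Suc n)" and f: "f = (\<lambda>s. \<phi> (slice n K s))"
    using S unfolding S'_def by blast
  show "continuous_on UNIV f" unfolding f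
    by (rule continuous_on_sequentiallyI) (intro lim SV K slice_smooth_conv)
  fix i assume i: "i < n"
  show "\<exists>f'\<in>S'. \<forall>x\<in>UNIV. ((\<lambda>t. f (x(i := t))) has_real_derivative f' x) (at (x i))"
  proof (intro bexI ballI)
    show "(\<lambda>s. \<phi> (slice n (pd i K) s)) \<in> S'" using pd[OF K(1) i] S'_def by blast
    fix s :: pt
    show "((\<lambda>t. f (s(i := t))) has_real_derivative \<phi> (slice n (pd i K) s)) (at (s i))"
      unfolding DERIV_def LIM_def[symmetric] tendsto_at_iff_sequentially o_def
    proof (intro allI impI)
      fix h :: "nat \<Rightarrow> real" assume h: "\<forall>m. h m \<in> UNIV - {0}" "h \<longlonglongrightarrow> 0"
      have "(\<lambda>m. \<phi> (\<lambda>y. 1 / h m * slice n K (s(i := s i + h m)) y + (- 1 / h m) * slice n K s y))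
          \<longlonglongrightarrow> \<phi> (slice n (pd i K) s)"
        using h by (intro lim slice_diff_quotient lin(1) SV K pd i) auto
      then show "(\<lambda>m. (f (s(i := s i + h m)) - f (s(i := s i))) / h m) \<longlonglongrightarrow> \<phi> (slice n (pd i K) s)"
        unfolding lin(2)[OF SV[OF K(1)] SV[OF K(1)]] by (simp add: f diff_divide_distrib)
    qed
  qed
qed

text \<open>The functions vanishing for line variable beyond \<open>N\<close> are closed under
  parameter derivatives, and all their slices lie in one \<open>test_funs_in {-N..N}\<close>, where
  \<phi> is sequentially continuous.\<close>

lemma dual_test_family:
  assumes \<phi>: "\<phi> \<in> dual test_space" and K: "K \<in> Cinf (Suc n)"
    and N: "\<And>s. \<bar>s n\<bar> > N \<Longrightarrow> K s = 0"
  shows "(\<lambda>s. \<phi> (slice n K s)) \<in> Cinf n"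
proof (rule functional_of_family[OF seq_functional_test[OF \<phi> compact_Icc[of "-N" N]]])
  let ?S = "{K \<in> Cinf (Suc n). \<forall>s. \<bar>s n\<bar> > N \<longrightarrow> K s = 0}"
  show "K \<in> ?S" using K N by blast
  show "?S \<subseteq> Cinf (Suc n)" by blast
  show "slice n K s \<in> test_funs_in {-N..N}" if "K \<in> ?S" for K s
    using that slice_Cinf_line(1)[of K n s] unfolding test_funs_in_def slice_def by auto
  show "pd i K \<in> ?S" if "K \<in> ?S" "i < n" for K i
  proof -
    have "pd i K s = 0" if "\<bar>s n\<bar> > N" for s
    proof -
      have "K (s(i := t)) = 0" for t using \<open>K \<in> ?S\<close> \<open>i < n\<close> that by auto
      then show ?thesis by (simp add: pd_def)
    qed
    then show ?thesis using that by (auto intro: Cinf_pd)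
  qed
qed

section \<open>Smooth families with values in the spaces of smooth functions and test functions\<close>

text \<open>With these coefficients a statement about series specializes to a single term.\<close>

lemma unit_sequence:
  shows "summable (\<lambda>m. \<bar>if m = (0::nat) then 1 else 0 :: real\<bar>)"
    and "(\<Sum>m. (if m = (0::nat) then 1 else 0) * x) = (x :: real)"
proof -
  show "summable (\<lambda>m. \<bar>if m = (0::nat) then 1 else 0 :: real\<bar>)"
    by (rule summable_finite[of "{0}"]) auto
  show "(\<Sum>m. (if m = (0::nat) then 1 else 0) * x) = x"
    using suminf_finite[of "{0::nat}" "\<lambda>m. (if m = 0 then 1 else 0) * x"] by simp
qed

text \<open>A gliding hump: the terms \<open>m < n\<close> of the series at the \<open>n\<close>-th point are absorbed by the
  pointwise bounds, the terms \<open>m > n\<close> by the choice of the coefficients.\<close>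

lemma l1_uniform_boundedness:
  fixes a :: "'x \<Rightarrow> 't \<Rightarrow> real"
  assumes bdd: "\<And>x. x \<in> X \<Longrightarrow> \<exists>M. \<forall>t\<in>T. \<bar>a x t\<bar> \<le> M"
    and weak: "\<And>c t. summable (\<lambda>m. \<bar>c m\<bar>) \<Longrightarrow> (\<And>m. t m \<in> T) \<Longrightarrow>
      \<exists>M. \<forall>x\<in>X. \<bar>\<Sum>m. c m * a x (t m)\<bar> \<le> M"
  shows "\<exists>M. \<forall>x\<in>X. \<forall>t\<in>T. \<bar>a x t\<bar> \<le> M"
proof (rule ccontr)
  assume "\<nexists>M. \<forall>x\<in>X. \<forall>t\<in>T. \<bar>a x t\<bar> \<le> M"
  then have unb: "\<exists>x\<in>X. \<exists>t\<in>T. \<bar>a x t\<bar> > M" for M by (meson not_le)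
  have "\<exists>M\<ge>0. \<forall>t\<in>T. \<bar>a x t\<bar> \<le> M" if "x \<in> X" for x
    using bdd[OF that] by (metis abs_ge_zero abs_ge_self order_trans)
  then obtain B where B: "\<And>x. x \<in> X \<Longrightarrow> 0 \<le> B x" "\<And>x t. x \<in> X \<Longrightarrow> t \<in> T \<Longrightarrow> \<bar>a x t\<bar> \<le> B x" by metis
  have "\<exists>M. \<forall>x\<in>X. \<bar>a x t\<bar> \<le> M" if tT: "t \<in> T" for t
  proof -
    obtain M where "\<forall>x\<in>X. \<bar>\<Sum>m. (if m = (0::nat) then 1 else 0) * a x t\<bar> \<le> M"
      using weak[OF unit_sequence(1), of "\<lambda>_. t"] tT by blast
    then show ?thesis by (auto simp: unit_sequence(2))
  qed
  then obtain Q where Q: "\<And>x t. t \<in> T \<Longrightarrow> x \<in> X \<Longrightarrow> \<bar>a x t\<bar> \<le> Q t" by metis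
  \<comment> \<open>The denominator contains the bounds \<open>B\<close> at the earlier points, so
    that the terms after the \<open>n\<close>-th contribute at most \<open>2\<close> at the
    \<open>n\<close>-th point.\<close>
  define C where "C f n = (1/2) ^ n / (1 + (\<Sum>m<n. B (fst (f m))))" for f :: "nat \<Rightarrow> 'x \<times> 't" and n :: nat
  \<comment> \<open>The summand \<open>2\<close> pays for that tail and the sum for the earlier
    terms; \<open>n\<close> remains as a lower bound for the whole series.\<close>
  define P where "P f n r \<longleftrightarrow> fst r \<in> X \<and> snd r \<in> T \<and>
    C f n * \<bar>a (fst r) (snd r)\<bar> > real n + 2 + (\<Sum>m<n. \<bar>C f m\<bar> * Q (snd (f m)))" for f n r
  have "\<exists>f. \<forall>n. P f n (f n)"
  proof (rule dependent_wellorder_choice)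
    fix r :: "'x \<times> 't" and f g :: "nat \<Rightarrow> 'x \<times> 't" and n :: nat
    assume fg: "\<And>m. m < n \<Longrightarrow> f m = g m"
    then have "C f m = C g m" if "m \<le> n" for m
      unfolding C_def using that by (intro arg_cong2[of _ _ _ _ "(/)"] arg_cong2[of _ _ _ _ "(+)"] sum.cong) auto
    moreover have "(\<Sum>m<n. \<bar>C f m\<bar> * Q (snd (f m))) = (\<Sum>m<n. \<bar>C g m\<bar> * Q (snd (g m)))"
      using fg calculation by (intro sum.cong) auto
    ultimately show "P f n r = P g n r" unfolding P_def by simp
  next
    fix n :: nat and f :: "nat \<Rightarrow> 'x \<times> 't"
    assume "\<And>m. m < n \<Longrightarrow> P f m (f m)"
    then have "0 \<le> (\<Sum>m<n. B (fst (f m)))" by (intro sum_nonneg B) (auto simp: P_def)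
    then have C: "C f n > 0" by (simp add: C_def)
    let ?R = "real n + 2 + (\<Sum>m<n. \<bar>C f m\<bar> * Q (snd (f m)))"
    obtain x t where "x \<in> X" "t \<in> T" "\<bar>a x t\<bar> > ?R / C f n" using unb by blast
    then have "P f n (x, t)" unfolding P_def using C by (simp add: divide_less_eq mult.commute)
    then show "\<exists>r. P f n r" ..
  qed
  then obtain f where f: "\<And>n. P f n (f n)" by blast
  define x where "x n = fst (f n)" for n
  define t where "t n = snd (f n)" for n
  define c where "c n = C f n" for n
  have x: "x n \<in> X" and t: "t n \<in> T"
    and big: "c n * \<bar>a (x n) (t n)\<bar> > real n + 2 + (\<Sum>m<n. \<bar>c m\<bar> * Q (t m))" for n
    using f[of n] by (simp_all add: P_def x_def t_def c_def)
  have c: "c n = (1/2) ^ n / (1 + (\<Sum>m<n. B (x m)))" for n by (simp add: c_def C_def x_def)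
  have Bs: "0 \<le> (\<Sum>m<n. B (x m))" for n by (intro sum_nonneg B x)
  have c0: "0 < c n" for n using Bs[of n] by (simp add: c)
  have c1: "c n \<le> (1/2) ^ n" for n using Bs[of n] by (simp add: c divide_le_eq mult_le_cancel_left1)
  have cB: "c m * B (x n) \<le> (1/2) ^ m" if "n < m" for n m
  proof -
    have "B (x n) \<le> (\<Sum>m<m. B (x m))" using that by (intro member_le_sum) (auto intro: B x)
    then have "c m * B (x n) \<le> c m * (1 + (\<Sum>m<m. B (x m)))" using c0[of m] by (intro mult_left_mono) auto
    also have "\<dots> = (1/2) ^ m" using Bs[of m] by (simp add: c)
    finally show ?thesis .
  qed
  have geo: "summable (\<lambda>n. (1/2::real) ^ n)" by (simp add: summable_geometric)
  have sc: "summable (\<lambda>n. \<bar>c n\<bar>)"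
    by (rule summable_comparison_test'[OF geo, of 0]) (use c0 c1 in \<open>auto simp: less_imp_le\<close>)
  obtain M where M: "\<And>y. y \<in> X \<Longrightarrow> \<bar>\<Sum>m. c m * a y (t m)\<bar> \<le> M"
    using weak[OF sc, of t] t by blast
  obtain n :: nat where n: "real n > M" using reals_Archimedean2 by blast
  let ?u = "\<lambda>m. c m * a (x n) (t m)"
  have su: "summable (\<lambda>m. \<bar>?u m\<bar>)"
  proof (rule summable_comparison_test'[of "\<lambda>m. \<bar>c m\<bar> * B (x n)" 0])
    show "summable (\<lambda>m. \<bar>c m\<bar> * B (x n))" using sc by (rule summable_mult2)
    show "norm \<bar>?u m\<bar> \<le> \<bar>c m\<bar> * B (x n)" for m
      using B(2)[OF x t, of n m] by (simp add: abs_mult mult_left_mono)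
  qed
  then have su': "summable ?u" by (rule summable_rabs_cancel)
  have "(\<Sum>m. ?u m) = (\<Sum>m. ?u (m + Suc n)) + (\<Sum>m<Suc n. ?u m)" by (rule suminf_split_initial_segment[OF su'])
  then have split: "(\<Sum>m. ?u m) = (\<Sum>m. ?u (m + Suc n)) + (\<Sum>m<n. ?u m) + ?u n" by simp
  have tail: "\<bar>\<Sum>m. ?u (m + Suc n)\<bar> \<le> 2"
  proof -
    have s1: "summable (\<lambda>m. \<bar>?u (m + Suc n)\<bar>)" using su by (rule summable_ignore_initial_segment)
    have "\<bar>\<Sum>m. ?u (m + Suc n)\<bar> \<le> (\<Sum>m. \<bar>?u (m + Suc n)\<bar>)" using s1 by (rule summable_rabs)
    also have "\<dots> \<le> (\<Sum>m. (1/2::real) ^ m)"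
    proof (rule suminf_le[OF _ s1 geo])
      fix m
      have "\<bar>?u (m + Suc n)\<bar> = c (m + Suc n) * \<bar>a (x n) (t (m + Suc n))\<bar>"
        using c0[of "m + Suc n"] by (simp add: abs_mult)
      also have "\<dots> \<le> c (m + Suc n) * B (x n)"
        using c0[of "m + Suc n"] B(2)[OF x t] by (intro mult_left_mono) auto
      also have "\<dots> \<le> (1/2) ^ (m + Suc n)" by (rule cB) simp
      also have "\<dots> \<le> (1/2) ^ m" by (rule power_decreasing) auto
      finally show "\<bar>?u (m + Suc n)\<bar> \<le> (1/2) ^ m" .
    qed
    also have "\<dots> = 2" by (simp add: suminf_geometric)
    finally show ?thesis .
  qed
  have head: "\<bar>\<Sum>m<n. ?u m\<bar> \<le> (\<Sum>m<n. \<bar>c m\<bar> * Q (t m))"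
    by (rule order_trans[OF sum_abs], rule sum_mono)
       (simp add: abs_mult mult_left_mono Q[OF t x])
  have "\<bar>?u n\<bar> = c n * \<bar>a (x n) (t n)\<bar>" using c0[of n] by (simp add: abs_mult)
  then have "\<bar>\<Sum>m. ?u m\<bar> > real n" using split tail head big[of n] by linarith
  then show False using M[OF x[of n]] n by linarith
qed

text \<open>Coordinates from \<open>n\<close> on are frozen at \<open>0\<close>, which makes the box
  a product of compact sets; functions in \<open>Cinf n\<close> ignore these coordinates.\<close>

lemma compact_box: "compact {s::pt. \<forall>i. \<bar>s i\<bar> \<le> (if i < n then M else 0)}"
proof -
  have "compactin (product_topology (\<lambda>_. euclidean) UNIV) (PiE UNIV (\<lambda>i. if i < n then {-M..M} else {0::real}))"
    unfolding compactin_PiE by auto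
  then have "compact (PiE UNIV (\<lambda>i. if i < n then {-M..M} else {0::real}))" by (simp add: euclidean_product_topology)
  moreover have "PiE UNIV (\<lambda>i. if i < n then {-M..M} else {0::real}) = {s::pt. \<forall>i. \<bar>s i\<bar> \<le> (if i < n then M else 0)}"
    unfolding PiE_UNIV_domain Pi_def by (intro Collect_cong iff_allI) (auto simp: abs_le_iff)
  ultimately show ?thesis by simp
qed

lemma Cinf_bounded:
  assumes f: "f \<in> Cinf n"
  shows "\<exists>M. \<forall>s. (\<forall>i<n. \<bar>s i\<bar> \<le> N) \<longrightarrow> \<bar>f s\<bar> \<le> M"
proof -
  let ?K = "{s::pt. \<forall>i. \<bar>s i\<bar> \<le> (if i < n then N else 0)}"
  have "bounded (f ` ?K)"
    by (intro compact_imp_bounded compact_continuous_image compact_box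
        continuous_on_subset[OF Cinf_continuous[OF f]]) auto
  then obtain M where M: "\<forall>s\<in>?K. \<bar>f s\<bar> \<le> M" by (auto simp: bounded_iff)
  have "\<bar>f s\<bar> \<le> M" if "\<forall>i<n. \<bar>s i\<bar> \<le> N" for s
  proof -
    have "(\<lambda>i. if i < n then s i else 0) \<in> ?K" using that by simp
    then have "\<bar>f (\<lambda>i. if i < n then s i else 0)\<bar> \<le> M" using M by blast
    moreover have "f (\<lambda>i. if i < n then s i else 0) = f s" by (rule depD[OF Cinf_dep[OF f]]) simp
    ultimately show ?thesis by simp
  qed
  then show ?thesis by blast
qed

text \<open>Smoothness of all \<open>l\<^sup>1\<close>-combinations yields uniform bounds for difference quotients and
  hence passes to partial derivatives, which smoothness at each \<open>t\<close> alone would not.\<close>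

definition l1_smooth :: "nat \<Rightarrow> 't set \<Rightarrow> (pt \<Rightarrow> 't \<Rightarrow> real) \<Rightarrow> bool" where
  "l1_smooth n T a \<longleftrightarrow> (\<forall>s. \<exists>M. \<forall>t\<in>T. \<bar>a s t\<bar> \<le> M) \<and>
     (\<forall>c t. summable (\<lambda>m. \<bar>c m\<bar>) \<and> (\<forall>m. t m \<in> T) \<longrightarrow> (\<lambda>s. \<Sum>m. c m * a s (t m)) \<in> Cinf n)"

lemma l1_smoothD:
  assumes "l1_smooth n T a"
  shows "\<exists>M. \<forall>t\<in>T. \<bar>a s t\<bar> \<le> M"
    and "summable (\<lambda>m. \<bar>c m\<bar>) \<Longrightarrow> (\<And>m. t m \<in> T) \<Longrightarrow> (\<lambda>s. \<Sum>m. c m * a s (t m)) \<in> Cinf n"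
  using assms unfolding l1_smooth_def by blast+

text \<open>Each summable combination is smooth and hence bounded on the box;
  \<open>l1_uniform_boundedness\<close> makes the bounds uniform in \<open>t\<close>.\<close>

lemma l1_smooth_bounded:
  assumes a: "l1_smooth n T a"
  shows "\<exists>M. \<forall>s. (\<forall>i<n. \<bar>s i\<bar> \<le> N) \<longrightarrow> (\<forall>t\<in>T. \<bar>a s t\<bar> \<le> M)"
proof -
  have "\<exists>M. \<forall>s\<in>{s. \<forall>i<n. \<bar>s i\<bar> \<le> N}. \<forall>t\<in>T. \<bar>a s t\<bar> \<le> M"
  proof (rule l1_uniform_boundedness)
    show "\<exists>M. \<forall>t\<in>T. \<bar>a s t\<bar> \<le> M" for s by (rule l1_smoothD[OF a])
    show "\<exists>M. \<forall>s\<in>{s. \<forall>i<n. \<bar>s i\<bar> \<le> N}. \<bar>\<Sum>m. c m * a s (t m)\<bar> \<le> M"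
      if "summable (\<lambda>m. \<bar>c m\<bar>)" "\<And>m. t m \<in> T" for c and t :: "nat \<Rightarrow> _"
      using Cinf_bounded[OF l1_smoothD(2)[OF a that], of N] by auto
  qed
  then show ?thesis by auto
qed

lemma l1_smooth_Cinf:
  assumes a: "l1_smooth n T a" and t: "t \<in> T"
  shows "(\<lambda>s. a s t) \<in> Cinf n"
proof -
  have "(\<lambda>s. \<Sum>m. (if m = (0::nat) then 1 else 0) * a s t) \<in> Cinf n"
    using l1_smoothD(2)[OF a unit_sequence(1), of "\<lambda>_. t"] t by simp
  then show ?thesis by (simp add: unit_sequence(2))
qed

lemma l1_smooth_summable:
  assumes a: "l1_smooth n T a" and c: "summable (\<lambda>m. \<bar>c m\<bar>)" and t: "\<And>m. t m \<in> T"
  shows "summable (\<lambda>m. c m * a s (t m))"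
proof -
  obtain M where M: "\<forall>t\<in>T. \<bar>a s t\<bar> \<le> M" using l1_smoothD(1)[OF a] by blast
  have "summable (\<lambda>m. \<bar>c m\<bar> * M)" using c by (rule summable_mult2)
  then show ?thesis
    by (rule summable_comparison_test'[of _ 0]) (use M t in \<open>simp add: abs_mult mult_left_mono\<close>)
qed

lemma pd_tendsto:
  assumes f: "f \<in> Cinf n" and i: "i < n"
  shows "((\<lambda>h. (f (s(i := s i + h)) - f s) / h) \<longlongrightarrow> pd i f s) (at 0)"
  using Cinf_has_pd[OF f i, of s] by (simp add: DERIV_def)

text \<open>Uniform boundedness with pairs \<open>(s, h)\<close> as indices. The quotients of a
  combination \<open>G\<close> are values of \<open>pd i G\<close> by the mean value theorem, taken
  in the box of size \<open>N + 1\<close> because of \<open>\<bar>h\<bar> \<le> 1\<close>.\<close>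

lemma l1_smooth_quotient_bounded:
  fixes a :: "pt \<Rightarrow> 't \<Rightarrow> real"
  assumes a: "l1_smooth n T a" and i: "i < n"
  shows "\<exists>M. \<forall>s h. (\<forall>j<n. \<bar>s j\<bar> \<le> N) \<and> h \<noteq> 0 \<and> \<bar>h\<bar> \<le> 1 \<longrightarrow>
    (\<forall>t\<in>T. \<bar>(a (s(i := s i + h)) t - a s t) / h\<bar> \<le> M)"
proof -
  define q where "q = (\<lambda>(s, h) t. (a (s(i := s i + h)) t - a s t) / h)"
  let ?X = "{(s :: pt, h :: real). (\<forall>j<n. \<bar>s j\<bar> \<le> N) \<and> h \<noteq> 0 \<and> \<bar>h\<bar> \<le> 1}"
  have "\<exists>M. \<forall>x\<in>?X. \<forall>t\<in>T. \<bar>q x t\<bar> \<le> M"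
  proof (rule l1_uniform_boundedness)
    fix x assume "x \<in> ?X"
    obtain s h where x: "x = (s, h)" by (cases x)
    obtain M1 M2 where M: "\<forall>t\<in>T. \<bar>a (s(i := s i + h)) t\<bar> \<le> M1" "\<forall>t\<in>T. \<bar>a s t\<bar> \<le> M2"
      using l1_smoothD(1)[OF a] by metis
    have "\<bar>q x t\<bar> \<le> (M1 + M2) / \<bar>h\<bar>" if "t \<in> T" for t
    proof -
      have "\<bar>a (s(i := s i + h)) t - a s t\<bar> \<le> M1 + M2" using M that by fastforce
      then show ?thesis by (simp add: q_def x abs_divide divide_right_mono)
    qed
    then show "\<exists>M. \<forall>t\<in>T. \<bar>q x t\<bar> \<le> M" by blast
  next
    fix c :: "nat \<Rightarrow> real" and t :: "nat \<Rightarrow> 't" assume c: "summable (\<lambda>m. \<bar>c m\<bar>)" and t: "\<And>m. t m \<in> T"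
    define G where "G s = (\<Sum>m. c m * a s (t m))" for s
    have G: "G \<in> Cinf n" unfolding G_def by (rule l1_smoothD(2)[OF a c t])
    obtain M where M: "\<And>s. (\<forall>j<n. \<bar>s j\<bar> \<le> N + 1) \<Longrightarrow> \<bar>pd i G s\<bar> \<le> M"
      using Cinf_bounded[OF Cinf_pd[OF G i], of "N + 1"] by blast
    have "\<bar>\<Sum>m. c m * q (s, h) (t m)\<bar> \<le> M" if sh: "(s, h) \<in> ?X" for s h
    proof -
      have s: "\<forall>j<n. \<bar>s j\<bar> \<le> N" "h \<noteq> 0" "\<bar>h\<bar> \<le> 1" using sh by auto
      have "(\<Sum>m. c m * q (s, h) (t m)) = (\<Sum>m. (c m * a (s(i := s i + h)) (t m) - c m * a s (t m)) / h)"
        by (simp add: q_def algebra_simps)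
      also have "\<dots> = (G (s(i := s i + h)) - G s) / h"
        unfolding G_def using l1_smooth_summable[OF a c t]
        by (simp add: suminf_divide suminf_diff summable_diff)
      finally have eq: "(\<Sum>m. c m * q (s, h) (t m)) = (G (s(i := s i + h)) - G s) / h" .
      obtain z where z: "\<bar>z - s i\<bar> \<le> \<bar>h\<bar>" "(G (s(i := s i + h)) - G s) / h = pd i G (s(i := z))"
        using pd_mvt[OF G i s(2)] by blast
      have "\<bar>s j\<bar> \<le> N + 1" if "j < n" for j using s(1) that by fastforce
      moreover have "\<bar>z\<bar> \<le> N + 1"
      proof -
        have "\<bar>s i\<bar> \<le> N" using s(1) i by blast
        then show ?thesis using z(1) s(3) by linarith
      qed
      ultimately have "\<bar>pd i G (s(i := z))\<bar> \<le> M" by (intro M) auto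
      then show ?thesis using eq z(2) by simp
    qed
    then show "\<exists>M. \<forall>x\<in>?X. \<bar>\<Sum>m. c m * q x (t m)\<bar> \<le> M" by blast
  qed
  then obtain M where M: "\<And>x t. x \<in> ?X \<Longrightarrow> t \<in> T \<Longrightarrow> \<bar>q x t\<bar> \<le> M" by blast
  have "\<bar>(a (s(i := s i + h)) t - a s t) / h\<bar> \<le> M"
    if "(\<forall>j<n. \<bar>s j\<bar> \<le> N) \<and> h \<noteq> 0 \<and> \<bar>h\<bar> \<le> 1" "t \<in> T" for s h t
    using M[of "(s, h)" t] that by (simp add: q_def)
  then show ?thesis by blast
qed

text \<open>The uniform bound on difference quotients dominates the series, so by Tannery's theorem
  the limit may be taken term by term: the derivative of a combination is the combination of the
  derivatives.\<close>

lemma l1_smooth_pd: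
  assumes a: "l1_smooth n T a" and i: "i < n"
  shows "l1_smooth n T (\<lambda>s t. pd i (\<lambda>s. a s t) s)"
proof -
  define b where "b s t = pd i (\<lambda>s. a s t) s" for s t
  have lim: "((\<lambda>h. (a (s(i := s i + h)) t - a s t) / h) \<longlongrightarrow> b s t) (at 0)" if "t \<in> T" for s t
    unfolding b_def by (rule pd_tendsto[OF l1_smooth_Cinf[OF a that] i])
  have ev: "\<forall>\<^sub>F h in at (0::real). h \<noteq> 0 \<and> \<bar>h\<bar> \<le> 1"
    unfolding eventually_at by (rule exI[of _ 1]) auto
  have quot: "\<exists>M. \<forall>h. h \<noteq> 0 \<and> \<bar>h\<bar> \<le> 1 \<longrightarrow> (\<forall>t\<in>T. \<bar>(a (s(i := s i + h)) t - a s t) / h\<bar> \<le> M)" for s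
  proof -
    have "\<forall>j<n. \<bar>s j\<bar> \<le> (\<Sum>j<n. \<bar>s j\<bar>)" by (auto intro: member_le_sum)
    then show ?thesis using l1_smooth_quotient_bounded[OF a i, of "\<Sum>j<n. \<bar>s j\<bar>"] by blast
  qed
  have 1: "\<exists>M. \<forall>t\<in>T. \<bar>b s t\<bar> \<le> M" for s
  proof -
    obtain M where M: "\<And>h t. h \<noteq> 0 \<and> \<bar>h\<bar> \<le> 1 \<Longrightarrow> t \<in> T \<Longrightarrow> \<bar>(a (s(i := s i + h)) t - a s t) / h\<bar> \<le> M"
      using quot[of s] by blast
    have "\<bar>b s t\<bar> \<le> M" if "t \<in> T" for t
      by (rule tendsto_upperbound[OF tendsto_rabs[OF lim[OF that]] eventually_mono[OF ev]]) (use M that in auto)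
    then show ?thesis by blast
  qed
  have 2: "(\<lambda>s. \<Sum>m. c m * b s (t m)) \<in> Cinf n"
    if c: "summable (\<lambda>m. \<bar>c m\<bar>)" and t: "\<And>m. t m \<in> T" for c and t :: "nat \<Rightarrow> _"
  proof -
    define G where "G s = (\<Sum>m. c m * a s (t m))" for s
    have G: "G \<in> Cinf n" unfolding G_def by (rule l1_smoothD(2)[OF a c t])
    have "pd i G s = (\<Sum>m. c m * b s (t m))" for s
    proof -
      obtain M where M: "\<And>h t. h \<noteq> 0 \<and> \<bar>h\<bar> \<le> 1 \<Longrightarrow> t \<in> T \<Longrightarrow> \<bar>(a (s(i := s i + h)) t - a s t) / h\<bar> \<le> M"
        using quot[of s] by blast
      let ?q = "\<lambda>m h. c m * ((a (s(i := s i + h)) (t m) - a s (t m)) / h)"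
      have "((\<lambda>h. \<Sum>m. ?q m h) \<longlongrightarrow> (\<Sum>m. c m * b s (t m))) (at 0)"
      proof (rule tannerys_theorem[THEN conjunct2, THEN conjunct2])
        show "(?q m \<longlongrightarrow> c m * b s (t m)) (at 0)" for m
          by (intro tendsto_mult tendsto_const lim t)
        have "\<forall>\<^sub>F x in at_top \<times>\<^sub>F at (0::real). True \<and> (snd x \<noteq> 0 \<and> \<bar>snd x\<bar> \<le> 1)"
          by (rule eventually_prodI[OF _ ev, of "\<lambda>_. True"]) simp
        then show "\<forall>\<^sub>F (m, h) in at_top \<times>\<^sub>F at 0. norm (?q m h) \<le> \<bar>c m\<bar> * M"
        proof (rule eventually_mono, clarify)
          fix m :: nat and h :: real assume "snd (m, h) \<noteq> 0" "\<bar>snd (m, h)\<bar> \<le> 1"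
          then have "\<bar>(a (s(i := s i + h)) (t m) - a s (t m)) / h\<bar> \<le> M" using t by (intro M) auto
          then show "norm (?q m h) \<le> \<bar>c m\<bar> * M"
            unfolding real_norm_def abs_mult by (rule mult_left_mono) simp
        qed
        show "summable (\<lambda>m. \<bar>c m\<bar> * M)" using c by (rule summable_mult2)
      qed simp
      moreover have "(\<Sum>m. ?q m h) = (G (s(i := s i + h)) - G s) / h" for h
      proof -
        have "(\<Sum>m. ?q m h) = (\<Sum>m. (c m * a (s(i := s i + h)) (t m) - c m * a s (t m)) / h)"
          by (simp add: algebra_simps)
        also have "\<dots> = (G (s(i := s i + h)) - G s) / h"
          unfolding G_def using l1_smooth_summable[OF a c t]
          by (simp add: suminf_divide suminf_diff summable_diff)
        finally show ?thesis .
      qed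
      ultimately have "((\<lambda>h. (G (s(i := s i + h)) - G s) / h) \<longlongrightarrow> (\<Sum>m. c m * b s (t m))) (at 0)" by simp
      from tendsto_unique[OF _ pd_tendsto[OF G i] this] show ?thesis by simp
    qed
    then have "(\<lambda>s. \<Sum>m. c m * b s (t m)) = pd i G" by auto
    then show ?thesis using Cinf_pd[OF G i] by simp
  qed
  show ?thesis unfolding l1_smooth_def using 1 2 unfolding b_def by blast
qed

section \<open>Uncurrying smooth families with values in the smooth functions\<close>

lemma Cinf_intoD:
  assumes "g \<in> Cinf_into n X"
  shows "g s \<in> topspace X" "dep n g" "\<phi> \<in> dual X \<Longrightarrow> (\<lambda>s. \<phi> (g s)) \<in> Cinf n"
  using assms unfolding Cinf_into_def dep_def by blast+

text \<open>For points in a bounded interval and summable coefficients, the series of values of the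
  \<open>j\<close>-th derivative is dominated by one seminorm and so is a continuous functional.
  This starts an induction that continues by \<open>l1_smooth_pd\<close>.\<close>

lemma derivs_l1_smooth:
  assumes g: "g \<in> Cinf_into n smooth_space" and "set is \<subseteq> {..<n}"
  shows "l1_smooth n {- real r..real r} (\<lambda>s t. pds is (\<lambda>s. (deriv ^^ j) (g s) t) s)"
  using assms(2)
proof (induction "is" rule: rev_induct)
  case Nil
  have gs: "g s \<in> Cinf_line" for s using Cinf_intoD(1)[OF g] by simp
  show ?case unfolding l1_smooth_def
  proof (intro conjI allI impI)
    show "\<exists>M. \<forall>t\<in>{- real r..real r}. \<bar>pds [] (\<lambda>s. (deriv ^^ j) (g s) t) s\<bar> \<le> M" for s
      using sup_deriv_upper[OF gs, of _ r j] by (intro exI[of _ "sup_deriv j r (g s)"]) simp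
    fix c t :: "nat \<Rightarrow> real" assume "summable (\<lambda>m. \<bar>c m\<bar>) \<and> (\<forall>m. t m \<in> {- real r..real r})"
    then have c: "summable (\<lambda>m. \<bar>c m\<bar>)" and t: "\<And>m. t m \<in> {- real r..real r}" by blast+
    have sc: "summable (\<lambda>m. \<bar>c m\<bar> * sup_deriv j r f)" for f using c by (rule summable_mult2)
    have sb: "\<bar>c m * (deriv ^^ j) f (t m)\<bar> \<le> \<bar>c m\<bar> * sup_deriv j r f" if "f \<in> Cinf_line" for f m
      using sup_deriv_upper[OF that t, of j m] by (simp add: abs_mult mult_left_mono)
    have s: "summable (\<lambda>m. \<bar>c m * (deriv ^^ j) f (t m)\<bar>)" if "f \<in> Cinf_line" for f
      by (rule summable_comparison_test'[OF sc, of 0 _ f]) (use sb[OF that] in simp)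
    have s': "summable (\<lambda>m. c m * (deriv ^^ j) f (t m))" if "f \<in> Cinf_line" for f
      using s[OF that] by (rule summable_rabs_cancel)
    have "(\<lambda>f. \<Sum>m. c m * (deriv ^^ j) f (t m)) \<in> dual smooth_space"
    proof (rule dual_smooth_spaceI)
      fix f h :: "real \<Rightarrow> real" assume fh: "f \<in> Cinf_line" "h \<in> Cinf_line"
      have "(deriv ^^ j) (\<lambda>x. f x + h x) = (\<lambda>x. (deriv ^^ j) f x + (deriv ^^ j) h x)"
        using Cinf_line_lincomb(2)[OF fh, of j 1 1] by simp
      then show "(\<Sum>m. c m * (deriv ^^ j) (\<lambda>x. f x + h x) (t m)) =
          (\<Sum>m. c m * (deriv ^^ j) f (t m)) + (\<Sum>m. c m * (deriv ^^ j) h (t m))"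
        using suminf_add[OF s'[OF fh(1)] s'[OF fh(2)]] by (simp add: algebra_simps)
    next
      fix f :: "real \<Rightarrow> real" and b assume f: "f \<in> Cinf_line"
      have "(deriv ^^ j) (\<lambda>x. b * f x) = (\<lambda>x. b * (deriv ^^ j) f x)"
        using Cinf_line_lincomb(2)[OF f f, of j b 0] by simp
      then show "(\<Sum>m. c m * (deriv ^^ j) (\<lambda>x. b * f x) (t m)) = b * (\<Sum>m. c m * (deriv ^^ j) f (t m))"
        using suminf_mult[OF s'[OF f], of b] by (simp add: algebra_simps)
    next
      \<comment> \<open>The added \<open>1\<close> makes the constant positive even if all
        coefficients are zero.\<close>
      show "(\<Sum>m. \<bar>c m\<bar>) + 1 > 0" using suminf_nonneg[OF c] by simp
      fix f :: "real \<Rightarrow> real" assume f: "f \<in> Cinf_line"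
      have "\<bar>\<Sum>m. c m * (deriv ^^ j) f (t m)\<bar> \<le> (\<Sum>m. \<bar>c m * (deriv ^^ j) f (t m)\<bar>)"
        by (rule summable_rabs[OF s[OF f]])
      also have "\<dots> \<le> (\<Sum>m. \<bar>c m\<bar> * sup_deriv j r f)"
        by (rule suminf_le[OF sb[OF f] s[OF f] sc])
      also have "\<dots> = (\<Sum>m. \<bar>c m\<bar>) * sup_deriv j r f" using suminf_mult2[OF c, of "sup_deriv j r f"] by simp
      also have "\<dots> \<le> ((\<Sum>m. \<bar>c m\<bar>) + 1) * sup_deriv j r f"
      proof (rule mult_right_mono)
        show "0 \<le> sup_deriv j r f"
          using sup_deriv_upper[OF f, of 0 r j] by (rule order_trans[OF abs_ge_zero]) simp
      qed simp
      finally show "\<bar>\<Sum>m. c m * (deriv ^^ j) f (t m)\<bar> \<le> ((\<Sum>m. \<bar>c m\<bar>) + 1) * sup_deriv j r f" .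
    qed
    from Cinf_intoD(3)[OF g this]
    show "(\<lambda>s. \<Sum>m. c m * pds [] (\<lambda>s. (deriv ^^ j) (g s) (t m)) s) \<in> Cinf n" by simp
  qed
next
  case (snoc i "is")
  then show ?case using l1_smooth_pd[of n _ "\<lambda>s t. pds is (\<lambda>s. (deriv ^^ j) (g s) t) s" i]
    by (simp add: pds_append)
qed

text \<open>The functionals directly give only separate smoothness of the mixed derivatives
  \<open>A is j s t\<close>. The bounds from \<open>l1_smooth_bounded\<close> make these jointly
  continuous and allow parameter and line derivatives to be exchanged, so that they form a family
  for \<open>smooth_coinduct\<close>.\<close>

lemma exponential_law:
  assumes g: "g \<in> Cinf_into n smooth_space"
  shows "(\<lambda>s. g s (s n)) \<in> Cinf (Suc n)"
proof -
  define A where "A is j s t = pds is (\<lambda>s. (deriv ^^ j) (g s) t) s" for "is" j s t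
  have gs: "g s \<in> Cinf_line" for s using Cinf_intoD(1)[OF g] by simp
  have l1: "l1_smooth n {- real r..real r} (A is j)" if "set is \<subseteq> {..<n}" for "is" j r
    using derivs_l1_smooth[OF g that, of r j] by (simp add: A_def[abs_def])
  have AC: "(\<lambda>s. A is j s t) \<in> Cinf n" if "set is \<subseteq> {..<n}" for "is" j t
    unfolding A_def using Cinf_intoD(3)[OF g eval_dual_smooth_space] that by (rule Cinf_pds)
  have Apd: "pd i (\<lambda>s. A is j s t) = (\<lambda>s. A (is @ [i]) j s t)" for i "is" j t
    by (simp add: A_def pds_append)
  have Abdd: "\<exists>M. \<forall>s. (\<forall>i<n. \<bar>s i\<bar> \<le> N) \<longrightarrow> (\<forall>t\<in>{- real r..real r}. \<bar>A is j s t\<bar> \<le> M)"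
    if "set is \<subseteq> {..<n}" for "is" j N r
    by (rule l1_smooth_bounded[OF l1[OF that]])
  \<comment> \<open>Each further parameter derivative is a limit of difference quotients that
    converge uniformly on intervals together with all line derivatives, so
    \<open>smooth_limit\<close> yields its line derivatives.\<close>
  have Ader: "set is \<subseteq> {..<n} \<Longrightarrow> (A is j s has_real_derivative A is (Suc j) s t) (at t)" for "is" j s t
  proof (induction "is" arbitrary: j s t rule: rev_induct)
    case Nil
    then show ?case using Cinf_line_deriv[OF gs, of j s t] by (simp add: A_def[abs_def])
  next
    case (snoc i "is")
    then have i: "i < n" and isn: "set is \<subseteq> {..<n}" by auto
    have A0: "A is 0 s \<in> Cinf_line" "(deriv ^^ j) (A is 0 s) = A is j s" for j s
      using Cinf_lineI[of "\<lambda>j. A is j s" "A is 0 s"] snoc.IH[OF isn] by auto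
    define h where "h m = 1 / (real m + 1)" for m
    have h: "0 < h m" "h m \<le> 1" for m by (simp_all add: h_def)
    have h0: "h \<longlonglongrightarrow> 0" unfolding h_def using LIMSEQ_inverse_real_of_nat by (simp add: inverse_eq_divide add.commute)
    define F where "F m t = 1 / h m * A is 0 (s(i := s i + h m)) t + (- 1 / h m) * A is 0 s t" for m t
    have F: "F m \<in> Cinf_line" for m unfolding F_def by (intro Cinf_line_lincomb A0)
    have dF: "(deriv ^^ j) (F m) t = (A is j (s(i := s i + h m)) t - A is j s t) / h m" for j m t
      unfolding F_def Cinf_line_lincomb(2)[OF A0(1) A0(1)] A0(2) by (simp add: diff_divide_distrib)
    have "uniform_limit {- real r..real r} (\<lambda>m. (deriv ^^ j) (F m)) (A (is @ [i]) j s) sequentially" for j r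
    proof (rule uniform_limitI)
      fix e :: real assume e: "e > 0"
      define N where "N = (\<Sum>j<n. \<bar>s j\<bar>) + 1"
      have sN: "\<bar>s j\<bar> \<le> N - 1" if "j < n" for j
        unfolding N_def using that by (auto intro: member_le_sum)
      have is2: "set ((is @ [i]) @ [i]) \<subseteq> {..<n}" using isn i by auto
      \<comment> \<open>A bound for the second derivative in direction \<open>i\<close> gives an
        error of order \<open>h m\<close> for the difference quotient, uniformly in
        \<open>t\<close>.\<close>
      obtain M where M: "\<And>s t. (\<forall>i<n. \<bar>s i\<bar> \<le> N) \<Longrightarrow> t \<in> {- real r..real r} \<Longrightarrow> \<bar>A ((is @ [i]) @ [i]) j s t\<bar> \<le> M"
        using Abdd[OF is2, of N r j] by blast
      have "\<bar>A ((is @ [i]) @ [i]) j s 0\<bar> \<le> M" using sN by (intro M) fastforce+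
      then have "M \<ge> 0" by linarith
      have "\<forall>\<^sub>F m in sequentially. dist (h m) 0 < e / (M + 1)"
        using h0 e \<open>M \<ge> 0\<close> by (intro tendstoD) auto
      then show "\<forall>\<^sub>F m in sequentially. \<forall>t\<in>{- real r..real r}. dist ((deriv ^^ j) (F m) t) (A (is @ [i]) j s t) < e"
      proof (rule eventually_mono, intro ballI)
        fix m t assume hm: "dist (h m) 0 < e / (M + 1)" and t: "t \<in> {- real r..real r}"
        have is': "set (is @ [i]) \<subseteq> {..<n}" using isn i by simp
        have hm0: "h m \<noteq> 0" using h(1)[of m] by simp
        obtain z where z: "\<bar>z - s i\<bar> \<le> \<bar>h m\<bar>"
          "(A is j (s(i := s i + h m)) t - A is j s t) / h m = pd i (\<lambda>s. A is j s t) (s(i := z))"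
          using pd_mvt[OF AC[OF isn] i hm0] by blast
        have "\<bar>A (is @ [i]) j (s(i := z)) t - A (is @ [i]) j s t\<bar> \<le> M * \<bar>h m\<bar>"
        proof (cases "z = s i")
          case False
          then have zs: "z - s i \<noteq> 0" by simp
          obtain y where y: "\<bar>y - s i\<bar> \<le> \<bar>z - s i\<bar>"
            "(A (is @ [i]) j (s(i := s i + (z - s i))) t - A (is @ [i]) j s t) / (z - s i) =
              pd i (\<lambda>s. A (is @ [i]) j s t) (s(i := y))"
            using pd_mvt[OF AC[OF is'] i zs] by blast
          have "\<bar>(s(i := y)) k\<bar> \<le> N" if "k < n" for k
            using sN[OF that] sN[OF i] y(1) z(1) h[of m] by auto
          then have "\<bar>A ((is @ [i]) @ [i]) j (s(i := y)) t\<bar> \<le> M" using t by (intro M) auto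
          moreover have "A (is @ [i]) j (s(i := z)) t - A (is @ [i]) j s t =
              A ((is @ [i]) @ [i]) j (s(i := y)) t * (z - s i)"
            using y(2) zs unfolding Apd by (simp add: field_simps)
          ultimately have "\<bar>A (is @ [i]) j (s(i := z)) t - A (is @ [i]) j s t\<bar> \<le> M * \<bar>z - s i\<bar>"
            by (simp add: abs_mult mult_right_mono)
          also have "\<dots> \<le> M * \<bar>h m\<bar>" using z(1) \<open>M \<ge> 0\<close> by (rule mult_left_mono)
          finally show ?thesis .
        qed (use \<open>M \<ge> 0\<close> in simp)
        also have "\<dots> \<le> (M + 1) * \<bar>h m\<bar>" by (simp add: mult_right_mono)
        also have "\<dots> < e" using hm \<open>M \<ge> 0\<close> by (simp add: dist_real_def field_simps)
        finally show "dist ((deriv ^^ j) (F m) t) (A (is @ [i]) j s t) < e"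
          unfolding dF z(2) Apd dist_real_def .
      qed
    qed
    then have *: "A (is @ [i]) 0 s \<in> Cinf_line" "\<And>j. (deriv ^^ j) (A (is @ [i]) 0 s) = A (is @ [i]) j s"
      using smooth_limit(1,2)[of F "\<lambda>j. A (is @ [i]) j s", OF F] by auto
    show ?case using Cinf_line_deriv[OF *(1), of j t] unfolding *(2) .
  qed
  have Aeq: "A is j x t = A is j y t" if "set is \<subseteq> {..<n}" "\<And>i. i < n \<Longrightarrow> x i = y i" for "is" j x y t
    by (rule depD[OF Cinf_dep[OF AC[OF that(1)]] that(2)])
  define S where "S = {(\<lambda>s. A is j s (s n)) |is j. set is \<subseteq> {..<n}}"
  show ?thesis
    unfolding Cinf_def mem_Collect_eq
  proof (rule smooth_coinduct[OF open_UNIV])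
    have "(\<lambda>s. g s (s n)) = (\<lambda>s. A [] 0 s (s n))" by (simp add: A_def)
    then show "(\<lambda>s. g s (s n)) \<in> S" unfolding S_def by (intro CollectI exI[of _ "[]"] exI[of _ 0]) simp
    show "g x (x n) = g y (y n)" if "\<And>i. i < Suc n \<Longrightarrow> x i = y i" for x y
    proof -
      have "g x = g y" by (rule depD[OF Cinf_intoD(2)[OF g]]) (use that in simp)
      then show ?thesis using that by simp
    qed
    fix f assume "f \<in> S"
    then obtain "is" j where isn: "set is \<subseteq> {..<n}" and f: "f = (\<lambda>s. A is j s (s n))" unfolding S_def by blast
    show "continuous_on UNIV f"
    proof (rule continuous_on_sequentiallyI)
      fix u and s :: pt assume us: "u \<longlonglongrightarrow> s"
      have ui: "(\<lambda>m. u m i) \<longlonglongrightarrow> s i" for i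
        using continuous_on_tendsto_compose[OF continuous_coord us] by simp
      define N where "N = (\<Sum>i\<le>n. \<bar>s i\<bar>) + 1"
      have sN: "\<bar>s i\<bar> < N" if "i \<le> n" for i
      proof -
        have "\<bar>s i\<bar> \<le> (\<Sum>i\<le>n. \<bar>s i\<bar>)" using that by (intro member_le_sum) auto
        then show ?thesis by (simp add: N_def)
      qed
      obtain r where r: "N \<le> real r" using real_arch_simple by blast
      \<comment> \<open>A bound for the line derivative near \<open>s\<close> controls the change of
        the last coordinate uniformly in the others; with the last coordinate fixed, continuity is
        already known from \<open>AC\<close>.\<close>
      obtain M where M: "\<And>s t. (\<forall>i<n. \<bar>s i\<bar> \<le> N) \<Longrightarrow> t \<in> {- real r..real r} \<Longrightarrow> \<bar>A is (Suc j) s t\<bar> \<le> M"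
        using Abdd[OF isn, of N r "Suc j"] by blast
      have "\<forall>\<^sub>F m in sequentially. \<forall>i\<in>{..n}. \<bar>u m i\<bar> < N"
        by (intro eventually_ball_finite ballI order_tendstoD(2)[OF tendsto_rabs[OF ui]] sN) auto
      then have bd: "\<forall>\<^sub>F m in sequentially. norm (A is j (u m) (u m n) - A is j (u m) (s n)) \<le> M * \<bar>u m n - s n\<bar>"
      proof (rule eventually_mono)
        fix m assume um: "\<forall>i\<in>{..n}. \<bar>u m i\<bar> < N"
        let ?I = "{- real r..real r}"
        have I: "u m n \<in> ?I" "s n \<in> ?I" using um[rule_format, of n] sN[of n] r by auto
        have "norm (A is j (u m) (u m n) - A is j (u m) (s n)) \<le> M * norm (u m n - s n)"
        proof (rule field_differentiable_bound[of ?I "A is j (u m)" "A is (Suc j) (u m)"])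
          show "(A is j (u m) has_field_derivative A is (Suc j) (u m) z) (at z within ?I)" for z
            using Ader[OF isn] by (rule has_field_derivative_at_within)
          show "norm (A is (Suc j) (u m) z) \<le> M" if "z \<in> ?I" for z
            using M[OF _ that, of "u m"] um by (simp add: less_imp_le)
        qed (use I in auto)
        then show "norm (A is j (u m) (u m n) - A is j (u m) (s n)) \<le> M * \<bar>u m n - s n\<bar>" by simp
      qed
      have "(\<lambda>m. M * \<bar>u m n - s n\<bar>) \<longlonglongrightarrow> 0"
        using tendsto_mult[OF tendsto_const tendsto_rabs[OF tendsto_diff[OF ui[of n] tendsto_const[of "s n"]]], of M] by simp
      with bd have "(\<lambda>m. A is j (u m) (u m n) - A is j (u m) (s n)) \<longlonglongrightarrow> 0" by (rule Lim_null_comparison)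
      moreover have "(\<lambda>m. A is j (u m) (s n)) \<longlonglongrightarrow> A is j s (s n)"
        using continuous_on_tendsto_compose[OF Cinf_continuous[OF AC[OF isn, of j "s n"]] us] by simp
      ultimately have "(\<lambda>m. (A is j (u m) (u m n) - A is j (u m) (s n)) + A is j (u m) (s n)) \<longlonglongrightarrow> 0 + A is j s (s n)"
        by (rule tendsto_add)
      then show "(\<lambda>m. f (u m)) \<longlonglongrightarrow> f s" by (simp add: f)
    qed
    fix i assume i: "i < Suc n"
    show "\<exists>f'\<in>S. \<forall>x\<in>UNIV. ((\<lambda>t. f (x(i := t))) has_real_derivative f' x) (at (x i))"
    proof (cases "i = n")
      case True
      have "((\<lambda>t. f (x(i := t))) has_real_derivative A is (Suc j) x (x n)) (at (x i))" for x
      proof -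
        have "f (x(i := t)) = A is j x t" for t
          unfolding f True using Aeq[OF isn, of "x(n := t)" x] by simp
        then show ?thesis using Ader[OF isn, of j x "x n"] True by simp
      qed
      then show ?thesis
        by (intro bexI[of _ "\<lambda>s. A is (Suc j) s (s n)"]) (use isn in \<open>auto simp: S_def\<close>)
    next
      case False
      with i have i': "i < n" by simp
      have "((\<lambda>t. f (x(i := t))) has_real_derivative A (is @ [i]) j x (x n)) (at (x i))" for x
        using Cinf_has_pd[OF AC[OF isn, of j "x n"] i', of x] False by (simp add: f Apd)
      moreover have "set (is @ [i]) \<subseteq> {..<n}" using isn i' by simp
      ultimately show ?thesis
        by (intro bexI[of _ "\<lambda>s. A (is @ [i]) j s (s n)"]) (auto simp: S_def simp del: set_append)
    qed
  qed
qed

text \<open>Only finitely many \<open>y m\<close> lie in a given compact set, so on functions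
  supported there \<phi> is a fixed finite combination of evaluations. The coefficients may grow
  arbitrarily fast.\<close>

lemma dual_test_locally_finite:
  fixes y c :: "nat \<Rightarrow> real"
  assumes y: "\<And>m. \<bar>y m\<bar> > real m"
  defines "\<phi> \<equiv> \<lambda>f. \<Sum>m | f (y m) \<noteq> 0. c m * f (y m)"
  shows "\<phi> \<in> dual test_space"
    and "(\<And>m. m \<ge> M \<Longrightarrow> f (y m) = 0) \<Longrightarrow> \<phi> f = (\<Sum>m<M. c m * f (y m))"
proof -
  have *: "\<phi> f = (\<Sum>m<M. c m * f (y m))" if "\<And>m. m \<ge> M \<Longrightarrow> f (y m) = 0" for f M
    unfolding \<phi>_def
  proof (rule sum.mono_neutral_left)
    show "{m. f (y m) \<noteq> 0} \<subseteq> {..<M}" using that by (auto simp: not_le[symmetric])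
  qed auto
  then show "(\<And>m. m \<ge> M \<Longrightarrow> f (y m) = 0) \<Longrightarrow> \<phi> f = (\<Sum>m<M. c m * f (y m))" by blast
  have N: "\<exists>M. \<forall>m\<ge>M. f (y m) = 0" if f: "f \<in> test_funs" for f
  proof -
    obtain N where N: "\<And>x. \<bar>x\<bar> > N \<Longrightarrow> f x = 0" using f test_funs_iff by blast
    obtain M :: nat where M: "N \<le> real M" using real_arch_simple by blast
    have "f (y m) = 0" if "m \<ge> M" for m
    proof (rule N)
      have "real M \<le> real m" using that by simp
      then show "\<bar>y m\<bar> > N" using y[of m] M by linarith
    qed
    then show ?thesis by blast
  qed
  show "\<phi> \<in> dual test_space"
  proof (rule dual_test_spaceI)
    fix f g assume "f \<in> test_funs" "g \<in> test_funs"
    then obtain M1 M2 where M: "\<forall>m\<ge>M1. f (y m) = 0" "\<forall>m\<ge>M2. g (y m) = 0" using N by meson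
    have "\<phi> f = (\<Sum>m<max M1 M2. c m * f (y m))" "\<phi> g = (\<Sum>m<max M1 M2. c m * g (y m))"
      "\<phi> (\<lambda>x. f x + g x) = (\<Sum>m<max M1 M2. c m * (f (y m) + g (y m)))"
      using M by (auto intro!: *)
    then show "\<phi> (\<lambda>x. f x + g x) = \<phi> f + \<phi> g" by (simp add: algebra_simps sum.distrib)
  next
    fix b f assume "f \<in> test_funs"
    then obtain M where M: "\<forall>m\<ge>M. f (y m) = 0" using N by meson
    have "\<phi> f = (\<Sum>m<M. c m * f (y m))" "\<phi> (\<lambda>x. b * f x) = (\<Sum>m<M. c m * (b * f (y m)))"
      using M by (auto intro!: *)
    then show "\<phi> (\<lambda>x. b * f x) = b * \<phi> f" by (simp add: sum_distrib_left algebra_simps)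
  next
    fix K :: "real set" assume "compact K"
    then obtain N where N: "\<And>x. x \<in> K \<Longrightarrow> \<bar>x\<bar> \<le> N" using compact_imp_bounded[of K] by (auto simp: bounded_iff)
    obtain M :: nat where M: "N \<le> real M" using real_arch_simple by blast
    have ev: "continuous_map smooth_space euclideanreal (\<lambda>f. f t)" for t
      using dual_continuous[OF eval_dual_smooth_space[of 0 t]] by simp
    have "continuous_map smooth_space euclideanreal (\<lambda>f. \<Sum>m<M. c m * f (y m))"
      by (intro continuous_map_sum continuous_map_real_mult_left ev) auto
    then have "continuous_map (subtopology smooth_space (test_funs_in K)) euclideanreal (\<lambda>f. \<Sum>m<M. c m * f (y m))"
      by (rule continuous_map_from_subtopology)
    then show "continuous_map (subtopology smooth_space (test_funs_in K)) euclideanreal \<phi>"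
    proof (rule continuous_map_eq)
      fix f assume f: "f \<in> topspace (subtopology smooth_space (test_funs_in K))"
      have "f (y m) = 0" if "m \<ge> M" for m
      proof -
        have "real M \<le> real m" using that by simp
        then have "y m \<notin> K" using N[of "y m"] y[of m] M by linarith
        then show ?thesis using f by (auto simp: test_funs_in_def)
      qed
      then show "(\<Sum>m<M. c m * f (y m)) = \<phi> f" using *[of M f] by simp
    qed
  qed
qed

text \<open>If the supports escaped to infinity, points \<open>y k\<close> outside the previous supports make the
  system for the coefficients \<open>c k\<close> triangular, so that the functional \<open>\<Sum>k. c k * f (y k)\<close> takes
  the value \<open>k\<close> at the \<open>k\<close>-th member.\<close>

lemma test_family_bounded_support:
  assumes g: "g \<in> Cinf_into n test_space"
  shows "\<exists>N. \<forall>s. (\<forall>i<n. \<bar>s i\<bar> \<le> R) \<longrightarrow> (\<forall>y. \<bar>y\<bar> > N \<longrightarrow> g s y = 0)"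
proof (rule ccontr)
  assume "\<not> ?thesis"
  then have unb: "\<exists>s y. (\<forall>i<n. \<bar>s i\<bar> \<le> R) \<and> \<bar>y\<bar> > N \<and> g s y \<noteq> 0" for N by blast
  \<comment> \<open>A tuple consists of a parameter, a point, a bound for the support of the
    function at this parameter, and a coefficient. The equation prescribes the value
    \<open>k\<close> without the later terms, because their points lie beyond
    \<open>N\<close>.\<close>
  define P :: "(nat \<Rightarrow> pt \<times> real \<times> real \<times> real) \<Rightarrow> nat \<Rightarrow> pt \<times> real \<times> real \<times> real \<Rightarrow> bool" where
    "P f k r \<longleftrightarrow> (case r of (s, y, N, c) \<Rightarrow> (\<forall>i<n. \<bar>s i\<bar> \<le> R) \<and> \<bar>y\<bar> > real k \<and>
       (\<forall>m<k. \<bar>y\<bar> > fst (snd (snd (f m)))) \<and> (\<forall>z. \<bar>z\<bar> > N \<longrightarrow> g s z = 0) \<and>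
       (\<Sum>m<k. snd (snd (snd (f m))) * g s (fst (snd (f m)))) + c * g s y = real k)" for f k r
  have "\<exists>f. \<forall>k. P f k (f k)"
  proof (rule dependent_wellorder_choice)
    fix r and f g' :: "nat \<Rightarrow> pt \<times> real \<times> real \<times> real" and k :: nat
    assume "\<And>m. m < k \<Longrightarrow> f m = g' m"
    then show "P f k r = P g' k r" unfolding P_def by (auto split: prod.splits)
  next
    fix k :: nat and f :: "nat \<Rightarrow> pt \<times> real \<times> real \<times> real"
    obtain s y where sy: "\<forall>i<n. \<bar>s i\<bar> \<le> R" "\<bar>y\<bar> > real k + (\<Sum>m<k. \<bar>fst (snd (snd (f m)))\<bar>)" "g s y \<noteq> 0"
      using unb by blast
    have "g s \<in> test_funs" using Cinf_intoD(1)[OF g] by simp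
    then obtain N where N: "\<forall>z. \<bar>z\<bar> > N \<longrightarrow> g s z = 0" using test_funs_iff by blast
    have "\<bar>y\<bar> > fst (snd (snd (f m)))" if "m < k" for m
    proof -
      have "\<bar>fst (snd (snd (f m)))\<bar> \<le> (\<Sum>m<k. \<bar>fst (snd (snd (f m)))\<bar>)"
        using that by (intro member_le_sum) auto
      then show ?thesis using sy(2) by linarith
    qed
    moreover have "\<bar>y\<bar> > real k"
      using sy(2) sum_nonneg[of "{..<k}" "\<lambda>m. \<bar>fst (snd (snd (f m)))\<bar>"]
      by (smt (verit) abs_ge_zero)
    \<comment> \<open>Since \<open>g s y \<noteq> 0\<close>, the prescribed equation can be solved
      for the new coefficient.\<close>
    ultimately have "P f k (s, y, N, (real k - (\<Sum>m<k. snd (snd (snd (f m))) * g s (fst (snd (f m))))) / g s y)"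
      unfolding P_def using sy N by simp
    then show "\<exists>r. P f k r" ..
  qed
  then obtain f where f: "\<And>k. P f k (f k)" by blast
  define s where "s k = fst (f k)" for k
  define y where "y k = fst (snd (f k))" for k
  define N where "N k = fst (snd (snd (f k)))" for k
  define c where "c k = snd (snd (snd (f k)))" for k
  have *: "(\<forall>i<n. \<bar>s k i\<bar> \<le> R) \<and> \<bar>y k\<bar> > real k \<and> (\<forall>m<k. \<bar>y k\<bar> > N m) \<and>
    (\<forall>z. \<bar>z\<bar> > N k \<longrightarrow> g (s k) z = 0) \<and> (\<Sum>m<k. c m * g (s k) (y m)) + c k * g (s k) (y k) = real k" for k
    using f[of k] unfolding P_def s_def y_def N_def c_def by (cases "f k") auto
  then have yk: "\<bar>y k\<bar> > real k" for k by blast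
  define \<phi> where "\<phi> = (\<lambda>h :: real \<Rightarrow> real. \<Sum>m | h (y m) \<noteq> 0. c m * h (y m))"
  have \<phi>: "\<phi> \<in> dual test_space" unfolding \<phi>_def by (rule dual_test_locally_finite(1)[OF yk])
  have val: "\<phi> (g (s k)) = real k" for k
  proof -
    have "g (s k) (y m) = 0" if "m \<ge> Suc k" for m using *[of k] *[of m] that by (simp add: Suc_le_eq)
    then have "\<phi> (g (s k)) = (\<Sum>m<Suc k. c m * g (s k) (y m))"
      unfolding \<phi>_def by (rule dual_test_locally_finite(2)[OF yk])
    then show ?thesis using *[of k] by simp
  qed
  obtain M where M: "\<And>s. (\<forall>i<n. \<bar>s i\<bar> \<le> R) \<Longrightarrow> \<bar>\<phi> (g s)\<bar> \<le> M"
    using Cinf_bounded[OF Cinf_intoD(3)[OF g \<phi>], of R] by blast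
  obtain k :: nat where "real k > M" using reals_Archimedean2 by blast
  then show False using M[of "s k"] *[of k] val[of k] by simp
qed

section \<open>Cutoff functions and charts\<close>

lemma Cinf_from_pd:
  assumes "dep n f" "continuous_on UNIV f"
    and "\<And>i. i < n \<Longrightarrow> \<exists>f'\<in>Cinf n. \<forall>x. ((\<lambda>t. f (x(i := t))) has_real_derivative f' x) (at (x i))"
  shows "f \<in> Cinf n"
proof (rule Cinf_gen[OF gen.base[of f "insert f (Cinf n)"]])
  fix g i assume g: "g \<in> insert f (Cinf n)" and i: "i < n"
  have "\<exists>g'\<in>Cinf n. \<forall>x. ((\<lambda>t. g (x(i := t))) has_real_derivative g' x) (at (x i))"
    using g assms(3)[OF i] Cinf_has_pd[OF _ i] Cinf_pd[OF _ i] by blast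
  then show "\<exists>f'\<in>gen (insert f (Cinf n)). \<forall>x. ((\<lambda>t. g (x(i := t))) has_real_derivative f' x) (at (x i))"
    using gen.base[of _ "insert f (Cinf n)"] by blast
qed (use assms Cinf_dep Cinf_continuous in auto)

text \<open>The derivative of \<open>1 / f\<close> is a polynomial in \<open>1 / f\<close> and a
  derivative of \<open>f\<close>, so adjoining the inverse to \<open>Cinf n\<close> gives generators
  for \<open>Cinf_gen\<close>.\<close>

lemma Cinf_inverse:
  assumes f: "f \<in> Cinf n" and nz: "\<And>x. f x \<noteq> 0"
  shows "(\<lambda>x. inverse (f x)) \<in> Cinf n"
proof (rule Cinf_gen[OF gen.base[of _ "insert (\<lambda>x. inverse (f x)) (Cinf n)"]])
  let ?S = "insert (\<lambda>x. inverse (f x)) (Cinf n)"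
  fix g assume g: "g \<in> ?S"
  have "f x = f y" if "\<forall>i<n. x i = y i" for x y using Cinf_dep[OF f] that unfolding dep_def by blast
  then show "dep n g" using g Cinf_dep[of g n] unfolding dep_def by auto
  show "continuous_on UNIV g"
    using g Cinf_continuous[OF f] Cinf_continuous[of g n] nz by (auto intro: continuous_on_inverse)
  fix i assume i: "i < n"
  show "\<exists>f'\<in>gen ?S. \<forall>x. ((\<lambda>t. g (x(i := t))) has_real_derivative f' x) (at (x i))"
  proof (cases "g \<in> Cinf n")
    case True
    then show ?thesis using i by (intro bexI[of _ "pd i g"]) (auto intro: gen.base Cinf_has_pd)
  next
    case False
    with g have g: "g = (\<lambda>x. inverse (f x))" by blast
    let ?g' = "\<lambda>x. ((-1) * pd i f x) * (inverse (f x) * inverse (f x))"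
    have "?g' \<in> gen ?S"
      by (intro gen.mult gen.const) (use Cinf_pd[OF f i] in \<open>auto intro: gen.base\<close>)
    moreover have "((\<lambda>t. g (x(i := t))) has_real_derivative ?g' x) (at (x i))" for x
    proof -
      have "f (x(i := x i)) \<noteq> 0" using nz by blast
      from DERIV_inverse'[OF Cinf_has_pd[OF f i] this]
      show ?thesis unfolding g by (rule DERIV_cong) simp
    qed
    ultimately show ?thesis by (intro bexI allI)
  qed
qed simp

text \<open>All powers of \<open>1 / x\<close> are included so that derivatives are linear
  combinations of members of the family; \<open>flat 0\<close> is the usual flat function.\<close>

definition flat :: "nat \<Rightarrow> real \<Rightarrow> real" where
  "flat m x = (if x > 0 then (1 / x) ^ m * exp (- (1 / x)) else 0)"

lemma flat_tendsto_0: "(flat m \<longlongrightarrow> 0) (at 0)"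
proof -
  have "((\<lambda>x::real. (1 / x) ^ m / exp (1 / x)) \<longlongrightarrow> 0) (at_right 0)"
  proof -
    have "filterlim (\<lambda>x::real. 1 / x) at_top (at_right 0)"
      using filterlim_inverse_at_top_right by (simp add: inverse_eq_divide)
    from filterlim_compose[OF tendsto_power_div_exp_0 this] show ?thesis .
  qed
  moreover have "\<forall>\<^sub>F x in at_right 0. (1 / x) ^ m / exp (1 / x) = flat m x"
    using eventually_at_right_less[of 0] by (rule eventually_mono) (simp add: flat_def exp_minus divide_inverse)
  ultimately have "(flat m \<longlongrightarrow> 0) (at_right 0)" using Lim_transform_eventually by blast
  moreover have "(flat m \<longlongrightarrow> 0) (at_left 0)"
  proof (rule Lim_transform_eventually[OF tendsto_const])
    show "\<forall>\<^sub>F x in at_left 0. 0 = flat m x"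
      unfolding eventually_at by (rule exI[of _ 1]) (auto simp: flat_def)
  qed
  ultimately show ?thesis by (simp add: filterlim_split_at)
qed

lemma flat_deriv: "(flat m has_real_derivative - real m * flat (Suc m) x + flat (Suc (Suc m)) x) (at x)"
proof -
  consider "x > 0" | "x < 0" | "x = 0" by linarith
  then show ?thesis
  proof cases
    case 1
    have d: "((\<lambda>x. 1 / x) has_real_derivative - ((1 / x)\<^sup>2)) (at x)"
      using 1 by (auto intro!: derivative_eq_intros simp: power2_eq_square)
    have "((\<lambda>x. (1 / x) ^ m) has_real_derivative - real m * (1 / x) ^ Suc m) (at x)"
      by (rule DERIV_cong[OF DERIV_power[OF d]]) (cases m; simp add: power2_eq_square algebra_simps diff_divide_distrib add_divide_distrib)
    moreover have "((\<lambda>x. exp (- (1 / x))) has_real_derivative exp (- (1 / x)) * (1 / x)\<^sup>2) (at x)"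
      by (rule DERIV_cong[OF DERIV_chain2[OF DERIV_exp DERIV_minus[OF d]]]) simp
    ultimately have "((\<lambda>x. (1 / x) ^ m * exp (- (1 / x))) has_real_derivative
        - real m * flat (Suc m) x + flat (Suc (Suc m)) x) (at x)"
      by (rule DERIV_cong[OF DERIV_mult']) (use 1 in \<open>simp add: flat_def power2_eq_square\<close>)
    moreover have "\<forall>\<^sub>F y in nhds x. flat m y = (1 / y) ^ m * exp (- (1 / y))"
      using eventually_nhds_in_open[of "{0<..}" x] 1 by (auto elim!: eventually_mono simp: flat_def)
    ultimately show ?thesis by (rule iffD2[OF DERIV_cong_ev[OF refl _ refl], rotated])
  next
    case 2
    have "((\<lambda>_. 0) has_real_derivative - real m * flat (Suc m) x + flat (Suc (Suc m)) x) (at x)"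
      using 2 by (simp add: flat_def)
    moreover have "\<forall>\<^sub>F y in nhds x. flat m y = 0"
      using eventually_nhds_in_open[of "{..<0}" x] 2 by (auto elim!: eventually_mono simp: flat_def)
    ultimately show ?thesis by (rule iffD2[OF DERIV_cong_ev[OF refl _ refl], rotated])
  next
    case 3
    \<comment> \<open>At \<open>0\<close> the difference quotient is literally the next member of
      the family, whose limit is \<open>0\<close>.\<close>
    have "(\<lambda>y. (flat m y - flat m 0) / (y - 0)) = flat (Suc m)" by (auto simp: flat_def)
    moreover have "- real m * flat (Suc m) 0 + flat (Suc (Suc m)) 0 = 0" by (simp add: flat_def)
    ultimately show ?thesis unfolding 3 has_field_derivative_iff using flat_tendsto_0 by metis
  qed
qed

lemma flat_Cinf: "(\<lambda>x. flat m (x 0)) \<in> Cinf 1"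
proof (rule Cinf_gen[OF gen.base[of _ "{(\<lambda>x. flat m (x 0)) |m. True}"]])
  let ?S = "{(\<lambda>x::pt. flat m (x 0)) |m. True}"
  fix f :: "pt \<Rightarrow> real" assume "f \<in> ?S"
  then obtain m where f: "f = (\<lambda>x. flat m (x 0))" by blast
  show "dep 1 f" by (auto simp: f dep_def)
  have "continuous_on UNIV (flat m)"
    by (intro continuous_at_imp_continuous_on ballI DERIV_isCont[OF flat_deriv])
  then show "continuous_on UNIV f" unfolding f
    by (rule continuous_on_compose2[OF _ continuous_coord]) simp
  fix i :: nat assume "i < 1"
  then have i: "i = 0" by simp
  have "(\<lambda>x. (- real m) * flat (Suc m) (x 0) + flat (Suc (Suc m)) (x 0)) \<in> gen ?S"
    by (intro gen.add gen.mult gen.const; rule gen.base; blast)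
  moreover have "((\<lambda>t. f (x(i := t))) has_real_derivative (- real m) * flat (Suc m) (x 0) + flat (Suc (Suc m)) (x 0)) (at (x i))" for x
    using flat_deriv[of m "x 0"] by (simp add: f i)
  ultimately show "\<exists>f'\<in>gen ?S. \<forall>x. ((\<lambda>t. f (x(i := t))) has_real_derivative f' x) (at (x i))"
    by (intro bexI allI)
qed blast

text \<open>The usual smooth transition from \<open>0\<close> to \<open>1\<close>; the denominator
  is positive because \<open>x\<close> or \<open>1 - x\<close> is.\<close>

definition smooth_step :: "real \<Rightarrow> real" where
  "smooth_step x = flat 0 x * inverse (flat 0 x + flat 0 (1 - x))"

lemma smooth_step:
  shows smooth_step_0: "x \<le> 0 \<Longrightarrow> smooth_step x = 0"
    and smooth_step_1: "x \<ge> 1 \<Longrightarrow> smooth_step x = 1"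
    and smooth_step_nonneg: "smooth_step x \<ge> 0"
  by (auto simp: smooth_step_def flat_def)

lemma Cinf_smooth_step:
  assumes "f \<in> Cinf n"
  shows "(\<lambda>x. smooth_step (f x)) \<in> Cinf n"
proof -
  have c: "(\<lambda>x. flat 0 (h x)) \<in> Cinf n" if "h \<in> Cinf n" for h
    using Cinf_compose[OF flat_Cinf, of "\<lambda>_. h" n] that by simp
  have nz: "flat 0 y + flat 0 (1 - y) \<noteq> 0" for y
  proof -
    have "flat 0 y \<ge> 0" "flat 0 (1 - y) \<ge> 0" "flat 0 y > 0 \<or> flat 0 (1 - y) > 0"
      by (auto simp: flat_def)
    then show ?thesis by linarith
  qed
  have "(\<lambda>x. flat 0 (f x) + flat 0 (1 - f x)) \<in> Cinf n"
    by (intro Cinf_add c assms Cinf_diff Cinf_const)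
  then have "(\<lambda>x. inverse (flat 0 (f x) + flat 0 (1 - f x))) \<in> Cinf n"
    using nz by (rule Cinf_inverse)
  then show ?thesis unfolding smooth_step_def by (intro Cinf_mult c assms)
qed

text \<open>Squares replace the absolute value. Beyond \<open>N + 1\<close> the argument of the step
  is at least \<open>(N + 1)^2 - N^2 = 2 * N + 1\<close>, hence at least \<open>1\<close>.\<close>

lemma cutoff:
  assumes "N \<ge> 0"
  obtains \<kappa> where "\<And>f n. f \<in> Cinf n \<Longrightarrow> (\<lambda>x. \<kappa> (f x)) \<in> Cinf n"
    "\<And>y. \<bar>y\<bar> \<le> N \<Longrightarrow> \<kappa> y = (1::real)" "\<And>y. \<bar>y\<bar> > N + 1 \<Longrightarrow> \<kappa> y = 0"
proof
  let ?\<kappa> = "\<lambda>y. 1 - smooth_step (y\<^sup>2 - N\<^sup>2)"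
  show "(\<lambda>x. ?\<kappa> (f x)) \<in> Cinf n" if "f \<in> Cinf n" for f n
    using that by (intro Cinf_diff Cinf_smooth_step Cinf_const Cinf_power)
  show "?\<kappa> y = 1" if "\<bar>y\<bar> \<le> N" for y
  proof -
    have "\<bar>y\<bar>\<^sup>2 \<le> N\<^sup>2" using that by (rule power_mono) simp
    then show ?thesis by (simp add: smooth_step_0)
  qed
  show "?\<kappa> y = 0" if "\<bar>y\<bar> > N + 1" for y
  proof -
    have "(N + 1)\<^sup>2 \<le> \<bar>y\<bar>\<^sup>2" using that assms by (intro power_mono) auto
    then have "1 \<le> y\<^sup>2 - N\<^sup>2" using assms by (simp add: power2_sum)
    then show ?thesis by (simp add: smooth_step_1)
  qed
qed

text \<open>Members of a cover are embeddings of all of \<open>R^k\<close>; the arctangent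
  compresses each coordinate, so that the image is a bounded open cube around
  \<open>q\<close>.\<close>

definition box_chart :: "pt \<Rightarrow> pt \<Rightarrow> pt" where
  "box_chart q x = (\<lambda>i. q i + 2 / pi * arctan (x i))"

lemma box_chart_bounds: "\<bar>box_chart q x i - q i\<bar> < 1"
proof -
  have "\<bar>arctan (x i)\<bar> < pi / 2" using arctan_bounded[of "x i"] by auto
  then show ?thesis by (simp add: box_chart_def abs_mult field_simps)
qed

lemma half_pi_bounds:
  assumes "\<bar>u\<bar> < 1"
  shows "- (pi / 2) < pi / 2 * u" "pi / 2 * u < pi / 2"
proof -
  have "pi / 2 * (-1) < pi / 2 * u" "pi / 2 * u < pi / 2 * 1"
    by (rule mult_strict_left_mono; use assms in simp)+
  then show "- (pi / 2) < pi / 2 * u" "pi / 2 * u < pi / 2" by simp_all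
qed

lemma emb_image_box_chart: "emb_image k (box_chart q) = {y. \<forall>i<k. \<bar>y i - q i\<bar> < 1}"
proof (intro equalityI subsetI)
  fix y assume "y \<in> {y. \<forall>i<k. \<bar>y i - q i\<bar> < 1}"
  then have y: "\<bar>y i - q i\<bar> < 1" if "i < k" for i using that by blast
  have "y i = box_chart q (\<lambda>i. tan (pi / 2 * (y i - q i))) i" if "i < k" for i
  proof -
    have "arctan (tan (pi / 2 * (y i - q i))) = pi / 2 * (y i - q i)"
      by (rule arctan_tan[OF half_pi_bounds[OF y[OF that]]])
    then show ?thesis unfolding box_chart_def by (simp only:) (simp add: field_simps)
  qed
  then show "y \<in> emb_image k (box_chart q)" unfolding emb_image_def by blast
qed (use box_chart_bounds in \<open>auto simp: emb_image_def\<close>)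

lemma open_box: "open {y::pt. \<forall>i<k. \<bar>y i - q i\<bar> < 1}"
proof -
  have "open (\<Inter>i<k. {y::pt. \<bar>y i - q i\<bar> < 1})"
  proof (intro open_INT ballI)
    show "open {y::pt. \<bar>y i - q i\<bar> < 1}" for i
      by (intro open_Collect_less continuous_on_rabs continuous_on_diff continuous_coord continuous_on_const)
  qed simp
  moreover have "(\<Inter>i<k. {y::pt. \<bar>y i - q i\<bar> < 1}) = {y. \<forall>i<k. \<bar>y i - q i\<bar> < 1}" by auto
  ultimately show ?thesis by simp
qed

text \<open>The inverse is a scaled tangent in each coordinate. Its derivative is a multiple of
  \<open>1 + tan^2\<close>, a polynomial in the function itself, and the cosine has no zero on the
  cube.\<close>

lemma open_embedding_box_chart: "open_embedding k (box_chart q)"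
  unfolding open_embedding_def emb_image_box_chart
proof (intro conjI allI impI exI[of _ "\<lambda>y i. tan (pi / 2 * (y i - q i))"] open_box)
  fix i assume i: "i < k"
  have "(\<lambda>x. arctan (x i)) \<in> Cinf k"
  proof (rule Cinf_from_pd)
    show "dep k (\<lambda>x. arctan (x i))" using i by (auto simp: dep_def)
    show "continuous_on UNIV (\<lambda>x::pt. arctan (x i))" by (intro continuous_on_arctan continuous_coord)
    fix j
    have nz: "1 + (x i)\<^sup>2 \<noteq> 0" for x :: pt by (smt (verit) zero_le_power2)
    have "(\<lambda>x. if j = i then inverse (1 + (x i)\<^sup>2) else 0) \<in> Cinf k"
      using i nz by (cases "j = i") (auto intro!: Cinf_inverse Cinf_add Cinf_power Cinf_coord)
    moreover have "((\<lambda>t. arctan ((x(j := t)) i)) has_real_derivative (if j = i then inverse (1 + (x i)\<^sup>2) else 0)) (at (x j))" for x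
      using DERIV_arctan[of "x i"] by auto
    ultimately show "\<exists>f'\<in>Cinf k. \<forall>x. ((\<lambda>t. arctan ((x(j := t)) i)) has_real_derivative f' x) (at (x j))"
      by (intro bexI allI)
  qed
  then show "(\<lambda>x. box_chart q x i) \<in> Cinf k"
    unfolding box_chart_def by (intro Cinf_add Cinf_const Cinf_mult)
  let ?U = "{y::pt. \<forall>i<k. \<bar>y i - q i\<bar> < 1}" and ?S = "{(\<lambda>y::pt. tan (pi / 2 * (y i - q i))) |i. i < k}"
  show "smooth_on k ?U (\<lambda>y. tan (pi / 2 * (y i - q i)))"
  proof (rule smooth_gen[OF open_box gen.base[of _ ?S]])
    show "(\<lambda>y. tan (pi / 2 * (y i - q i))) \<in> ?S" using i by blast
    fix f assume "f \<in> ?S"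
    then obtain i where i: "i < k" and f: "f = (\<lambda>y. tan (pi / 2 * (y i - q i)))" by blast
    show "f x = f y" if "\<And>i. i < k \<Longrightarrow> x i = y i" for x y using that[OF i] by (simp add: f)
    have nz: "cos (pi / 2 * (y i - q i)) \<noteq> 0" if "y \<in> ?U" for y
    proof -
      have "\<bar>y i - q i\<bar> < 1" using that i by blast
      then show ?thesis using cos_gt_zero_pi[OF half_pi_bounds] by fastforce
    qed
    show "continuous_on ?U f" unfolding f
    proof (rule continuous_on_compose2[of "{x. cos x \<noteq> 0}" tan])
      show "continuous_on {x::real. cos x \<noteq> 0} tan"
        by (intro continuous_at_imp_continuous_on ballI isCont_tan) simp
      have "continuous_on UNIV (\<lambda>y::pt. pi / 2 * (y i - q i))"
        by (intro continuous_on_mult continuous_on_diff continuous_on_const continuous_coord)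
      then show "continuous_on ?U (\<lambda>y. pi / 2 * (y i - q i))" by (rule continuous_on_subset) simp
    qed (use nz in blast)
    fix j
    have "(\<lambda>x. (if j = i then pi / 2 else 0) * (1 + f x * f x)) \<in> gen ?S"
      by (intro gen.mult gen.add gen.const; rule gen.base; use i f in blast)
    moreover have "((\<lambda>t. f (x(j := t))) has_real_derivative (if j = i then pi / 2 else 0) * (1 + f x * f x)) (at (x j))"
      if "x \<in> ?U" for x
    proof (cases "j = i")
      case True
      have "((\<lambda>t. tan (pi / 2 * (t - q i))) has_real_derivative inverse ((cos (pi / 2 * (x i - q i)))\<^sup>2) * (pi / 2)) (at (x i))"
        using nz[OF that] by (auto intro!: derivative_eq_intros)
      moreover have "inverse ((cos (pi / 2 * (x i - q i)))\<^sup>2) = 1 + f x * f x"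
        using tan_sec[OF nz[OF that]] by (simp add: f power2_eq_square)
      ultimately show ?thesis using True by (simp add: f mult.commute)
    qed (simp add: f)
    ultimately show "\<exists>f'\<in>gen ?S. \<forall>x\<in>?U. ((\<lambda>t. f (x(j := t))) has_real_derivative f' x) (at (x j))"
      by (intro bexI ballI)
  qed
  show "tan (pi / 2 * (box_chart q x i - q i)) = x i" for x
    by (simp add: box_chart_def tan_arctan)
qed

text \<open>A locally finite sum of smooth steps in the squared norm \<open>r s\<close>, the
  \<open>m\<close>-th step being complete at \<open>r s = m\<close>. Its summands are nonnegative,
  so a single one may serve as lower bound, whatever the growth of \<open>B\<close>.\<close>

lemma smooth_majorant:
  fixes B :: "nat \<Rightarrow> real"
  obtains G where "G \<in> Cinf n" "\<And>s. \<exists>m. (\<forall>i<n. \<bar>s i\<bar> \<le> real m) \<and> G s \<ge> (B m)\<^sup>2"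
proof
  define r where "r s = (\<Sum>i<n. (s i)\<^sup>2)" for s :: pt
  define T where "T m s = (B (Suc m))\<^sup>2 * smooth_step (r s - real m + 1)" for m s
  define G where "G s = (\<Sum>m<nat \<lceil>r s\<rceil> + 1. T m s)" for s
  have r: "r \<in> Cinf n" unfolding r_def by (intro Cinf_sum Cinf_power Cinf_coord) simp
  have r0: "r s \<ge> 0" for s by (simp add: r_def sum_nonneg)
  have T: "T m \<in> Cinf n" for m
    unfolding T_def using r by (intro Cinf_mult Cinf_smooth_step Cinf_add Cinf_diff Cinf_const)
  have T0: "T m s \<ge> 0" for m s by (simp add: T_def smooth_step_nonneg)
  have Tz: "T m s = 0" if "real m \<ge> r s + 1" for m s using that by (simp add: T_def smooth_step_0)
  have GM: "G s = (\<Sum>m<M + 1. T m s)" if "r s < real M" for M s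
    unfolding G_def
  proof (rule sum.mono_neutral_left)
    have "nat \<lceil>r s\<rceil> \<le> M" using that by linarith
    then show "{..<nat \<lceil>r s\<rceil> + 1} \<subseteq> {..<M + 1}" by auto
    show "\<forall>m\<in>{..<M + 1} - {..<nat \<lceil>r s\<rceil> + 1}. T m s = 0"
    proof
      fix m assume "m \<in> {..<M + 1} - {..<nat \<lceil>r s\<rceil> + 1}"
      then have "nat \<lceil>r s\<rceil> + 1 \<le> m" by auto
      then have "r s + 1 \<le> real m" by linarith
      then show "T m s = 0" by (rule Tz)
    qed
  qed simp
  show "G \<in> Cinf n"
  proof (rule Cinf_local)
    show "dep n G" unfolding dep_def
    proof (intro allI impI)
      fix x y :: pt assume "\<forall>i<n. x i = y i"
      then have "r x = r y" by (simp add: r_def)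
      then show "G x = G y" by (simp add: G_def T_def)
    qed
    fix s
    obtain M :: nat where M: "r s < real M" using reals_Archimedean2 by blast
    have "open {s. r s < real M}" using Cinf_continuous[OF r] by (intro open_Collect_less continuous_on_const)
    moreover have "(\<lambda>s. \<Sum>m<M + 1. T m s) \<in> Cinf n" by (intro Cinf_sum T)
    ultimately show "\<exists>U h. open U \<and> s \<in> U \<and> h \<in> Cinf n \<and> (\<forall>y\<in>U. G y = h y)"
      using M GM by (intro exI[of _ "{s. r s < real M}"] exI[of _ "\<lambda>s. \<Sum>m<M + 1. T m s"]) auto
  qed
  fix s
  \<comment> \<open>At the integer part \<open>m\<close> of \<open>r s\<close> the summand
    \<open>T m\<close> has its full value; it contains \<open>B (Suc m)\<close> because the
    coordinates of \<open>s\<close> are bounded by \<open>Suc m\<close>.\<close>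
  define m where "m = nat \<lfloor>r s\<rfloor>"
  have m: "real m \<le> r s" "r s < real m + 1" using r0[of s] unfolding m_def by linarith+
  have "\<bar>s i\<bar> \<le> real (Suc m)" if "i < n" for i
  proof -
    have "(s i)\<^sup>2 \<le> r s" unfolding r_def using that by (intro member_le_sum) auto
    also have "\<dots> \<le> (real (Suc m))\<^sup>2"
      using m by (simp add: power2_eq_square algebra_simps) (smt (verit) mult_nonneg_nonneg of_nat_0_le_iff)
    finally show ?thesis using abs_le_square_iff[of "s i" "real (Suc m)"] by simp
  qed
  moreover have "(B (Suc m))\<^sup>2 \<le> G s"
  proof -
    have "(B (Suc m))\<^sup>2 = T m s" using m by (simp add: T_def smooth_step_1)
    also have "\<dots> \<le> (\<Sum>m<nat \<lceil>r s\<rceil> + 1. T m s)"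
      using m T0 by (intro member_le_sum) (auto, linarith)
    finally show ?thesis by (simp add: G_def)
  qed
  ultimately show "\<exists>m. (\<forall>i<n. \<bar>s i\<bar> \<le> real m) \<and> G s \<ge> (B m)\<^sup>2" by blast
qed

section \<open>The map into the exponential\<close>

lemma subspace_Cinf_line: "subspace Cinf_line"
proof (rule subspaceI)
  have z: "(\<lambda>_. 0) \<in> Cinf_line" by (rule Cinf_lineI(1)[of "\<lambda>_ _. 0"]) auto
  then show "0 \<in> Cinf_line" by (simp add: zero_fun_def)
  show "x + y \<in> Cinf_line" if "x \<in> Cinf_line" "y \<in> Cinf_line" for x y
    using Cinf_line_lincomb(1)[OF that, of 1 1] by (simp add: plus_fun_def)
  show "c *\<^sub>R x \<in> Cinf_line" if "x \<in> Cinf_line" for x c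
    using Cinf_line_lincomb(1)[OF that that, of c 0] by (simp add: scaleR_fun_def)
qed

lemma subspace_test_funs: "subspace test_funs"
proof (rule subspaceI)
  have "(\<lambda>_. 0) \<in> Cinf_line" by (rule Cinf_lineI(1)[of "\<lambda>_ _. 0"]) auto
  then show "0 \<in> test_funs" by (simp add: zero_fun_def test_funs_iff)
  show "x + y \<in> test_funs" if "x \<in> test_funs" "y \<in> test_funs" for x y
    using test_funs_lincomb[OF that, of 1 1] by (simp add: plus_fun_def)
  show "c *\<^sub>R x \<in> test_funs" if "x \<in> test_funs" for x c
    using test_funs_lincomb[OF that that, of c 0] by (simp add: scaleR_fun_def)
qed

section \<open>Classes of vector-valued smooth maps\<close>

lemma dual_diff:
  assumes X: "subspace (topspace X)" and \<phi>: "\<phi> \<in> dual X" and x: "x \<in> topspace X" "y \<in> topspace X"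
  shows "\<phi> (x - y) = \<phi> x - \<phi> y"
proof -
  have "\<phi> (x - y) + \<phi> y = \<phi> (x - y + y)"
    using dual_add[OF \<phi> subspace_diff[OF X x] x(2)] by simp
  then show ?thesis by simp
qed

lemma Cinf_into_diff:
  assumes X: "subspace (topspace X)" and f: "f \<in> Cinf_into n X" and g: "g \<in> Cinf_into n X"
  shows "(\<lambda>s. f s - g s) \<in> Cinf_into n X"
  unfolding Cinf_into_def
proof (intro CollectI conjI allI impI ballI)
  show "range (\<lambda>s. f s - g s) \<subseteq> topspace X"
    using Cinf_intoD(1)[OF f] Cinf_intoD(1)[OF g] subspace_diff[OF X] by blast
  show "f x - g x = f y - g y" if "\<forall>i<n. x i = y i" for x y
    using Cinf_intoD(2)[OF f] Cinf_intoD(2)[OF g] that unfolding dep_def by metis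
  show "(\<lambda>s. \<phi> (f s - g s)) \<in> Cinf n" if "\<phi> \<in> dual X" for \<phi>
    using Cinf_diff[OF Cinf_intoD(3)[OF f that] Cinf_intoD(3)[OF g that]]
    by (simp add: dual_diff[OF X that Cinf_intoD(1)[OF f] Cinf_intoD(1)[OF g]])
qed

lemma ideal_intoD:
  assumes "g \<in> ideal_into A X"
  shows "g \<in> Cinf_into (sdim A) X" "\<phi> \<in> dual X \<Longrightarrow> (\<lambda>s. \<phi> (g s)) \<in> sideal A"
  using assms unfolding ideal_into_def by blast+

lemma ideal_into_diff:
  assumes A: "A \<in> site_obj" and X: "subspace (topspace X)" and f: "f \<in> ideal_into A X" and g: "g \<in> ideal_into A X"
  shows "(\<lambda>s. f s - g s) \<in> ideal_into A X"
  unfolding ideal_into_def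
proof (intro CollectI conjI ballI)
  note f' = ideal_intoD(1)[OF f] and g' = ideal_intoD(1)[OF g]
  show "(\<lambda>s. f s - g s) \<in> Cinf_into (sdim A) X" by (rule Cinf_into_diff[OF X f' g'])
  show "(\<lambda>s. \<phi> (f s - g s)) \<in> sideal A" if "\<phi> \<in> dual X" for \<phi>
    using ideal_diff[OF site_ideal[OF A] ideal_intoD(2)[OF f that] ideal_intoD(2)[OF g that]]
    by (simp add: dual_diff[OF X that Cinf_intoD(1)[OF f'] Cinf_intoD(1)[OF g']])
qed

lemma Cinf_into_const:
  assumes "c \<in> topspace X"
  shows "(\<lambda>_. c) \<in> Cinf_into n X"
  using assms unfolding Cinf_into_def by auto

lemma ideal_into_zero:
  assumes A: "A \<in> site_obj" and X: "subspace (topspace X)"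
  shows "(\<lambda>_. 0) \<in> ideal_into A X"
proof -
  have "0 \<in> topspace X" by (rule subspace_0[OF X])
  moreover have "(\<lambda>s. \<phi> 0) \<in> sideal A" if "\<phi> \<in> dual X" for \<phi>
    using dual_diff[OF X that \<open>0 \<in> _\<close> \<open>0 \<in> _\<close>] ideal_zero[OF site_ideal[OF A]] by simp
  ultimately show ?thesis
    unfolding ideal_into_def using Cinf_into_const by blast
qed

lemma ideal_into_minus:
  assumes A: "A \<in> site_obj" and X: "subspace (topspace X)" and f: "(\<lambda>s. f s - g s) \<in> ideal_into A X"
  shows "(\<lambda>s. g s - f s) \<in> ideal_into A X"
  using ideal_into_diff[OF A X ideal_into_zero[OF A X] f] by simp

lemma ideal_into_trans:
  assumes A: "A \<in> site_obj" and X: "subspace (topspace X)"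
    and f: "(\<lambda>s. f s - g s) \<in> ideal_into A X" and g: "(\<lambda>s. g s - h s) \<in> ideal_into A X"
  shows "(\<lambda>s. f s - h s) \<in> ideal_into A X"
  using ideal_into_diff[OF A X f ideal_into_minus[OF A X g]] by simp

lemma cls_into_eqI:
  assumes A: "A \<in> site_obj" and X: "subspace (topspace X)" and fg: "(\<lambda>s. f s - g s) \<in> ideal_into A X"
  shows "cls_into A X f = cls_into A X g"
proof -
  have "(\<lambda>s. h s - f s) \<in> ideal_into A X \<longleftrightarrow> (\<lambda>s. h s - g s) \<in> ideal_into A X" for h
    using ideal_into_trans[OF A X _ fg, of h] ideal_into_trans[OF A X _ ideal_into_minus[OF A X fg], of h] by blast
  then show ?thesis unfolding cls_into_def by auto
qed

lemma rep_cls_into: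
  assumes A: "A \<in> site_obj" and X: "subspace (topspace X)" and g: "g \<in> Cinf_into (sdim A) X"
  shows "rep (cls_into A X g) \<in> Cinf_into (sdim A) X"
    "(\<lambda>s. rep (cls_into A X g) s - g s) \<in> ideal_into A X"
proof -
  have "g \<in> cls_into A X g" using g ideal_into_zero[OF A X] by (simp add: cls_into_def)
  then have "rep (cls_into A X g) \<in> cls_into A X g"
    unfolding rep_def by (rule someI[where P = "\<lambda>h. h \<in> cls_into A X g"])
  then show "rep (cls_into A X g) \<in> Cinf_into (sdim A) X"
    "(\<lambda>s. rep (cls_into A X g) s - g s) \<in> ideal_into A X" by (auto simp: cls_into_def)
qed

lemma h_sec:
  assumes A: "A \<in> site_obj" and X: "subspace (topspace X)" and c: "c \<in> sec (h_obj X) A"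
  shows "rep c \<in> Cinf_into (sdim A) X" "cls_into A X (rep c) = c"
proof -
  obtain g where g: "c = cls_into A X g" "g \<in> Cinf_into (sdim A) X" using c by (auto simp: h_obj_def)
  show "rep c \<in> Cinf_into (sdim A) X" "cls_into A X (rep c) = c"
    unfolding g(1) using rep_cls_into[OF A X g(2)] cls_into_eqI[OF A X] by blast+
qed

lemma Cinf_into_compose:
  assumes g: "g \<in> Cinf_into n X" and p: "\<And>i. i < n \<Longrightarrow> p i \<in> Cinf m"
  shows "(\<lambda>s. g (\<lambda>i. p i s)) \<in> Cinf_into m X"
  unfolding Cinf_into_def
proof (intro CollectI conjI allI impI ballI)
  show "range (\<lambda>s. g (\<lambda>i. p i s)) \<subseteq> topspace X" using Cinf_intoD(1)[OF g] by blast
  show "g (\<lambda>i. p i x) = g (\<lambda>i. p i y)" if "\<forall>i<m. x i = y i" for x y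
  proof (rule depD[OF Cinf_intoD(2)[OF g]])
    show "p i x = p i y" if "i < n" for i
      by (rule depD[OF Cinf_dep[OF p[OF that]]]) (use \<open>\<forall>i<m. _\<close> in blast)
  qed
  show "(\<lambda>s. \<phi> (g (\<lambda>i. p i s))) \<in> Cinf m" if "\<phi> \<in> dual X" for \<phi>
    by (rule Cinf_compose[OF Cinf_intoD(3)[OF g that] p])
qed

lemma ideal_into_compose:
  assumes A: "A \<in> site_obj" and B: "B \<in> site_obj" and u: "u \<in> Hom A B" and p: "lifts A B u p"
    and g: "g \<in> ideal_into A X"
  shows "(\<lambda>s. g (\<lambda>i. p i s)) \<in> ideal_into B X"
  unfolding ideal_into_def
proof (intro CollectI conjI ballI)
  show "(\<lambda>s. g (\<lambda>i. p i s)) \<in> Cinf_into (sdim B) X"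
    by (rule Cinf_into_compose[OF ideal_intoD(1)[OF g] lifts_Cinf[OF p]])
  show "(\<lambda>s. \<phi> (g (\<lambda>i. p i s))) \<in> sideal B" if "\<phi> \<in> dual X" for \<phi>
    by (rule lifts_sideal[OF A B u p ideal_intoD(2)[OF g that]])
qed

lemma ideal_into_cong:
  assumes B: "B \<in> site_obj" and X: "subspace (topspace X)"
    and g: "g \<in> Cinf_into n X" and p: "\<And>i. i < n \<Longrightarrow> p i \<in> Cinf (sdim B)" and q: "\<And>i. i < n \<Longrightarrow> q i \<in> Cinf (sdim B)"
    and pq: "\<And>i. i < n \<Longrightarrow> cls B (p i) = cls B (q i)"
  shows "(\<lambda>s. g (\<lambda>i. p i s) - g (\<lambda>i. q i s)) \<in> ideal_into B X"
  unfolding ideal_into_def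
proof (intro CollectI conjI ballI)
  show "(\<lambda>s. g (\<lambda>i. p i s) - g (\<lambda>i. q i s)) \<in> Cinf_into (sdim B) X"
    by (intro Cinf_into_diff[OF X] Cinf_into_compose[OF g] p q)
  show "(\<lambda>s. \<phi> (g (\<lambda>i. p i s) - g (\<lambda>i. q i s))) \<in> sideal B" if \<phi>: "\<phi> \<in> dual X" for \<phi>
    using compose_cong[OF B Cinf_intoD(3)[OF g \<phi>], of p q] p q pq
    by (simp add: cls_eq[OF B] dual_diff[OF X \<phi> Cinf_intoD(1)[OF g] Cinf_intoD(1)[OF g]])
qed

section \<open>Evaluation of families at elements of the line\<close>

lemma eval_extend:
  assumes "dep n g"
  shows "g (\<lambda>i. if i < n then p i else y) = g p"
  using assms by (rule depD) simp

lemma Cinf_extend: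
  assumes "\<And>i. i < n \<Longrightarrow> p i \<in> Cinf m" "\<xi> \<in> Cinf m"
  shows "(\<lambda>s. if i < n then p i s else \<xi> s) \<in> Cinf m"
  using assms by (cases "i < n") auto

lemma eval_Cinf:
  assumes g: "g \<in> Cinf_into n smooth_space" and p: "\<And>i. i < n \<Longrightarrow> p i \<in> Cinf m" and \<xi>: "\<xi> \<in> Cinf m"
  shows "(\<lambda>s. g (\<lambda>i. p i s) (\<xi> s)) \<in> Cinf m"
proof -
  have "(\<lambda>s. if i < n then p i s else \<xi> s) \<in> Cinf m" for i using p \<xi> by (rule Cinf_extend)
  from Cinf_compose[OF exponential_law[OF g], of "\<lambda>i s. if i < n then p i s else \<xi> s", OF this]
  show ?thesis by (simp add: eval_extend[OF Cinf_intoD(2)[OF g]])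
qed

lemma eval_cong:
  assumes B: "B \<in> site_obj" and g: "g \<in> Cinf_into n smooth_space"
    and p: "\<And>i. i < n \<Longrightarrow> p i \<in> Cinf (sdim B)" and q: "\<And>i. i < n \<Longrightarrow> q i \<in> Cinf (sdim B)"
    and \<xi>: "\<xi> \<in> Cinf (sdim B)" and \<eta>: "\<eta> \<in> Cinf (sdim B)"
    and pq: "\<And>i. i < n \<Longrightarrow> cls B (p i) = cls B (q i)" and \<xi>\<eta>: "cls B \<xi> = cls B \<eta>"
  shows "cls B (\<lambda>s. g (\<lambda>i. p i s) (\<xi> s)) = cls B (\<lambda>s. g (\<lambda>i. q i s) (\<eta> s))"
proof -
  have "cls B (\<lambda>s. if i < n then p i s else \<xi> s) = cls B (\<lambda>s. if i < n then q i s else \<eta> s)" for i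
    using pq \<xi>\<eta> by (cases "i < n") auto
  moreover have "(\<lambda>s. if i < n then p i s else \<xi> s) \<in> Cinf (sdim B)" for i using p \<xi> by (rule Cinf_extend)
  moreover have "(\<lambda>s. if i < n then q i s else \<eta> s) \<in> Cinf (sdim B)" for i using q \<eta> by (rule Cinf_extend)
  ultimately have "cls B (\<lambda>s. (\<lambda>s. g s (s n)) (\<lambda>i. if i < n then p i s else \<xi> s)) =
      cls B (\<lambda>s. (\<lambda>s. g s (s n)) (\<lambda>i. if i < n then q i s else \<eta> s))"
    by (intro compose_cong[OF B exponential_law[OF g],
          of "\<lambda>i s. if i < n then p i s else \<xi> s" "\<lambda>i s. if i < n then q i s else \<eta> s"])
  then
  show ?thesis by (simp add: eval_extend[OF Cinf_intoD(2)[OF g]])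
qed

text \<open>The ideal with \<open>Suc (kdim A)\<close> belongs to the stage \<open>A \<times> R\<close>, whose last coordinate is the
  generic element of the line.\<close>

lemma generic_substitution:
  assumes A: "A \<in> site_obj" and C: "C \<in> site_obj" and I: "ideal I (Cinf_ring (ldim A))"
    and AI: "sideal A = pullback_ideal (ldim A) (kdim A) I"
    and v: "v \<in> Hom A C" and p: "lifts A C v p" and \<xi>: "\<xi> \<in> Cinf (sdim C)"
    and f: "f \<in> pullback_ideal (ldim A) (Suc (kdim A)) I"
  shows "(\<lambda>s. f (\<lambda>i. if i < sdim A then p i s else \<xi> s)) \<in> sideal C"
  using f unfolding pullback_ideal_fsums
proof (induction rule: fsums_induct)
  note idC = site_ideal[OF C]
  let ?q = "\<lambda>i s. if i < sdim A then p i s else \<xi> s"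
  case zero
  show ?case by (rule ideal_zero[OF idC])
next
  note idC = site_ideal[OF C]
  let ?q = "\<lambda>i s. if i < sdim A then p i s else \<xi> s"
  case (step f h k)
  have q: "?q i \<in> Cinf (sdim C)" for i by (rule Cinf_extend[OF lifts_Cinf[OF p] \<xi>])
  have "(\<lambda>x. h x * 1) \<in> fsums I (Cinf (sdim A))" using step.hyps by (intro fsums_single) auto
  then have "h \<in> sideal A" by (simp add: AI pullback_ideal_fsums)
  then have "(\<lambda>s. h (\<lambda>i. p i s)) \<in> sideal C" by (rule lifts_sideal[OF A C v p])
  moreover have "h (\<lambda>i. ?q i s) = h (\<lambda>i. p i s)" for s
    by (rule depD[OF Cinf_dep[OF ideal_Cinf[OF I step.hyps(2)]]]) simp
  moreover have "(\<lambda>s. k (\<lambda>i. ?q i s)) \<in> Cinf (sdim C)" using step.hyps(3) q by (rule Cinf_compose)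
  ultimately have "(\<lambda>s. h (\<lambda>i. ?q i s) * k (\<lambda>i. ?q i s)) \<in> sideal C"
    using ideal_mult[OF idC] by simp
  from ideal_add[OF idC step.IH this] show ?case .
qed

text \<open>The fibre over \<open>(t, y)\<close> of the uncurried map is the fibre over
  \<open>t\<close> of the evaluation at \<open>y\<close>, so evaluations at constants decide the
  fibrewise criterion.\<close>

lemma pointwise_generic:
  assumes I: "weil_ideal l I" and g: "g \<in> Cinf_into (l + k) smooth_space"
    and pt: "\<And>y. (\<lambda>s. g s y) \<in> pullback_ideal l k I"
  shows "(\<lambda>s. g s (s (l + k))) \<in> pullback_ideal l (Suc k) I"
  unfolding pullback_ideal_fibrewise[OF I]
proof (intro conjI allI)
  show "(\<lambda>s. g s (s (l + k))) \<in> Cinf (l + Suc k)" using exponential_law[OF g] by simp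
  fix t
  have "fibre l (\<lambda>s. g s (s (l + k))) t = fibre l (\<lambda>s. g s (t (l + k))) t" by (simp add: fibre_def)
  then show "fibre l (\<lambda>s. g s (s (l + k))) t \<in> I" using pt pullback_ideal_fibrewise[OF I] by auto
qed

text \<open>Point evaluations are functionals of \<open>smooth_space\<close>, so
  \<open>pointwise_generic\<close> applies, and \<xi> is then substituted for the generic element.
  This makes \<open>h_eval\<close> independent of the representative of the family.\<close>

lemma eval_ideal:
  assumes B: "B \<in> site_obj" and g: "g \<in> ideal_into B smooth_space" and \<xi>: "\<xi> \<in> Cinf (sdim B)"
  shows "(\<lambda>s. g s (\<xi> s)) \<in> sideal B"
proof -
  obtain I where I: "weil_ideal (ldim B) I" "sideal B = pullback_ideal (ldim B) (kdim B) I"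
    using site_weil[OF B] .
  note g' = ideal_intoD(1)[OF g]
  have "(\<lambda>s. g s y) \<in> pullback_ideal (ldim B) (kdim B) I" for y
    using ideal_intoD(2)[OF g eval_dual_smooth_space[of 0 y]] I(2) by simp
  from pointwise_generic[OF I(1) g' this]
  have "(\<lambda>s. g s (s (sdim B))) \<in> pullback_ideal (ldim B) (Suc (kdim B)) I" .
  from generic_substitution[OF B B _ I(2) hom_id[OF B] \<xi> this] I(1)
  show ?thesis by (simp add: weil_ideal_def eval_extend[OF Cinf_intoD(2)[OF g']])
qed

lemma eval_ideal_cls:
  assumes B: "B \<in> site_obj" and fg: "(\<lambda>s. f s - g s) \<in> ideal_into B smooth_space" and \<xi>: "\<xi> \<in> Cinf (sdim B)"
  shows "cls B (\<lambda>s. f s (\<xi> s)) = cls B (\<lambda>s. g s (\<xi> s))"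
  using eval_ideal[OF B fg \<xi>] by (simp add: cls_eq[OF B])

text \<open>The chosen representatives of the family, of the morphism and of the element are
  exchanged for given ones, each time at the cost of an element of the ideal.\<close>

lemma h_exp_iso_cls:
  assumes A: "A \<in> site_obj" and B: "B \<in> site_obj" and u: "u \<in> Hom A B" and p: "lifts A B u p"
    and g: "g \<in> Cinf_into (sdim A) smooth_space" and \<xi>: "\<xi> \<in> Cinf (sdim B)"
  shows "h_exp_iso A (cls_into A smooth_space g) B u (cls B \<xi>) = cls B (\<lambda>s. g (\<lambda>i. p i s) (\<xi> s))"
proof -
  have X: "subspace (topspace smooth_space)" by (simp add: subspace_Cinf_line)
  let ?r = "rep (cls_into A smooth_space g)" and ?q = "\<lambda>i s. hom_map A u s i"
  have q: "lifts A B u ?q" by (rule lifts_hom_map[OF B u])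
  have 1: "(\<lambda>s. ?r (hom_map A u s) - g (hom_map A u s)) \<in> ideal_into B smooth_space"
    using ideal_into_compose[OF A B u q rep_cls_into(2)[OF A X g]] by simp
  have 2: "(\<lambda>s. g (hom_map A u s) - g (\<lambda>i. p i s)) \<in> ideal_into B smooth_space"
    using ideal_into_cong[OF B X g, of ?q p] q p by (simp add: lifts_def)
  let ?gp = "\<lambda>s. g (\<lambda>i. p i s)"
  have gp: "?gp \<in> Cinf_into (sdim B) smooth_space" by (rule Cinf_into_compose[OF g lifts_Cinf[OF p]])
  have eq: "cls_into B smooth_space (\<lambda>s. ?r (hom_map A u s)) = cls_into B smooth_space ?gp"
    by (rule cls_into_eqI[OF B X ideal_into_trans[OF B X 1 2]])
  have "h_exp_iso A (cls_into A smooth_space g) B u (cls B \<xi>) =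
    cls B (\<lambda>s. rep (cls_into B smooth_space ?gp) s (rep (cls B \<xi>) s))"
    using B u \<xi> by (simp add: h_exp_iso_def h_eval_def h_obj_def eq cls_carrier)
  also have "\<dots> = cls B (\<lambda>s. ?gp s (rep (cls B \<xi>) s))"
    by (rule eval_ideal_cls[OF B rep_cls_into(2)[OF B X gp] rep_cls_Cinf[OF B \<xi>]])
  also have "\<dots> = cls B (\<lambda>s. ?gp s (\<xi> s))"
    by (rule eval_cong[OF B g]) (use p \<xi> rep_cls_Cinf[OF B \<xi>] cls_rep_cls[OF B] in \<open>auto simp: lifts_def\<close>)
  finally show ?thesis .
qed

section \<open>The comparison map on families of test functions\<close>

lemma Cinf_into_test_smooth: "g \<in> Cinf_into n test_space \<Longrightarrow> g \<in> Cinf_into n smooth_space"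
  using dual_smooth_test unfolding Cinf_into_def by (auto simp: test_funs_iff)

lemma ideal_into_test_smooth: "g \<in> ideal_into A test_space \<Longrightarrow> g \<in> ideal_into A smooth_space"
  using dual_smooth_test Cinf_into_test_smooth unfolding ideal_into_def by blast

lemma h_test_incl_cls:
  assumes A: "A \<in> site_obj" and B: "B \<in> site_obj" and u: "u \<in> Hom A B" and p: "lifts A B u p"
    and g: "g \<in> Cinf_into (sdim A) test_space" and \<xi>: "\<xi> \<in> Cinf (sdim B)"
  shows "h_test_incl A (cls_into A test_space g) B u (cls B \<xi>) = cls B (\<lambda>s. g (\<lambda>i. p i s) (\<xi> s))"
proof -
  have X: "subspace (topspace smooth_space)" by (simp add: subspace_Cinf_line)
  have Y: "subspace (topspace test_space)" by (simp add: subspace_test_funs)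
  have "(\<lambda>s. rep (cls_into A test_space g) s - g s) \<in> ideal_into A smooth_space"
    by (rule ideal_into_test_smooth[OF rep_cls_into(2)[OF A Y g]])
  then have "h_map smooth_space (\<lambda>f. f) A (cls_into A test_space g) = cls_into A smooth_space g"
    unfolding h_map_def by (rule cls_into_eqI[OF A X])
  then show ?thesis
    unfolding h_test_incl_def using h_exp_iso_cls[OF A B u p Cinf_into_test_smooth[OF g] \<xi>] by simp
qed

lemma h_test_incl_undefined:
  "\<not> (B \<in> site_obj \<and> u \<in> Hom A B \<and> x \<in> carrier (alg B)) \<Longrightarrow> h_test_incl A c B u x = undefined"
  by (auto simp: h_test_incl_def h_exp_iso_def)

lemma h_test_incl_rep:
  assumes A: "A \<in> site_obj" and c: "c \<in> sec (h_obj test_space) A"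
    and B: "B \<in> site_obj" and u: "u \<in> Hom A B" and p: "lifts A B u p" and \<xi>: "\<xi> \<in> Cinf (sdim B)"
  shows "h_test_incl A c B u (cls B \<xi>) = cls B (\<lambda>s. rep c (\<lambda>i. p i s) (\<xi> s))"
proof -
  have Y: "subspace (topspace test_space)" by (simp add: subspace_test_funs)
  show ?thesis using h_test_incl_cls[OF A B u p h_sec(1)[OF A Y c] \<xi>] h_sec(2)[OF A Y c] by simp
qed

lemma h_test_incl_sec:
  assumes A: "A \<in> site_obj" and c: "c \<in> sec (h_obj test_space) A"
  shows "h_test_incl A c \<in> sec line_fun A"
proof -
  have Y: "subspace (topspace test_space)" by (simp add: subspace_test_funs)
  note g = Cinf_into_test_smooth[OF h_sec(1)[OF A Y c]]
  have 1: "h_test_incl A c B u x \<in> carrier (alg B)"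
    if B: "B \<in> site_obj" and u: "u \<in> Hom A B" and x: "x \<in> carrier (alg B)" for B u x
  proof -
    obtain \<xi> where \<xi>: "\<xi> \<in> Cinf (sdim B)" "x = cls B \<xi>" using x by (auto simp: carrier_alg)
    note p = lifts_hom_map[OF B u]
    show ?thesis unfolding \<xi>(2) h_test_incl_rep[OF A c B u p \<xi>(1)]
      by (rule cls_carrier[OF eval_Cinf[OF g lifts_Cinf[OF p] \<xi>(1)]])
  qed
  have 2: "h_test_incl A c C (hom_comp A v u) (v x) = v (h_test_incl A c B u x)"
    if B: "B \<in> site_obj" and C: "C \<in> site_obj" and u: "u \<in> Hom A B" and v: "v \<in> Hom B C"
      and x: "x \<in> carrier (alg B)" for B C u v x
  proof -
    obtain \<xi> where \<xi>: "\<xi> \<in> Cinf (sdim B)" "x = cls B \<xi>" using x by (auto simp: carrier_alg)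
    note p = lifts_hom_map[OF B u] and q = lifts_hom_map[OF C v]
    have vx: "v x = cls C (\<lambda>s. \<xi> (hom_map B v s))" using Hom_cls[OF B C v q \<xi>(1)] \<xi>(2) by simp
    have "(\<lambda>s. \<xi> (hom_map B v s)) \<in> Cinf (sdim C)" using Cinf_compose[OF \<xi>(1) lifts_Cinf[OF q]] by simp
    from h_test_incl_rep[OF A c C hom_comp_Hom[OF A B C u v] lifts_comp[OF A B C u v p q] this]
    have "h_test_incl A c C (hom_comp A v u) (v x) =
        cls C (\<lambda>s. rep c (hom_map A u (hom_map B v s)) (\<xi> (hom_map B v s)))" by (simp add: vx)
    also have "\<dots> = v (cls B (\<lambda>s. rep c (hom_map A u s) (\<xi> s)))"
      using Hom_cls[OF B C v q eval_Cinf[OF g lifts_Cinf[OF p] \<xi>(1)]] by simp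
    also have "\<dots> = v (h_test_incl A c B u x)"
      using h_test_incl_rep[OF A c B u p \<xi>(1)] by (simp add: \<xi>(2))
    finally show ?thesis .
  qed
  show ?thesis unfolding psh_exp_def using 1 2 h_test_incl_undefined by simp
qed

lemma h_test_incl_natural:
  assumes A: "A \<in> site_obj" and B: "B \<in> site_obj" and u: "u \<in> Hom A B" and c: "c \<in> sec (h_obj test_space) A"
  shows "h_test_incl B (act (h_obj test_space) A B u c) = act line_fun A B u (h_test_incl A c)"
proof (intro ext)
  fix C w x
  have Y: "subspace (topspace test_space)" by (simp add: subspace_test_funs)
  note g = h_sec(1)[OF A Y c] and p = lifts_hom_map[OF B u]
  have gp: "(\<lambda>s. rep c (hom_map A u s)) \<in> Cinf_into (sdim B) test_space"
    using Cinf_into_compose[OF g lifts_Cinf[OF p]] by simp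
  have act: "act (h_obj test_space) A B u c = cls_into B test_space (\<lambda>s. rep c (hom_map A u s))"
    by (simp add: h_obj_def)
  show "h_test_incl B (act (h_obj test_space) A B u c) C w x = act line_fun A B u (h_test_incl A c) C w x"
  proof (cases "C \<in> site_obj \<and> w \<in> Hom B C \<and> x \<in> carrier (alg C)")
    case True
    then have C: "C \<in> site_obj" and w: "w \<in> Hom B C" by blast+
    obtain \<xi> where \<xi>: "\<xi> \<in> Cinf (sdim C)" "x = cls C \<xi>" using True by (auto simp: carrier_alg)
    note q = lifts_hom_map[OF C w]
    show ?thesis
      using h_test_incl_cls[OF B C w q gp \<xi>(1)]
        h_test_incl_rep[OF A c C hom_comp_Hom[OF A B C u w] lifts_comp[OF A B C u w p q] \<xi>(1)] True
      by (simp add: act line_fun_act \<xi>(2))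
  next
    case False
    then show ?thesis using h_test_incl_undefined by (simp only: line_fun_act if_False)
  qed
qed

lemma seq_functional_sum:
  fixes m :: nat
  assumes \<phi>: "seq_functional V \<phi>" and f: "\<And>i. i < m \<Longrightarrow> f i \<in> V" and z: "(\<lambda>_. 0) \<in> V"
  shows "\<phi> (\<lambda>y. \<Sum>i<m. a i * f i y) = (\<Sum>i<m. a i * \<phi> (f i))"
proof -
  have lin: "(\<lambda>x. a * f x + b * g x) \<in> V" "\<phi> (\<lambda>x. a * f x + b * g x) = a * \<phi> f + b * \<phi> g"
    if "f \<in> V" "g \<in> V" for a b f g
    using \<phi> that unfolding seq_functional_def by blast+
  have "(\<lambda>y. \<Sum>i<j. a i * f i y) \<in> V \<and> \<phi> (\<lambda>y. \<Sum>i<j. a i * f i y) = (\<Sum>i<j. a i * \<phi> (f i))" if "j \<le> m" for j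
    using that
  proof (induction j)
    case 0
    then show ?case using lin[OF z z, of 0 0] z by simp
  next
    case (Suc j)
    then show ?case using lin[of "\<lambda>y. \<Sum>i<j. a i * f i y" "f j" 1 "a j"] f[of j] by simp
  qed
  then show ?thesis by blast
qed

text \<open>Locally in the parameters the supports lie in a fixed compact set, so that a presentation in the
  ideal of \<open>A \<times> R\<close> can be cut off before the functional is applied to its coefficients.\<close>

lemma pointwise_ideal_into_test:
  assumes A: "A \<in> site_obj" and D: "D \<in> Cinf_into (sdim A) test_space" and pt: "\<And>y. (\<lambda>s. D s y) \<in> sideal A"
  shows "D \<in> ideal_into A test_space"
  unfolding ideal_into_def
proof (intro CollectI conjI ballI D)
  fix \<phi> assume \<phi>: "\<phi> \<in> dual test_space"
  let ?l = "ldim A" and ?k = "kdim A" and ?n = "sdim A"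
  obtain I where I: "weil_ideal ?l I" "sideal A = pullback_ideal ?l ?k I" using site_weil[OF A] .
  have id: "ideal I (Cinf_ring ?l)" using I(1) by (simp add: weil_ideal_def)
  obtain r where r: "vanishing_ideal ?l r \<subseteq> I" using I(1) by (auto simp: weil_ideal_def)
  have \<phi>D: "(\<lambda>s. \<phi> (D s)) \<in> Cinf ?n" by (rule Cinf_intoD(3)[OF D \<phi>])
  have "(\<lambda>s. D s (s ?n)) \<in> pullback_ideal ?l (Suc ?k) I"
    using pointwise_generic[OF I(1) Cinf_into_test_smooth[OF D]] pt I(2) by simp
  then obtain m h k where hk: "\<And>i. i < (m::nat) \<Longrightarrow> h i \<in> I" "\<And>i. i < m \<Longrightarrow> k i \<in> Cinf (Suc ?n)"
    "(\<lambda>s. D s (s ?n)) = (\<lambda>s. \<Sum>i<m. h i s * k i s)"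
    unfolding pullback_ideal_def by auto
  have hl: "h i \<in> Cinf ?l" if "i < m" for i using ideal_Cinf[OF id hk(1)[OF that]] .
  have "fibre ?l (\<lambda>s. \<phi> (D s)) t \<in> I" for t
  proof -
    \<comment> \<open>The box has room for the point \<open>t\<close> and, by the summand
      \<open>1\<close>, for infinitesimal coordinates of absolute value below
      \<open>1\<close>.\<close>
    define R where "R = 1 + (\<Sum>i<?n. \<bar>t i\<bar>)"
    have tR: "\<bar>t i\<bar> \<le> R" if "i < ?n" for i
    proof -
      have "\<bar>t i\<bar> \<le> (\<Sum>i<?n. \<bar>t i\<bar>)" using that by (intro member_le_sum) auto
      then show ?thesis by (simp add: R_def)
    qed
    have R1: "1 \<le> R" unfolding R_def by (simp add: sum_nonneg)
    obtain N0 where N0: "\<And>s y. (\<forall>i<?n. \<bar>s i\<bar> \<le> R) \<Longrightarrow> \<bar>y\<bar> > N0 \<Longrightarrow> D s y = 0"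
      using test_family_bounded_support[OF D, of R] by blast
    define N where "N = max N0 0"
    have N: "N \<ge> 0" "\<And>s y. (\<forall>i<?n. \<bar>s i\<bar> \<le> R) \<Longrightarrow> \<bar>y\<bar> > N \<Longrightarrow> D s y = 0"
      using N0 by (auto simp: N_def)
    obtain \<kappa> where \<kappa>: "\<And>f n. f \<in> Cinf n \<Longrightarrow> (\<lambda>x. \<kappa> (f x)) \<in> Cinf n"
      "\<And>y. \<bar>y\<bar> \<le> N \<Longrightarrow> \<kappa> y = 1" "\<And>y. \<bar>y\<bar> > N + 1 \<Longrightarrow> \<kappa> y = 0"
      using cutoff[OF N(1)] by metis
    \<comment> \<open>Cutting off the coefficients brings their slices into one space of functions
      with common compact support; for parameters in the box the sum is unchanged.\<close>
    define K where "K i s = k i s * \<kappa> (s ?n)" for i s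
    have K: "K i \<in> Cinf (Suc ?n)" if "i < m" for i
      unfolding K_def using that by (intro Cinf_mult hk \<kappa> Cinf_coord) auto
    have K0: "K i s = 0" if "\<bar>s ?n\<bar> > N + 1" for i s using \<kappa>(3)[OF that] by (simp add: K_def)
    define \<psi> where "\<psi> i s = \<phi> (slice ?n (K i) s)" for i s
    have \<psi>: "\<psi> i \<in> Cinf ?n" if "i < m" for i
      using dual_test_family[OF \<phi> K[OF that] K0] unfolding \<psi>_def by blast
    let ?V = "test_funs_in {- (N + 1)..N + 1}"
    have V: "seq_functional ?V \<phi>" by (rule seq_functional_test[OF \<phi> compact_Icc])
    have KV: "slice ?n (K i) s \<in> ?V" if "i < m" for i s
      using slice_Cinf_line(1)[OF K[OF that], of s] K0
      unfolding test_funs_in_def slice_def by auto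
    have zV: "(\<lambda>_. 0) \<in> ?V"
      unfolding test_funs_in_def using Cinf_lineI(1)[of "\<lambda>_ _. 0" "\<lambda>_. 0"] by simp
    have \<phi>eq: "\<phi> (D s) = (\<Sum>i<m. h i s * \<psi> i s)" if s: "\<forall>i<?n. \<bar>s i\<bar> \<le> R" for s
    proof -
      have "D s y = (\<Sum>i<m. h i s * slice ?n (K i) s y)" for y
      proof -
        have hs: "h i (s(?n := y)) = h i s" if "i < m" for i
          by (rule depD[OF Cinf_dep[OF hl[OF that]]]) simp
        have Ds: "D (s(?n := y)) = D s" by (rule depD[OF Cinf_intoD(2)[OF D]]) simp
        have eq: "D s y = (\<Sum>i<m. h i s * k i (s(?n := y)))"
          using fun_cong[OF hk(3), of "s(?n := y)"] hs by (simp add: Ds)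
        have "D s y = D s y * \<kappa> y"
        proof (cases "\<bar>y\<bar> \<le> N")
          case False
          then show ?thesis using N(2)[OF s, of y] by simp
        qed (simp add: \<kappa>(2))
        also have "\<dots> = (\<Sum>i<m. h i s * slice ?n (K i) s y)"
          by (simp add: eq slice_def K_def sum_distrib_right mult.assoc)
        finally show ?thesis .
      qed
      then have "D s = (\<lambda>y. \<Sum>i<m. h i s * slice ?n (K i) s y)" by blast
      then show ?thesis using
          seq_functional_sum[where m = m and a = "\<lambda>i. h i s" and f = "\<lambda>i. slice ?n (K i) s", OF V KV zV] by (simp add: \<psi>_def)
    qed
    define F where "F x = (\<Sum>i<m. h i x * fibre ?l (\<psi> i) t x)" for x
    have F: "F \<in> I" unfolding F_def
      by (intro ideal_sum[OF id] ideal_mult[OF id] hk fibre_Cinf[of _ _ ?k] \<psi>) auto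
    \<comment> \<open>The identity for \<open>\<phi> (D s)\<close> holds on the box only, that is
      for infinitesimal coordinates near \<open>0\<close>; the Weil ideal absorbs the
      discrepancy.\<close>
    have "(\<lambda>x. fibre ?l (\<lambda>s. \<phi> (D s)) t x - F x) \<in> vanishing_ideal ?l r"
    proof (rule vanishing_near_zero)
      show "(\<lambda>x. fibre ?l (\<lambda>s. \<phi> (D s)) t x - F x) \<in> Cinf ?l"
        by (intro Cinf_diff fibre_Cinf[OF \<phi>D] ideal_Cinf[OF id F])
      show "open {y::pt. \<forall>i<?l. \<bar>y i - 0\<bar> < 1}" by (rule open_box)
      fix x :: pt assume "x \<in> {y. \<forall>i<?l. \<bar>y i - 0\<bar> < 1}"
      then have x: "\<bar>x i\<bar> < 1" if "i < ?l" for i using that by simp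
      let ?s = "\<lambda>i. if i < ?l then x i else t i"
      have "\<bar>?s i\<bar> \<le> R" if "i < ?n" for i using x[of i] tR[OF that] R1 by auto
      then have "\<phi> (D ?s) = (\<Sum>i<m. h i ?s * \<psi> i ?s)" by (intro \<phi>eq) blast
      moreover have "h i ?s = h i x" if "i < m" for i by (rule depD[OF Cinf_dep[OF hl[OF that]]]) simp
      ultimately show "fibre ?l (\<lambda>s. \<phi> (D s)) t x - F x = 0" by (simp add: fibre_def F_def)
    qed auto
    then have "(\<lambda>x. fibre ?l (\<lambda>s. \<phi> (D s)) t x - F x) \<in> I" using r by blast
    from ideal_add[OF id this F] show ?thesis by simp
  qed
  then show "(\<lambda>s. \<phi> (D s)) \<in> sideal A" using \<phi>D I(2) pullback_ideal_fibrewise[OF I(1)] by simp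
qed

text \<open>Equal images agree at the constant elements \<open>y\<close>, so the differences lie in
  the ideal pointwise; \<open>pointwise_ideal_into_test\<close> extends this to all functionals of
  \<open>test_space\<close>.\<close>

lemma h_test_incl_inj:
  assumes A: "A \<in> site_obj"
  shows "inj_on (h_test_incl A) (sec (h_obj test_space) A)"
proof (rule inj_onI)
  have Y: "subspace (topspace test_space)" by (simp add: subspace_test_funs)
  fix c d assume c: "c \<in> sec (h_obj test_space) A" and d: "d \<in> sec (h_obj test_space) A"
    and eq: "h_test_incl A c = h_test_incl A d"
  have "(\<lambda>s. rep c s - rep d s) \<in> ideal_into A test_space"
  proof (rule pointwise_ideal_into_test[OF A])
    show "(\<lambda>s. rep c s - rep d s) \<in> Cinf_into (sdim A) test_space"
      by (intro Cinf_into_diff h_sec A Y c d)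
    fix y
    have y: "(\<lambda>_. y) \<in> Cinf (sdim A)" by simp
    have "cls A (\<lambda>s. rep c s y) = cls A (\<lambda>s. rep d s y)"
      using h_test_incl_rep[OF A c A hom_id[OF A] y] h_test_incl_rep[OF A d A hom_id[OF A] y] eq by simp
    then show "(\<lambda>s. (rep c s - rep d s) y) \<in> sideal A" by (simp add: cls_eq[OF A])
  qed
  then show "c = d" using cls_into_eqI[OF A Y] h_sec(2)[OF A Y c] h_sec(2)[OF A Y d] by metis
qed

lemma psh_mono_h_test_incl: "psh_mono (h_obj test_space) line_fun h_test_incl"
  unfolding psh_mono_def psh_map_def
  using h_test_incl_sec h_test_incl_natural h_test_incl_inj by blast

section \<open>Functions of bounded support in the internal language\<close>

lemma sideal_vanishes:
  assumes A: "A \<in> site_obj" and f: "f \<in> sideal A" and x: "\<And>i. i < ldim A \<Longrightarrow> x i = 0"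
  shows "f x = 0"
proof -
  obtain I where I: "weil_ideal (ldim A) I" "sideal A = pullback_ideal (ldim A) (kdim A) I"
    using site_weil[OF A] .
  have "fibre (ldim A) f x \<in> I" using f I(2) pullback_ideal_fibrewise[OF I(1)] by blast
  then have "fibre (ldim A) f x (\<lambda>_. 0) = 0" by (rule weil_ideal_zero_at_0[OF I(1)])
  moreover have "(\<lambda>i. if i < ldim A then 0 else x i) = x" using x by auto
  ultimately show ?thesis by (simp add: fibre_def)
qed

text \<open>Members of the ideal vanish where the infinitesimal coordinates do, so positivity at
  these points does not depend on the representative.\<close>

lemma line_pos_iff:
  assumes A: "A \<in> site_obj" and f: "f \<in> Cinf (sdim A)"
  shows "cls A f \<in> line_pos A \<longleftrightarrow> (\<forall>x. (\<forall>i<ldim A. x i = 0) \<longrightarrow> f x > 0)"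
proof
  assume "cls A f \<in> line_pos A"
  then obtain h where h: "cls A f = cls A h" "\<And>x. (\<forall>i<ldim A. x i = 0) \<Longrightarrow> h x > 0"
    unfolding line_pos_def by blast
  have "f x - h x = 0" if "\<forall>i<ldim A. x i = 0" for x
    using sideal_vanishes[OF A, of "\<lambda>x. f x - h x" x] h(1) that by (simp add: cls_eq[OF A])
  then show "\<forall>x. (\<forall>i<ldim A. x i = 0) \<longrightarrow> f x > 0" using h(2) by fastforce
qed (use f in \<open>auto simp: line_pos_def\<close>)

text \<open>A power of an infinitesimal coordinate lies in the ideal of \<open>A\<close>, so the
  same power of its image lies in that of \<open>B\<close> and vanishes where the infinitesimal
  coordinates of \<open>B\<close> do.\<close>

lemma lifts_infinitesimal:
  assumes A: "A \<in> site_obj" and B: "B \<in> site_obj" and u: "u \<in> Hom A B" and p: "lifts A B u p"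
    and i: "i < ldim A" and x: "\<And>j. j < ldim B \<Longrightarrow> x j = 0"
  shows "p i x = 0"
proof -
  obtain I where I: "weil_ideal (ldim A) I" "sideal A = pullback_ideal (ldim A) (kdim A) I"
    using site_weil[OF A] .
  obtain r where r: "vanishing_ideal (ldim A) r \<subseteq> I" using I(1) by (auto simp: weil_ideal_def)
  have "(\<lambda>s. s i ^ r) \<in> vanishing_ideal (ldim A) r" using i by (intro vanishing_power) auto
  then have "(\<lambda>s. s i ^ r * 1) \<in> sideal A"
    unfolding I(2) pullback_ideal_fsums using r by (intro fsums_single) auto
  from lifts_sideal[OF A B u p this] have "(\<lambda>s. p i s ^ r) \<in> sideal B" by simp
  from sideal_vanishes[OF B this x] show ?thesis by simp
qed

lemma Hom_const:
  assumes "A \<in> site_obj" "B \<in> site_obj" "u \<in> Hom A B"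
  shows "u (cls A (\<lambda>_. c)) = cls B (\<lambda>_. c)"
  using Hom_cls[OF assms lifts_hom_map[OF assms(2,3)], of "\<lambda>_. c"] by simp

lemma cover_hom_cls:
  assumes "A \<in> site_obj" "open_embedding (kdim A) e" "f \<in> Cinf (sdim A)"
  shows "cover_hom A e (cls A f) = cls A (\<lambda>s. f (\<lambda>i. cover_map (ldim A) e i s))"
  unfolding cover_hom_induced by (rule induced_cls[OF assms(1,1) cover_map_ideal_map[OF assms(1,2)] assms(3)])

lemma cover_hom_Hom:
  assumes "A \<in> site_obj" "open_embedding (kdim A) e"
  shows "cover_hom A e \<in> Hom A A" "lifts A A (cover_hom A e) (cover_map (ldim A) e)"
  unfolding cover_hom_induced
  using induced_Hom[OF assms(1,1)] lifts_induced[OF assms(1,1)] cover_map_ideal_map[OF assms] by blast+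

lemma line_fun_act_chain:
  assumes A: "A \<in> site_obj" and C: "C \<in> site_obj" and D: "D \<in> site_obj"
    and u: "u \<in> Hom A A" and v: "v \<in> Hom A C" and w: "w \<in> Hom C D" and y: "y \<in> carrier (alg D)"
  shows "act line_fun C D w (act line_fun A C v (act line_fun A A u \<tau>)) D (hom_id D) y =
    \<tau> D (hom_comp A (hom_comp A (hom_comp C (hom_id D) w) v) u) y"
proof -
  have i: "hom_id D \<in> Hom D D" by (rule hom_id_Hom[OF D])
  have 1: "hom_comp C (hom_id D) w \<in> Hom C D" by (rule hom_comp_Hom[OF C D D w i])
  have 2: "hom_comp A (hom_comp C (hom_id D) w) v \<in> Hom A D" by (rule hom_comp_Hom[OF A C D v 1])
  show ?thesis by (simp add: line_fun_act D i 1 2 y)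
qed

text \<open>On each member of the cover, \<open>pos\<close> gives
  \<open>\<bar>\<xi>\<bar> > N\<close> at zero infinitesimal coordinates and hence on a
  neighbourhood, where the argument of \<open>g\<close> stays in the box of size \<open>R\<close>.
  There \<open>g\<close> vanishes, so the fibre lies in the Weil ideal.\<close>

lemma support_condition:
  assumes A: "A \<in> site_obj" and D: "D \<in> site_obj" and v: "v \<in> Hom A D" and p: "lifts A D v p"
    and g: "g \<in> Cinf_into (sdim A) test_space" and \<xi>: "\<xi> \<in> Cinf (sdim D)"
    and R: "1 \<le> R" "\<And>i. i < kdim A \<Longrightarrow> \<bar>q i\<bar> + 1 \<le> R"
    and N: "\<And>s y. (\<forall>i<sdim A. \<bar>s i\<bar> \<le> R) \<Longrightarrow> \<bar>y\<bar> > N \<Longrightarrow> g s y = 0"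
    and E: "\<And>e. e \<in> E \<Longrightarrow> open_embedding (kdim D) e" "(\<Union>e\<in>E. emb_image (kdim D) e) = UNIV"
    and pos: "\<And>e. e \<in> E \<Longrightarrow>
      cls D (\<lambda>s. - N - \<xi> (\<lambda>i. cover_map (ldim D) e i s)) \<in> line_pos D \<or>
      cls D (\<lambda>s. \<xi> (\<lambda>i. cover_map (ldim D) e i s) - N) \<in> line_pos D"
  shows "(\<lambda>s. g (\<lambda>i. cover_map (ldim A) (box_chart q) i (\<lambda>j. p j s)) (\<xi> s)) \<in> sideal D"
proof (rule cover_separated[OF D _ E(2)])
  let ?l = "ldim D" and ?P = "\<lambda>i s. cover_map (ldim A) (box_chart q) i (\<lambda>j. p j s)"
  have P: "?P i \<in> Cinf (sdim D)" if "i < sdim A" for i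
    using cover_map_Cinf[OF open_embedding_box_chart that] lifts_Cinf[OF p] by (rule Cinf_compose)
  show f: "(\<lambda>s. g (\<lambda>i. ?P i s) (\<xi> s)) \<in> Cinf (sdim D)"
    by (rule eval_Cinf[OF Cinf_into_test_smooth[OF g] P \<xi>])
  fix e assume e: "e \<in> E"
  let ?c = "\<lambda>s i. cover_map ?l e i s"
  let ?f = "\<lambda>s. g (\<lambda>i. ?P i (?c s)) (\<xi> (?c s))"
  have cC: "cover_map ?l e i \<in> Cinf (sdim D)" if "i < sdim D" for i by (rule cover_map_Cinf[OF E(1)[OF e] that])
  have fC: "?f \<in> Cinf (sdim D)" using f cC by (rule Cinf_compose)
  have \<xi>C: "(\<lambda>s. \<xi> (?c s)) \<in> Cinf (sdim D)" using \<xi> cC by (rule Cinf_compose)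
  have pC: "(\<lambda>s. p i (?c s)) \<in> Cinf (sdim D)" if "i < sdim A" for i
    using lifts_Cinf[OF p that] cC by (rule Cinf_compose)
  obtain I where I: "weil_ideal ?l I" "sideal D = pullback_ideal ?l (kdim D) I"
    using site_weil[OF D] .
  obtain r where r: "vanishing_ideal ?l r \<subseteq> I" using I(1) by (auto simp: weil_ideal_def)
  have "fibre ?l ?f t \<in> I" for t
  proof -
    define a where "a x = (\<lambda>i. if i < ?l then x i else t i)" for x :: pt
    have a: "continuous_on UNIV (\<lambda>x. h (a x))" if "h \<in> Cinf (sdim D)" for h
      using Cinf_continuous[OF fibre_Cinf[OF that, of t]] by (simp add: fibre_def a_def)
    have a0: "a (\<lambda>_. 0) j = 0" if "j < ?l" for j using that by (simp add: a_def)
    have c0: "?c (a (\<lambda>_. 0)) j = 0" if "j < ?l" for j using that by (simp add: cover_map_def a_def)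
    \<comment> \<open>Besides the strict inequality, \<open>U\<close> keeps the infinitesimal
      coordinates of the image below \<open>1\<close>; the other coordinates are bounded by the
      chart.\<close>
    define U where "U = {x. N < \<bar>\<xi> (?c (a x))\<bar>} \<inter> (\<Inter>i<ldim A. {x. \<bar>p i (?c (a x))\<bar> < 1})"
    have "open U" unfolding U_def
    proof (intro open_Int open_INT ballI)
      show "open {x. N < \<bar>\<xi> (?c (a x))\<bar>}"
        by (intro open_Collect_less continuous_on_const continuous_on_rabs a[OF \<xi>C])
      show "open {x. \<bar>p i (?c (a x))\<bar> < 1}" if "i \<in> {..<ldim A}" for i
        by (intro open_Collect_less continuous_on_const continuous_on_rabs a[OF pC]) (use that in simp)
    qed simp
    moreover have "(\<lambda>_. 0) \<in> U"
    proof -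
      have "- N - \<xi> (?c (a (\<lambda>_. 0))) > 0 \<or> \<xi> (?c (a (\<lambda>_. 0))) - N > 0"
        using pos[OF e] line_pos_iff[OF D Cinf_diff[OF Cinf_const \<xi>C]] line_pos_iff[OF D Cinf_diff[OF \<xi>C Cinf_const]] a0
        by blast
      moreover have "p i (?c (a (\<lambda>_. 0))) = 0" if "i < ldim A" for i
        by (rule lifts_infinitesimal[OF A D v p that c0])
      ultimately show ?thesis by (auto simp: U_def)
    qed
    moreover have "fibre ?l ?f t x = 0" if x: "x \<in> U" for x
    proof -
      have "\<bar>?P i (?c (a x))\<bar> \<le> R" if "i < sdim A" for i
      proof (cases "i < ldim A")
        case True
        then have "\<bar>p i (?c (a x))\<bar> < 1" using x by (auto simp: U_def)
        then show ?thesis using R(1) True by (simp add: cover_map_def)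
      next
        case False
        then have "i - ldim A < kdim A" using that by auto
        then have "\<bar>q (i - ldim A)\<bar> + 1 \<le> R" by (rule R(2))
        moreover have "\<bar>box_chart q y (i - ldim A) - q (i - ldim A)\<bar> < 1" for y by (rule box_chart_bounds)
        ultimately show ?thesis using False unfolding cover_map_def by (smt (verit))
      qed
      moreover have "\<bar>\<xi> (?c (a x))\<bar> > N" using x by (simp add: U_def)
      ultimately have "g (\<lambda>i. ?P i (?c (a x))) (\<xi> (?c (a x))) = 0" by (intro N) auto
      then show ?thesis by (simp add: fibre_def a_def)
    qed
    ultimately have "fibre ?l ?f t \<in> vanishing_ideal ?l r"
      by (intro vanishing_near_zero[OF fibre_Cinf[OF fC]]) auto
    then show ?thesis using r by blast
  qed
  then show "?f \<in> sideal D" unfolding I(2) pullback_ideal_fibrewise[OF I(1)] using fC by blast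
qed

lemma h_test_incl_internal_D:
  assumes A: "A \<in> site_obj" and c: "c \<in> sec (h_obj test_space) A"
  shows "h_test_incl A c \<in> internal_D A"
proof -
  have Y: "subspace (topspace test_space)" by (simp add: subspace_test_funs)
  note g = h_sec(1)[OF A Y c]
  let ?l = "ldim A" and ?k = "kdim A"
  define S where "S = {(A, cover_hom A e) |e. e \<in> range box_chart}"
  have "(\<Union>e\<in>range box_chart. emb_image ?k e) = UNIV"
    unfolding emb_image_box_chart[abs_def] image_image[symmetric]
  proof (intro equalityI subsetI UNIV_I)
    show "y \<in> (\<Union>e\<in>range box_chart. emb_image ?k e)" for y
      by (rule UN_I[of "box_chart y"]) (auto simp: emb_image_box_chart)
  qed
  then have S: "S \<in> covers A" unfolding covers_def S_def using open_embedding_box_chart by blast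
  have "bounded_support_fml A (h_test_incl A c)"
    unfolding bounded_support_fml_iff
  proof (rule bexI[OF _ S], clarify)
    fix B u assume "(B, u) \<in> S"
    then obtain q where B: "B = A" and u: "u = cover_hom A (box_chart q)" by (auto simp: S_def)
    note oe = open_embedding_box_chart[of ?k q]
    note uH = cover_hom_Hom[OF A oe, folded u]
    \<comment> \<open>The box contains the image of the chart around \<open>q\<close>, with
      infinitesimal coordinates of absolute value up to \<open>1\<close>.\<close>
    define R where "R = 1 + (\<Sum>i<?k. \<bar>q i\<bar>)"
    have R1: "1 \<le> R" by (simp add: R_def sum_nonneg)
    have Rq: "\<bar>q i\<bar> + 1 \<le> R" if "i < ?k" for i
    proof -
      have "\<bar>q i\<bar> \<le> (\<Sum>i<?k. \<bar>q i\<bar>)" using that by (intro member_le_sum) auto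
      then show ?thesis by (simp add: R_def)
    qed
    obtain N0 where N0: "\<And>s y. (\<forall>i<sdim A. \<bar>s i\<bar> \<le> R) \<Longrightarrow> \<bar>y\<bar> > N0 \<Longrightarrow> rep c s y = 0"
      using test_family_bounded_support[OF g, of R] by blast
    \<comment> \<open>At least \<open>1\<close>, so that the constant \<open>N\<close> is a positive
      element of the line.\<close>
    define N where "N = max N0 1"
    have N: "N > 0" "\<And>s y. (\<forall>i<sdim A. \<bar>s i\<bar> \<le> R) \<Longrightarrow> \<bar>y\<bar> > N \<Longrightarrow> rep c s y = 0"
      using N0 by (auto simp: N_def)
    let ?b = "cls A (\<lambda>_. N)"
    show "\<exists>b\<in>carrier (alg B). b \<ominus>\<^bsub>alg B\<^esub> \<zero>\<^bsub>alg B\<^esub> \<in> line_pos B \<and>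
      bounds_support A (h_test_incl A c) B u b"
      unfolding B bounds_support_def
    proof (intro bexI[of _ ?b] conjI ballI impI)
      show "?b \<in> carrier (alg A)" by (rule cls_carrier) simp
      show "?b \<ominus>\<^bsub>alg A\<^esub> \<zero>\<^bsub>alg A\<^esub> \<in> line_pos A"
        unfolding zero_alg[OF A] using N(1)
        by (subst minus_cls[OF A]) (auto simp: line_pos_iff[OF A])
      fix C v x D w assume C: "C \<in> site_obj" and v: "v \<in> Hom A C" and x: "x \<in> carrier (alg C)"
        and D: "D \<in> site_obj" and w: "w \<in> Hom C D"
        and T: "\<exists>T\<in>covers D. \<forall>(F, z)\<in>T.
          \<ominus>\<^bsub>alg F\<^esub> z (w (v ?b)) \<ominus>\<^bsub>alg F\<^esub> z (w x) \<in> line_pos F \<or>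
          z (w x) \<ominus>\<^bsub>alg F\<^esub> z (w (v ?b)) \<in> line_pos F"
      have wx: "w x \<in> carrier (alg D)" by (rule Hom_carrier[OF w x])
      then obtain \<xi> where \<xi>: "\<xi> \<in> Cinf (sdim D)" "w x = cls D \<xi>" by (auto simp: carrier_alg)
      have wvb: "w (v ?b) = cls D (\<lambda>_. N)" by (simp add: Hom_const[OF A C v] Hom_const[OF C D w])
      from T obtain T where T: "T \<in> covers D" and Tpos: "\<And>F z. (F, z) \<in> T \<Longrightarrow>
          \<ominus>\<^bsub>alg F\<^esub> z (w (v ?b)) \<ominus>\<^bsub>alg F\<^esub> z (w x) \<in> line_pos F \<or>
          z (w x) \<ominus>\<^bsub>alg F\<^esub> z (w (v ?b)) \<in> line_pos F" by blast
      obtain E where E: "T = {(D, cover_hom D e) |e. e \<in> E}" "\<And>e. e \<in> E \<Longrightarrow> open_embedding (kdim D) e"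
        "(\<Union>e\<in>E. emb_image (kdim D) e) = UNIV" using T unfolding covers_def by blast
      define v' where "v' = hom_comp A (hom_comp C (hom_id D) w) v"
      have v': "v' \<in> Hom A D" unfolding v'_def
        by (intro hom_comp_Hom[OF A C D v] hom_comp_Hom[OF C D D w] hom_id_Hom[OF D])
      note p = lifts_hom_map[OF D v']
      let ?p = "\<lambda>i s. hom_map A v' s i"
      have "(\<lambda>s. rep c (\<lambda>i. cover_map ?l (box_chart q) i (\<lambda>j. ?p j s)) (\<xi> s)) \<in> sideal D"
      proof (rule support_condition[OF A D v' p g \<xi>(1) R1 Rq N(2) E(2,3)])
        fix e assume e: "e \<in> E"
        let ?\<eta> = "\<lambda>s. \<xi> (\<lambda>i. cover_map (ldim D) e i s)"
        have \<eta>: "?\<eta> \<in> Cinf (sdim D)"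
          using \<xi>(1) cover_map_Cinf[OF E(2)[OF e]] by (rule Cinf_compose)
        have "cover_hom D e (w x) = cls D ?\<eta>" unfolding \<xi>(2) by (rule cover_hom_cls[OF D E(2)[OF e] \<xi>(1)])
        moreover have "cover_hom D e (w (v ?b)) = cls D (\<lambda>_. N)"
          unfolding wvb by (rule Hom_const[OF D D cover_hom_Hom(1)[OF D E(2)[OF e]]])
        ultimately have "\<ominus>\<^bsub>alg D\<^esub> cls D (\<lambda>_. N) \<ominus>\<^bsub>alg D\<^esub> cls D ?\<eta> \<in> line_pos D \<or>
            cls D ?\<eta> \<ominus>\<^bsub>alg D\<^esub> cls D (\<lambda>_. N) \<in> line_pos D"
          using Tpos[of D "cover_hom D e"] e E(1) by auto
        then show "cls D (\<lambda>s. - N - ?\<eta> s) \<in> line_pos D \<or> cls D (\<lambda>s. ?\<eta> s - N) \<in> line_pos D"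
          unfolding a_inv_cls[OF D Cinf_const] minus_cls[OF D Cinf_const \<eta>] minus_cls[OF D \<eta> Cinf_const] .
      qed auto
      then have z: "cls D (\<lambda>s. rep c (\<lambda>i. cover_map ?l (box_chart q) i (\<lambda>j. ?p j s)) (\<xi> s)) = \<zero>\<^bsub>alg D\<^esub>"
        by (simp add: zero_alg[OF D] cls_eq[OF D])
      have "h_test_incl A c D (hom_comp A v' u) (w x) = \<zero>\<^bsub>alg D\<^esub>"
        unfolding \<xi>(2) z[symmetric]
        using h_test_incl_rep[OF A c D hom_comp_Hom[OF A A D uH(1) v'] lifts_comp[OF A A D uH(1) v' uH(2) p] \<xi>(1)] by simp
      then show "act line_fun C D w (act line_fun A C v (act line_fun A A u (h_test_incl A c))) D (hom_id D) (w x) =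
         \<zero>\<^bsub>alg D\<^esub>"
        unfolding line_fun_act_chain[OF A C D uH(1) v w wx] v'_def .
    qed
  qed
  then show ?thesis using h_test_incl_sec[OF A c] by (simp add: internal_D_def extension_def)
qed

section \<open>From the internal formula to a smooth family of test functions\<close>

lemma generic_representation:
  assumes A: "A \<in> site_obj" and I: "weil_ideal (ldim A) I" "sideal A = pullback_ideal (ldim A) (kdim A) I"
    and \<tau>: "\<tau> \<in> sec line_fun A"
  shows "\<exists>F\<in>Cinf (Suc (sdim A)). \<forall>C v p \<xi>. C \<in> site_obj \<longrightarrow> v \<in> Hom A C \<longrightarrow> lifts A C v p \<longrightarrow> \<xi> \<in> Cinf (sdim C) \<longrightarrow>
    \<tau> C v (cls C \<xi>) = cls C (\<lambda>s. F (\<lambda>i. if i < sdim A then p i s else \<xi> s))"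
proof -
  let ?l = "ldim A" and ?n = "sdim A"
  have id: "ideal I (Cinf_ring ?l)" using I(1) by (simp add: weil_ideal_def)
  \<comment> \<open>A Yoneda argument: \<open>G\<close> is the product of \<open>A\<close> with the
    line. An element \<xi> at a stage over \<open>A\<close> is the image of the last coordinate
    under the substitution \<open>w\<close> below, so naturality determines \<tau> by its value
    \<open>F\<close> at \<open>G\<close>.\<close>
  define G where "G = \<lparr>ldim = ?l, kdim = Suc (kdim A), sideal = pullback_ideal ?l (Suc (kdim A)) I\<rparr>"
  have G: "G \<in> site_obj" unfolding site_obj_def G_def using I(1) by auto
  have sG: "sdim G = Suc ?n" by (simp add: G_def)
  have nat\<tau>: "\<And>B C u v x. B \<in> site_obj \<Longrightarrow> C \<in> site_obj \<Longrightarrow> u \<in> Hom A B \<Longrightarrow> v \<in> Hom B C \<Longrightarrow> x \<in> carrier (alg B) \<Longrightarrow>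
      \<tau> C (hom_comp A v u) (v x) = v (\<tau> B u x)"
    and car\<tau>: "\<And>B u x. B \<in> site_obj \<Longrightarrow> u \<in> Hom A B \<Longrightarrow> x \<in> carrier (alg B) \<Longrightarrow> \<tau> B u x \<in> carrier (alg B)"
    using \<tau> unfolding psh_exp_def by simp_all
  let ?c = "\<lambda>i (s::pt). s i"
  have im: "ideal_map A G ?c" unfolding ideal_map_def
  proof (intro conjI allI impI ballI)
    show "?c i \<in> Cinf (sdim G)" if "i < ?n" for i using that unfolding sG by (intro Cinf_coord) simp
    show "(\<lambda>s. f (\<lambda>i. s i)) \<in> sideal G" if "f \<in> sideal A" for f
      using fsums_mono[of f I "Cinf ?n" I "Cinf (Suc ?n)"] that Cinf_mono[of ?n "Suc ?n"]
      by (auto simp: G_def I(2) pullback_ideal_fsums)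
  qed
  define \<iota> where "\<iota> = induced A G ?c"
  have \<iota>: "\<iota> \<in> Hom A G" "lifts A G \<iota> ?c"
    unfolding \<iota>_def by (rule induced_Hom[OF A G im], rule lifts_induced[OF A G im])
  have xn: "(\<lambda>s. s ?n) \<in> Cinf (sdim G)" unfolding sG by (intro Cinf_coord) simp
  from car\<tau>[OF G \<iota>(1) cls_carrier[OF xn]] obtain F where F: "F \<in> Cinf (sdim G)" "\<tau> G \<iota> (cls G (\<lambda>s. s ?n)) = cls G F"
    by (auto simp: carrier_alg)
  have "\<tau> C v (cls C \<xi>) = cls C (\<lambda>s. F (\<lambda>i. if i < ?n then p i s else \<xi> s))"
    if C: "C \<in> site_obj" and v: "v \<in> Hom A C" and p: "lifts A C v p" and \<xi>: "\<xi> \<in> Cinf (sdim C)" for C v p \<xi>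
  proof -
    define q where "q i s = (if i < ?n then p i s else \<xi> s)" for i s
    have q: "ideal_map G C q" unfolding ideal_map_def
    proof (intro conjI allI impI ballI)
      show "q i \<in> Cinf (sdim C)" for i
        unfolding q_def[abs_def] by (rule Cinf_extend[OF lifts_Cinf[OF p] \<xi>])
      show "(\<lambda>s. f (\<lambda>i. q i s)) \<in> sideal C" if "f \<in> sideal G" for f
        unfolding q_def using that by (intro generic_substitution[OF A C id I(2) v p \<xi>]) (simp add: G_def)
    qed
    define w where "w = induced G C q"
    have w: "w \<in> Hom G C" "lifts G C w q"
      unfolding w_def by (rule induced_Hom[OF G C q], rule lifts_induced[OF G C q])
    have "hom_comp A w \<iota> = v"
    proof (rule Hom_eqI[OF A C hom_comp_Hom[OF A G C \<iota>(1) w(1)] lifts_comp[OF A G C \<iota>(1) w(1) \<iota>(2) w(2)] v])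
      have "q i = p i" if "i < ?n" for i using that by (auto simp: q_def)
      then show "lifts A C v (\<lambda>i s. q i s)" using p by (simp add: lifts_def)
    qed
    moreover have "w (cls G (\<lambda>s. s ?n)) = cls C \<xi>"
      using Hom_cls[OF G C w xn] by (simp add: q_def)
    ultimately have "\<tau> C v (cls C \<xi>) = w (cls G F)"
      using nat\<tau>[OF G C \<iota>(1) w(1) cls_carrier[OF xn]] F(2) by simp
    also have "\<dots> = cls C (\<lambda>s. F (\<lambda>i. q i s))" by (rule Hom_cls[OF G C w F(1)])
    finally show ?thesis by (simp add: q_def)
  qed
  then show ?thesis using F(1) unfolding sG by blast
qed

text \<open>The formula is tested on the elements \<open>y\<close> of the stage given by the Weil algebra alone.\<close>

lemma fibre_outside_bound:
  assumes A: "A \<in> site_obj" and I: "weil_ideal (ldim A) I" "sideal A = pullback_ideal (ldim A) (kdim A) I"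
    and F: "F \<in> Cinf (Suc (sdim A))"
    and \<tau>F: "\<And>C v p \<xi>. C \<in> site_obj \<Longrightarrow> v \<in> Hom A C \<Longrightarrow> lifts A C v p \<Longrightarrow> \<xi> \<in> Cinf (sdim C) \<Longrightarrow>
      \<tau> C v (cls C \<xi>) = cls C (\<lambda>s. F (\<lambda>i. if i < sdim A then p i s else \<xi> s))"
    and e: "open_embedding (kdim A) e" and b0: "b0 \<in> Cinf (sdim A)"
    and fml: "bounds_support A \<tau> A (cover_hom A e) (cls A b0)"
    and t: "\<And>i. i < kdim A \<Longrightarrow> t (ldim A + i) = e x i"
    and y: "\<bar>y\<bar> > b0 (\<lambda>i. if i < ldim A then 0 else x (i - ldim A))"
  shows "fibre (ldim A) F (t(sdim A := y)) \<in> I"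
proof -
  let ?l = "ldim A" and ?n = "sdim A"
  have id: "ideal I (Cinf_ring ?l)" using I(1) by (simp add: weil_ideal_def)
  \<comment> \<open>With \<open>kdim W = 0\<close> its ideal is \<open>I\<close> itself, so
    vanishing of a class at \<open>W\<close> says that a fibre lies in \<open>I\<close>.\<close>
  define W where "W = \<lparr>ldim = ?l, kdim = 0, sideal = pullback_ideal ?l 0 I\<rparr>"
  have W: "W \<in> site_obj" unfolding site_obj_def W_def using I(1) by auto
  have lW: "ldim W = ?l" "kdim W = 0" "sdim W = ?l" by (simp_all add: W_def)
  \<comment> \<open>The infinitesimal coordinates are kept and the others frozen at
    \<open>x\<close>, a preimage of the base point under the chart \<open>e\<close>.\<close>
  define ev where "ev i s = (if i < ?l then s i else x (i - ?l))" for i and s :: pt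
  have evC: "ev i \<in> Cinf ?l" for i unfolding ev_def[abs_def] by (cases "i < ?l") auto
  have evf: "(\<lambda>s. f (\<lambda>i. ev i s)) = fibre ?l f (\<lambda>i. x (i - ?l))" for f
    by (simp add: fibre_def ev_def)
  have fW: "f \<in> sideal W \<longleftrightarrow> f \<in> I" for f
  proof
    show "f \<in> sideal W" if "f \<in> I"
    proof -
      have "(\<lambda>s. f s * 1) \<in> fsums I (Cinf (?l + 0))" using that by (intro fsums_single) auto
      then show ?thesis by (simp add: W_def pullback_ideal_fsums)
    qed
    show "f \<in> I" if "f \<in> sideal W" using ideal_fsums[OF id] that by (simp add: W_def pullback_ideal_fsums)
  qed
  have im: "ideal_map A W ev" unfolding ideal_map_def evf
    using evC pullback_fibre[OF id] by (auto simp: lW fW I(2))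
  define v where "v = induced A W ev"
  have v: "v \<in> Hom A W" "lifts A W v ev"
    unfolding v_def by (rule induced_Hom[OF A W im], rule lifts_induced[OF A W im])
  note uH = cover_hom_Hom[OF A e]
  note iW = hom_id_Hom[OF W]
  have yC: "(\<lambda>_. y) \<in> Cinf (sdim W)" by simp
  have evb: "(\<lambda>s. b0 (\<lambda>i. ev i s)) \<in> Cinf (sdim W)" unfolding evf using fibre_Cinf[OF b0] by (simp add: lW)
  have vb: "v (cls A b0) = cls W (\<lambda>s. b0 (\<lambda>i. ev i s))" by (rule Hom_cls[OF A W v b0])
  have idW: "hom_id W (cls W f) = cls W f" if "f \<in> Cinf (sdim W)" for f
    using that by (simp add: hom_id_def cls_carrier)
  \<comment> \<open>The sign of the constant \<open>y\<close> decides the disjunction outright, so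
    the cover by the identity suffices.\<close>
  define T where "T = {(W, cover_hom W e) |e. e \<in> {\<lambda>x::pt. x}}"
  have T: "T \<in> covers W"
  proof -
    have "(\<Union>e\<in>{\<lambda>x::pt. x}. emb_image (kdim W) e) = UNIV" by (simp add: lW emb_image_def)
    then show ?thesis unfolding covers_def T_def using open_embedding_id by blast
  qed
  have cov: "cover_hom W (\<lambda>x. x) (cls W f) = cls W f" if "f \<in> Cinf (sdim W)" for f
  proof -
    have "cover_map (ldim W) (\<lambda>x. x) i s = s i" for i s by (simp add: cover_map_def)
    then show ?thesis using cover_hom_cls[OF W open_embedding_id that] by simp
  qed
  have bpos: "b0 (\<lambda>i. ev i s) = b0 (\<lambda>i. if i < ?l then 0 else x (i - ?l))" if "\<forall>i<?l. s i = 0" for s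
    using that by (auto simp: ev_def intro!: arg_cong[of _ _ b0])
  have pos: "cls W (\<lambda>s. - b0 (\<lambda>i. ev i s) - y) \<in> line_pos W \<or> cls W (\<lambda>s. y - b0 (\<lambda>i. ev i s)) \<in> line_pos W"
  proof (cases "y \<ge> 0")
    case True
    then have "cls W (\<lambda>s. y - b0 (\<lambda>i. ev i s)) \<in> line_pos W"
      unfolding line_pos_iff[OF W Cinf_diff[OF yC evb]] lW using y bpos by simp
    then show ?thesis ..
  next
    case False
    then have "cls W (\<lambda>s. - b0 (\<lambda>i. ev i s) - y) \<in> line_pos W"
      unfolding line_pos_iff[OF W Cinf_diff[OF Cinf_uminus[OF evb] yC]] lW using y bpos by simp
    then show ?thesis ..
  qed
  have prem: "\<exists>T\<in>covers W. \<forall>(F, z)\<in>T.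
          \<ominus>\<^bsub>alg F\<^esub> z (hom_id W (v (cls A b0))) \<ominus>\<^bsub>alg F\<^esub> z (hom_id W (cls W (\<lambda>_. y))) \<in> line_pos F \<or>
          z (hom_id W (cls W (\<lambda>_. y))) \<ominus>\<^bsub>alg F\<^esub> z (hom_id W (v (cls A b0))) \<in> line_pos F"
  proof (rule bexI[OF _ T], clarify)
    fix F z assume "(F, z) \<in> T"
      and n: "z (hom_id W (cls W (\<lambda>_. y))) \<ominus>\<^bsub>alg F\<^esub> z (hom_id W (v (cls A b0))) \<notin> line_pos F"
    then have F: "F = W" "z = cover_hom W (\<lambda>x. x)" by (auto simp: T_def)
    show "\<ominus>\<^bsub>alg F\<^esub> z (hom_id W (v (cls A b0))) \<ominus>\<^bsub>alg F\<^esub> z (hom_id W (cls W (\<lambda>_. y))) \<in> line_pos F"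
      using pos n unfolding F vb idW[OF evb] idW[OF yC] cov[OF evb] cov[OF yC]
        a_inv_cls[OF W evb] minus_cls[OF W Cinf_uminus[OF evb] yC] minus_cls[OF W yC evb] by blast
  qed
  have "act line_fun W W (hom_id W) (act line_fun A W v (act line_fun A A (cover_hom A e) \<tau>)) W (hom_id W)
      (hom_id W (cls W (\<lambda>_. y))) = \<zero>\<^bsub>alg W\<^esub>"
    using fml[unfolded bounds_support_def, rule_format, OF W v(1) cls_carrier[OF yC] W iW prem] .
  then have z: "\<tau> W (hom_comp A (hom_comp A (hom_comp W (hom_id W) (hom_id W)) v) (cover_hom A e)) (cls W (\<lambda>_. y)) = \<zero>\<^bsub>alg W\<^esub>"
    unfolding idW[OF yC] line_fun_act_chain[OF A W W uH(1) v(1) iW cls_carrier[OF yC]] .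
  have v': "hom_comp A (hom_comp W (hom_id W) (hom_id W)) v \<in> Hom A W"
    by (intro hom_comp_Hom[OF A W W v(1)] hom_comp_Hom[OF W W W iW iW])
  have l1: "lifts A W (hom_comp A (hom_comp W (hom_id W) (hom_id W)) v) ev"
    using lifts_comp[OF A W W v(1) hom_comp_Hom[OF W W W iW iW] v(2) lifts_comp[OF W W W iW iW lifts_id[OF W] lifts_id[OF W]]]
    by simp
  let ?P = "\<lambda>i s. cover_map ?l e i (\<lambda>j. ev j s)"
  let ?f = "\<lambda>s. F (\<lambda>i. if i < ?n then ?P i s else y)"
  have "cls W ?f = \<zero>\<^bsub>alg W\<^esub>"
    using \<tau>F[OF W hom_comp_Hom[OF A A W uH(1) v'] lifts_comp[OF A A W uH(1) v' uH(2) l1] yC] z by simp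
  then have "?f \<in> I" by (simp add: zero_alg[OF W] cls_eq[OF W] fW)
  moreover have "?f = fibre ?l F (t(?n := y))"
  proof
    fix s
    show "?f s = fibre ?l F (t(?n := y)) s" unfolding fibre_def
    proof (rule depD[OF Cinf_dep[OF F]])
      fix i assume i: "i < Suc ?n"
      show "(if i < ?n then ?P i s else y) = (if i < ?l then s i else (t(?n := y)) i)"
      proof (cases "i < ?l")
        case False
        have "(\<lambda>j. ev (?l + j) s) = x" by (simp add: ev_def)
        then show ?thesis using False i t[of "i - ?l"] by (auto simp: cover_map_def)
      qed (simp add: cover_map_def ev_def)
    qed
  qed
  ultimately show ?thesis by simp
qed

text \<open>On the image of a chart of the cover, the inverse chart turns a representative of
  \<open>b\<close>, taken at zero infinitesimal coordinates, into a continuous function \<beta>,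
  which stays below \<open>\<beta> t + 1\<close> near \<open>t\<close>.\<close>

lemma internal_D_locally_bounded:
  assumes A: "A \<in> site_obj" and I: "weil_ideal (ldim A) I" "sideal A = pullback_ideal (ldim A) (kdim A) I"
    and F: "F \<in> Cinf (Suc (sdim A))"
    and \<tau>F: "\<And>C v p \<xi>. C \<in> site_obj \<Longrightarrow> v \<in> Hom A C \<Longrightarrow> lifts A C v p \<Longrightarrow> \<xi> \<in> Cinf (sdim C) \<Longrightarrow>
      \<tau> C v (cls C \<xi>) = cls C (\<lambda>s. F (\<lambda>i. if i < sdim A then p i s else \<xi> s))"
    and fml: "bounded_support_fml A \<tau>"
  shows "\<exists>U N. open U \<and> t \<in> U \<and> (\<forall>t'\<in>U. \<forall>y. \<bar>y\<bar> > N \<longrightarrow> fibre (ldim A) F (t'(sdim A := y)) \<in> I)"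
proof -
  let ?l = "ldim A" and ?k = "kdim A" and ?n = "sdim A"
  obtain S where S: "S \<in> covers A" and bd: "\<And>B u. (B, u) \<in> S \<Longrightarrow> \<exists>b\<in>carrier (alg B). bounds_support A \<tau> B u b"
    using fml unfolding bounded_support_fml_iff by blast
  obtain E where E: "S = {(A, cover_hom A e) |e. e \<in> E}" "\<And>e. e \<in> E \<Longrightarrow> open_embedding ?k e"
    "(\<Union>e\<in>E. emb_image ?k e) = UNIV" using S unfolding covers_def by blast
  let ?sh = "\<lambda>(t::pt) j. t (?l + j)"
  obtain e where e: "e \<in> E" "?sh t \<in> emb_image ?k e" using E(3) by blast
  note oe = E(2)[OF e(1)]
  obtain b where b: "b \<in> carrier (alg A)" and fb: "bounds_support A \<tau> A (cover_hom A e) b"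
    using bd[of A "cover_hom A e"] e(1) E(1) by blast
  obtain b0 where b0: "b0 \<in> Cinf ?n" "b = cls A b0" using b by (auto simp: carrier_alg)
  obtain g where g: "\<And>i. i < ?k \<Longrightarrow> smooth_on ?k (emb_image ?k e) (\<lambda>y. g y i)"
    "\<And>x i. i < ?k \<Longrightarrow> g (e x) i = x i" and oI: "open (emb_image ?k e)"
    using oe unfolding open_embedding_def by blast
  have sh: "continuous_on UNIV ?sh"
    by (rule continuous_on_coordinatewise_then_product) (rule continuous_coord)
  define V where "V = ?sh -` emb_image ?k e"
  have V: "open V" unfolding V_def using oI sh by (simp add: continuous_on_open_vimage)
  have tV: "t \<in> V" using e(2) by (simp add: V_def)
  define \<beta> where "\<beta> t = b0 (\<lambda>i. if i < ?l then 0 else g (?sh t) (i - ?l))" for t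
  have "continuous_on V \<beta>" unfolding \<beta>_def
  proof (rule continuous_compose_pt[OF b0(1)])
    fix i assume i: "i < ?n"
    show "continuous_on V (\<lambda>t. if i < ?l then 0 else g (?sh t) (i - ?l))"
    proof (cases "i < ?l")
      case False
      with i have "i - ?l < ?k" by auto
      from g(1)[OF this] have "continuous_on (emb_image ?k e) (pds [] (\<lambda>y. g y (i - ?l)))"
        unfolding smooth_on_def by (metis empty_subsetI list.set(1))
      then have "continuous_on (emb_image ?k e) (\<lambda>y. g y (i - ?l))" by simp
      then have "continuous_on V (\<lambda>t. g (?sh t) (i - ?l))"
        by (rule continuous_on_compose2[OF _ continuous_on_subset[OF sh]]) (auto simp: V_def)
      then show ?thesis using False by simp
    qed simp
  qed
  then have "open (V \<inter> \<beta> -` {..<\<beta> t + 1})" using V by (rule continuous_open_preimage) simp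
  moreover have "fibre ?l F (t'(?n := y)) \<in> I" if t': "t' \<in> V \<inter> \<beta> -` {..<\<beta> t + 1}" and y: "\<bar>y\<bar> > \<beta> t + 1" for t' y
  proof -
    have "?sh t' \<in> emb_image ?k e" using t' by (simp add: V_def)
    then obtain x where x: "\<And>i. i < ?k \<Longrightarrow> t' (?l + i) = e x i" unfolding emb_image_def by blast
    have "b0 (\<lambda>i. if i < ?l then 0 else x (i - ?l)) = \<beta> t'"
      unfolding \<beta>_def
    proof (rule depD[OF Cinf_dep[OF b0(1)]])
      fix i assume i: "i < ?n"
      show "(if i < ?l then 0 else x (i - ?l)) = (if i < ?l then 0 else g (?sh t') (i - ?l))"
      proof (cases "i < ?l")
        case False
        with i have ik: "i - ?l < ?k" by auto
        have ex: "e x \<in> emb_image ?k e" unfolding emb_image_def by blast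
        have H: "\<forall>x\<in>emb_image ?k e. \<forall>y\<in>emb_image ?k e. (\<forall>i<?k. x i = y i) \<longrightarrow> g x (i - ?l) = g y (i - ?l)"
          using g(1)[OF ik] unfolding smooth_on_def by (rule conjunct1)
        have "g (?sh t') (i - ?l) = g (e x) (i - ?l)"
          by (rule H[THEN bspec, THEN bspec, THEN mp, OF \<open>?sh t' \<in> _\<close> ex]) (use x in simp)
        then show ?thesis using g(2)[OF ik] False by simp
      qed simp
    qed
    then have y': "\<bar>y\<bar> > b0 (\<lambda>i. if i < ?l then 0 else x (i - ?l))" using t' y by auto
    have fb': "bounds_support A \<tau> A (cover_hom A e) (cls A b0)" using fb b0(2) by simp
    show ?thesis by (rule fibre_outside_bound[where x = x, OF A I F \<tau>F oe b0(1) fb' x y'])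
  qed
  ultimately show ?thesis using tV
    by (intro exI[of _ "V \<inter> \<beta> -` {..<\<beta> t + 1}"] exI[of _ "\<beta> t + 1"]) auto
qed

text \<open>Finitely many of the neighbourhoods cover a compact box of parameters, and the sum of
  the absolute values of their bounds dominates each of them.\<close>

lemma internal_D_bounded:
  assumes dep: "dep (Suc n) F"
    and loc: "\<And>t. \<exists>U N. open U \<and> t \<in> U \<and> (\<forall>t'\<in>U. \<forall>y. \<bar>y\<bar> > N \<longrightarrow> fibre l F (t'(n := y)) \<in> I)"
  shows "\<exists>N\<ge>0. \<forall>t. (\<forall>i<n. \<bar>t i\<bar> \<le> M) \<longrightarrow> (\<forall>y. \<bar>y\<bar> > N \<longrightarrow> fibre l F (t(n := y)) \<in> I)"
proof -
  let ?K = "{s::pt. \<forall>i. \<bar>s i\<bar> \<le> (if i < n then M else 0)}"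
  obtain U N where UN: "\<And>t. open (U t)" "\<And>t. t \<in> U t"
    "\<And>t t' y. t' \<in> U t \<Longrightarrow> \<bar>y\<bar> > N t \<Longrightarrow> fibre l F (t'(n := y)) \<in> I"
    using loc by metis
  have cov: "?K \<subseteq> (\<Union>t\<in>?K. U t)" using UN(2) by blast
  obtain C where C: "C \<subseteq> ?K" "finite C" "?K \<subseteq> (\<Union>t\<in>C. U t)"
    by (rule compactE_image[OF compact_box UN(1) cov])
  define N' where "N' = (\<Sum>t\<in>C. \<bar>N t\<bar>)"
  have "fibre l F (t(n := y)) \<in> I" if t: "\<forall>i<n. \<bar>t i\<bar> \<le> M" and y: "\<bar>y\<bar> > N'" for t y
  proof -
    define t' where "t' i = (if i < n then t i else 0)" for i
    have "t' \<in> ?K" using t by (simp add: t'_def)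
    then obtain c where c: "c \<in> C" "t' \<in> U c" using C(3) by blast
    have "\<bar>N c\<bar> \<le> N'" unfolding N'_def using c(1) C(2) by (intro member_le_sum) auto
    then have "fibre l F (t'(n := y)) \<in> I" using y by (intro UN(3)[OF c(2)]) linarith
    moreover have "fibre l F (t'(n := y)) = fibre l F (t(n := y))"
      unfolding fibre_def by (rule ext, rule depD[OF dep]) (auto simp: t'_def less_Suc_eq)
    ultimately show ?thesis by simp
  qed
  moreover have "N' \<ge> 0" by (simp add: N'_def sum_nonneg)
  ultimately show ?thesis by blast
qed

text \<open>Smoothness is local in the parameters: near \<open>s0\<close> the majorant stays below
  \<open>G s0 + 1\<close>, so the slices have a common compact support, and after a cutoff
  \<open>dual_test_family\<close> applies.\<close>

lemma slice_into_test:
  assumes K: "K \<in> Cinf (Suc n)" and G: "G \<in> Cinf n" and z: "\<And>s. (s n)\<^sup>2 \<ge> G s + 1 \<Longrightarrow> K s = 0"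
  shows "slice n K \<in> Cinf_into n test_space"
  unfolding Cinf_into_def
proof (intro CollectI conjI allI impI ballI)
  have Gn: "G (s(n := y)) = G s" for s y by (rule depD[OF Cinf_dep[OF G]]) simp
  have big: "y\<^sup>2 \<ge> c" if "\<bar>y\<bar> \<ge> \<bar>c\<bar> + 1" for y c :: real
  proof -
    have "c \<le> 1 * (\<bar>c\<bar> + 1)" by simp
    also have "\<dots> \<le> (\<bar>c\<bar> + 1)\<^sup>2" unfolding power2_eq_square by (rule mult_right_mono) auto
    also have "\<dots> \<le> \<bar>y\<bar>\<^sup>2" using that by (intro power_mono) auto
    finally show ?thesis by simp
  qed
  show "range (slice n K) \<subseteq> topspace test_space"
  proof clarify
    fix s
    have "slice n K s y = 0" if "\<bar>y\<bar> > \<bar>G s + 1\<bar> + 1" for y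
      using z[of "s(n := y)"] big[of "G s + 1" y] that Gn by (simp add: slice_def)
    then show "slice n K s \<in> topspace test_space"
      using slice_Cinf_line(1)[OF K] unfolding topspace_test_space test_funs_iff by blast
  qed
  show dep: "slice n K x = slice n K y" if "\<forall>i<n. x i = y i" for x y
    unfolding slice_def by (rule ext, rule depD[OF Cinf_dep[OF K]]) (use that less_Suc_eq in auto)
  fix \<phi> assume \<phi>: "\<phi> \<in> dual test_space"
  show "(\<lambda>s. \<phi> (slice n K s)) \<in> Cinf n"
  proof (rule Cinf_local)
    show "dep n (\<lambda>s. \<phi> (slice n K s))"
      unfolding dep_def by (intro allI impI, rule arg_cong[of _ _ \<phi>], rule dep)
    fix s0
    \<comment> \<open>Chosen so that \<open>\<bar>y\<bar> > N\<close> forces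
      \<open>y\<^sup>2 \<ge> G s0 + 2\<close>, which exceeds \<open>G s + 1\<close> near
      \<open>s0\<close>.\<close>
    define N where "N = \<bar>G s0 + 2\<bar> + 1"
    have N: "N \<ge> 0" by (simp add: N_def)
    obtain \<kappa> where \<kappa>: "\<And>f n. f \<in> Cinf n \<Longrightarrow> (\<lambda>x. \<kappa> (f x)) \<in> Cinf n"
      "\<And>y. \<bar>y\<bar> \<le> N \<Longrightarrow> \<kappa> y = 1" "\<And>y. \<bar>y\<bar> > N + 1 \<Longrightarrow> \<kappa> y = 0"
      using cutoff[OF N] by metis
    let ?L = "\<lambda>s. K s * \<kappa> (s n)"
    have "?L \<in> Cinf (Suc n)" by (intro Cinf_mult K \<kappa> Cinf_coord) simp
    then have "(\<lambda>s. \<phi> (slice n ?L s)) \<in> Cinf n"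
      by (rule dual_test_family[OF \<phi>, of _ _ "N + 1"]) (simp add: \<kappa>(3))
    moreover have "slice n K s = slice n ?L s" if s: "G s < G s0 + 1" for s
    proof
      fix y
      show "slice n K s y = slice n ?L s y"
      proof (cases "\<bar>y\<bar> \<le> N")
        case False
        then have "y\<^sup>2 \<ge> G s0 + 2" by (intro big) (simp add: N_def)
        then have "K (s(n := y)) = 0" using s by (intro z) (simp add: Gn)
        then show ?thesis by (simp add: slice_def)
      qed (simp add: slice_def \<kappa>(2))
    qed
    moreover have "open {s. G s < G s0 + 1}"
      by (intro open_Collect_less continuous_on_const Cinf_continuous[OF G])
    ultimately show "\<exists>U h. open U \<and> s0 \<in> U \<and> h \<in> Cinf n \<and> (\<forall>y\<in>U. \<phi> (slice n K y) = h y)"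
      by (intro exI[of _ "{s. G s < G s0 + 1}"] exI[of _ "\<lambda>s. \<phi> (slice n ?L s)"]) simp
  qed
qed

lemma internal_D_h_test_incl:
  assumes A: "A \<in> site_obj" and \<tau>: "\<tau> \<in> internal_D A"
  shows "\<tau> \<in> h_test_incl A ` sec (h_obj test_space) A"
proof -
  let ?l = "ldim A" and ?k = "kdim A" and ?n = "sdim A"
  have \<tau>s: "\<tau> \<in> sec line_fun A" and fml: "bounded_support_fml A \<tau>"
    using \<tau> by (auto simp: internal_D_def extension_def)
  obtain I where I: "weil_ideal ?l I" "sideal A = pullback_ideal ?l ?k I" using site_weil[OF A] .
  have id: "ideal I (Cinf_ring ?l)" using I(1) by (simp add: weil_ideal_def)
  obtain F where F: "F \<in> Cinf (Suc ?n)" and \<tau>F: "\<And>C v p \<xi>. C \<in> site_obj \<Longrightarrow> v \<in> Hom A C \<Longrightarrow> lifts A C v p \<Longrightarrow>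
      \<xi> \<in> Cinf (sdim C) \<Longrightarrow> \<tau> C v (cls C \<xi>) = cls C (\<lambda>s. F (\<lambda>i. if i < ?n then p i s else \<xi> s))"
    using generic_representation[OF A I \<tau>s] by blast
  define P where "P M N \<longleftrightarrow> N \<ge> 0 \<and> (\<forall>t. (\<forall>i<?n. \<bar>t i\<bar> \<le> M) \<longrightarrow> (\<forall>y. \<bar>y\<bar> > N \<longrightarrow> fibre ?l F (t(?n := y)) \<in> I))"
    for M N
  have "\<forall>m. \<exists>N. P (real m) N"
    unfolding P_def
    using internal_D_bounded[OF Cinf_dep[OF F] internal_D_locally_bounded[OF A I F \<tau>F fml]] by blast
  then obtain B where PB: "\<forall>m. P (real m) (B m)" by (rule choice[THEN exE])
  have B: "B m \<ge> 0" "(\<forall>i<?n. \<bar>t i\<bar> \<le> real m) \<Longrightarrow> \<bar>y\<bar> > B m \<Longrightarrow> fibre ?l F (t(?n := y)) \<in> I" for m t y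
    using spec[OF PB, of m] unfolding P_def by blast+
  obtain G where G: "G \<in> Cinf ?n" "\<And>s. \<exists>m. (\<forall>i<?n. \<bar>s i\<bar> \<le> real m) \<and> G s \<ge> (B m)\<^sup>2"
    using smooth_majorant[of ?n B] by blast
  \<comment> \<open>Zero where the squared line variable is at most \<open>G\<close>, and one where
    it is at least \<open>G + 1\<close>. Thus \<open>K\<close> keeps \<open>F\<close> inside and
    vanishes outside.\<close>
  define w where "w s = smooth_step ((s ?n)\<^sup>2 - G s)" for s :: pt
  have GS: "G \<in> Cinf (Suc ?n)" using G(1) by (rule Cinf_mono[rotated]) simp
  have w: "w \<in> Cinf (Suc ?n)"
    unfolding w_def by (intro Cinf_smooth_step Cinf_diff Cinf_power Cinf_coord GS) simp
  define K where "K s = F s * (1 - w s)" for s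
  have K: "K \<in> Cinf (Suc ?n)" unfolding K_def by (intro Cinf_mult F Cinf_diff Cinf_const w)
  have g: "slice ?n K \<in> Cinf_into ?n test_space"
    by (rule slice_into_test[OF K G(1)]) (simp add: K_def w_def smooth_step_1)
  have Fw: "(\<lambda>s. F s * w s) \<in> pullback_ideal ?l (Suc ?k) I"
    unfolding pullback_ideal_fibrewise[OF I(1)]
  proof (intro conjI allI)
    show "(\<lambda>s. F s * w s) \<in> Cinf (?l + Suc ?k)" using Cinf_mult[OF F w] by simp
    fix t
    have eq: "fibre ?l (\<lambda>s. F s * w s) t = (\<lambda>x. fibre ?l F t x * fibre ?l w t x)"
      by (simp add: fibre_def)
    show "fibre ?l (\<lambda>s. F s * w s) t \<in> I"
    proof (cases "\<exists>x. fibre ?l w t x \<noteq> 0")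
      \<comment> \<open>\<open>G\<close> involves the infinitesimal coordinates too, so
        \<open>w\<close> may vary along the fibre. One point with nonzero \<open>w\<close> yields an
        \<open>m\<close> that bounds its coordinates and has \<open>B m < \<bar>t ?n\<bar>\<close>,
        which puts the whole fibre of \<open>F\<close> into \<open>I\<close>.\<close>
      case True
      then obtain x where x: "fibre ?l w t x \<noteq> 0" by blast
      define s where "s = (\<lambda>i. if i < ?l then x i else t i)"
      have "w s \<noteq> 0" using x by (simp add: fibre_def s_def)
      then have "(s ?n)\<^sup>2 > G s" using smooth_step_0[of "(s ?n)\<^sup>2 - G s"] by (force simp: w_def)
      moreover have "s ?n = t ?n" by (simp add: s_def)
      moreover obtain m where m: "\<forall>i<?n. \<bar>s i\<bar> \<le> real m" "G s \<ge> (B m)\<^sup>2" using G(2) by blast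
      ultimately have "(B m)\<^sup>2 < \<bar>t ?n\<bar>\<^sup>2" by simp
      then have "B m < \<bar>t ?n\<bar>" by (rule power2_less_imp_less) simp
      then have "fibre ?l F (s(?n := t ?n)) \<in> I" by (rule B(2)[OF m(1)])
      moreover have "fibre ?l F (s(?n := t ?n)) = fibre ?l F t"
        unfolding fibre_def by (rule ext, rule arg_cong[of _ _ F]) (auto simp: s_def)
      moreover have "fibre ?l w t \<in> Cinf ?l" by (rule fibre_Cinf[of _ _ "Suc ?k"]) (use w in simp)
      ultimately show ?thesis unfolding eq by (intro ideal_mult[OF id]) auto
    next
      case False
      then show ?thesis unfolding eq using ideal_zero[OF id] by simp
    qed
  qed
  define c where "c = cls_into A test_space (slice ?n K)"
  have c: "c \<in> sec (h_obj test_space) A" using g by (auto simp: h_obj_def c_def)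
  have "h_test_incl A c C v x = \<tau> C v x" for C v x
  proof (cases "C \<in> site_obj \<and> v \<in> Hom A C \<and> x \<in> carrier (alg C)")
    case True
    then have C: "C \<in> site_obj" and v: "v \<in> Hom A C" by blast+
    obtain \<xi> where \<xi>: "\<xi> \<in> Cinf (sdim C)" "x = cls C \<xi>" using True by (auto simp: carrier_alg)
    note p = lifts_hom_map[OF C v]
    let ?q = "\<lambda>i s. if i < ?n then hom_map A v s i else \<xi> s"
    have "slice ?n K (\<lambda>i. hom_map A v s i) (\<xi> s) = K (\<lambda>i. ?q i s)" for s
      unfolding slice_def by (rule depD[OF Cinf_dep[OF K]]) auto
    then have "h_test_incl A c C v x = cls C (\<lambda>s. K (\<lambda>i. ?q i s))"
      unfolding c_def \<xi>(2) h_test_incl_cls[OF A C v p g \<xi>(1)] by simp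
    also have "\<dots> = cls C (\<lambda>s. F (\<lambda>i. ?q i s))"
    proof -
      have "(\<lambda>s. - (F (\<lambda>i. ?q i s) * w (\<lambda>i. ?q i s))) \<in> sideal C"
        by (rule ideal_uminus[OF site_ideal[OF C] generic_substitution[OF A C id I(2) v p \<xi>(1) Fw]])
      then show ?thesis by (simp add: cls_eq[OF C] K_def algebra_simps)
    qed
    also have "\<dots> = \<tau> C v x" using \<tau>F[OF C v p \<xi>(1)] \<xi>(2) by simp
    finally show ?thesis .
  next
    case False
    then have "\<tau> C v x = undefined" using \<tau>s unfolding psh_exp_def by simp
    then show ?thesis using h_test_incl_undefined[OF False] by simp
  qed
  then have "h_test_incl A c = \<tau>" by (intro ext)
  then show ?thesis using c by blast
qed

theorem theorem7p1:
  shows "psh_mono (h_obj test_space) line_fun h_test_incl \<and>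
         (\<forall>A\<in>site_obj. h_test_incl A ` sec (h_obj test_space) A = internal_D A)"
proof (intro conjI ballI equalityI subsetI)
  show "psh_mono (h_obj test_space) line_fun h_test_incl" by (rule psh_mono_h_test_incl)
  fix A \<tau> assume A: "A \<in> site_obj"
  show "\<tau> \<in> internal_D A" if "\<tau> \<in> h_test_incl A ` sec (h_obj test_space) A"
    using that h_test_incl_internal_D[OF A] by blast
  show "\<tau> \<in> h_test_incl A ` sec (h_obj test_space) A" if "\<tau> \<in> internal_D A"
    using A that by (rule internal_D_h_test_incl)
qed

end
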